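(* Let $r \geq 2$, $k \geq 3$ and suppose that $H_1,\dots,H_r$ are non-empty $k$-graphs such that $m_k(H_1) \geq m_k(H_2) \geq \cdots \geq m_k(H_r)$ and $m_k(H_2)>1$. Suppose that for some heart $(H_1',H_2')$ of $(H_1,H_2)$ at least one of the following holds: (i) $\chi(H_2') \geq k+1$; (ii) $m(H_2')>\binom{v(H_1)}{k-2}+1$. Then there exists a constant $b>0$ such that, for every $p=p(n)$ with $p \leq bn^{-1/m_k(H_1,H_2)}$, $$\lim_{n\to\infty}\mathbb{P}[G^k_{n,p}\to(H_1,\dots,H_r)]=0.$$
   Context: A $k$-graph is a finite $k$-uniform hypergraph; it is non-empty if it has at least one edge; $v(H),e(H)$ are the numbers of vertices and edges; $J \subseteq H$ means $J$ is a (not necessarily induced) subhypergraph. $G^k_{n,p}$ is the binomial random $k$-graph on $n$ vertices with edge probability $p$. $G \to (H_1,\dots,H_r)$ means: for every colouring of the edges of $G$ with colours from $\{1,\dots,r\}$ there is $i$ and a copy of $H_i$ in $G$ all of whose edges have colour $i$. Densities: $d(H)=e(H)/v(H)$ if $v(H)\ge 1$ and $0$ otherwise; $m(H)=\max\{d(J):J\subseteq H\}$. $d_k(H)=(e(H)-1)/(v(H)-k)$ if $H$ is non-empty with $v(H)\geq k+1$, $d_k(H)=1/k$ if $H\cong K_k$ (a single edge on $k$ vertices), and $d_k(H)=0$ otherwise; $m_k(H)=\max\{d_k(J):J\subseteq H\}$. $H$ is strictly $k$-balanced if $d_k(J)<m_k(H)$ for all proper subhypergraphs $J\subsetneq H$.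 For $k$-graphs with $m_k(H_1)\geq m_k(H_2)$: $d_k(H_1,H_2)=\frac{e(H_1)}{v(H_1)-k+1/m_k(H_2)}$ if $H_2$ is non-empty and $v(H_1)\geq k$, and $0$ otherwise (the same formula defines $d_k(J,H_2)$ for $J\subseteq H_1$); $m_k(H_1,H_2)=\max\{d_k(J,H_2):J\subseteq H_1\}$. $H_1$ is strictly balanced with respect to $d_k(\cdot,H_2)$ if $d_k(J,H_2)<m_k(H_1,H_2)$ for all proper $J\subsetneq H_1$. Heart: a pair $(H_1,H_2)$ with $m_k(H_1)\geq m_k(H_2)$ is a heart if $H_2$ is strictly $k$-balanced; $H_1$ is strictly $k$-balanced when $m_k(H_1)=m_k(H_2)$; and $H_1$ is strictly balanced with respect to $d_k(\cdot,H_2)$ when $m_k(H_1)>m_k(H_2)$. A heart of $(H_1,H_2)$ is a heart $(H_1',H_2')$ with $H_i'\subseteq H_i$ for $i=1,2$, $m_k(H_2')=m_k(H_2)$, $m_k(H_1',H_2')=m_k(H_1,H_2)$ if $m_k(H_1)>m_k(H_2)$, and $m_k(H_1')=m_k(H_1)$ if $m_k(H_1)=m_k(H_2)$. $\chi(H)$ is the weak chromatic number: the minimum $t$ such that the vertices of $H$ can be $t$-coloured with no monochromatic edge. *)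

theory Defs
  imports "HOL-Probability.Probability"
begin

datatype 'a hypergraph = Hypergraph (verts: "'a set") (edges: "'a set set")

definition kgraph :: "nat \<Rightarrow> 'a hypergraph \<Rightarrow> bool" where
  "kgraph k H \<longleftrightarrow> finite (verts H) \<and> (\<forall>e\<in>edges H. e \<subseteq> verts H \<and> card e = k)"

definition nonempty :: "'a hypergraph \<Rightarrow> bool" where
  "nonempty H \<longleftrightarrow> edges H \<noteq> {}"

definition vc :: "'a hypergraph \<Rightarrow> nat" where
  "vc H = card (verts H)"

definition ec :: "'a hypergraph \<Rightarrow> nat" where
  "ec H = card (edges H)"

definition subhypergraph :: "'a hypergraph \<Rightarrow> 'a hypergraph \<Rightarrow> bool" where
  "subhypergraph J H \<longleftrightarrow>
     verts J \<subseteq> verts H \<and> edges J \<subseteq> edges H \<and> (\<forall>e\<in>edges J. e \<subseteq> verts J)"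

definition isomorphic :: "'a hypergraph \<Rightarrow> 'b hypergraph \<Rightarrow> bool" where
  "isomorphic H J \<longleftrightarrow>
     (\<exists>f. bij_betw f (verts H) (verts J) \<and> (\<lambda>e. f ` e) ` edges H = edges J)"

definition arrows :: "'b hypergraph \<Rightarrow> nat \<Rightarrow> (nat \<Rightarrow> 'a hypergraph) \<Rightarrow> bool" where
  "arrows G r H \<longleftrightarrow>
     (\<forall>c :: 'b set \<Rightarrow> nat. c ` edges G \<subseteq> {1..r} \<longrightarrow>
        (\<exists>i\<in>{1..r}. \<exists>J. subhypergraph J G \<and> isomorphic (H i) J \<and> (\<forall>e\<in>edges J. c e = i)))"

definition dens :: "'a hypergraph \<Rightarrow> real" where
  "dens H = (if vc H \<ge> 1 then real (ec H) / real (vc H) else 0)"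

definition max_dens :: "'a hypergraph \<Rightarrow> real" where
  "max_dens H = Max {dens J |J. subhypergraph J H}"

text \<open>The condition \<open>edges H = {verts H}\<close> together with \<open>vc H = k\<close> says that \<open>H\<close> is a single
  edge on \<open>k\<close> vertices, i.e. a copy of \<open>K\<^sub>k\<close>.\<close>

definition dens_k :: "nat \<Rightarrow> 'a hypergraph \<Rightarrow> real" where
  "dens_k k H =
     (if nonempty H \<and> vc H \<ge> k + 1 then (real (ec H) - 1) / (real (vc H) - real k)
      else if vc H = k \<and> edges H = {verts H} then 1 / real k
      else 0)"

definition max_dens_k :: "nat \<Rightarrow> 'a hypergraph \<Rightarrow> real" where
  "max_dens_k k H = Max {dens_k k J |J. subhypergraph J H}"

definition strictly_k_balanced :: "nat \<Rightarrow> 'a hypergraph \<Rightarrow> bool" where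
  "strictly_k_balanced k H \<longleftrightarrow>
     (\<forall>J. subhypergraph J H \<and> J \<noteq> H \<longrightarrow> dens_k k J < max_dens_k k H)"

text \<open>The asymmetric densities are total functions here; they are only meaningful for
  \<open>max_dens_k k H1 \<ge> max_dens_k k H2\<close>.\<close>

definition dens_k2 :: "nat \<Rightarrow> 'a hypergraph \<Rightarrow> 'b hypergraph \<Rightarrow> real" where
  "dens_k2 k H1 H2 =
     (if nonempty H2 \<and> vc H1 \<ge> k
      then real (ec H1) / (real (vc H1) - real k + 1 / max_dens_k k H2)
      else 0)"

definition max_dens_k2 :: "nat \<Rightarrow> 'a hypergraph \<Rightarrow> 'b hypergraph \<Rightarrow> real" where
  "max_dens_k2 k H1 H2 = Max {dens_k2 k J H2 |J. subhypergraph J H1}"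

definition strictly_balanced_wrt :: "nat \<Rightarrow> 'a hypergraph \<Rightarrow> 'b hypergraph \<Rightarrow> bool" where
  "strictly_balanced_wrt k H1 H2 \<longleftrightarrow>
     (\<forall>J. subhypergraph J H1 \<and> J \<noteq> H1 \<longrightarrow> dens_k2 k J H2 < max_dens_k2 k H1 H2)"

definition heart :: "nat \<Rightarrow> 'a hypergraph \<Rightarrow> 'b hypergraph \<Rightarrow> bool" where
  "heart k H1 H2 \<longleftrightarrow>
     kgraph k H1 \<and> kgraph k H2 \<and> max_dens_k k H1 \<ge> max_dens_k k H2 \<and>
     strictly_k_balanced k H2 \<and>
     (max_dens_k k H1 = max_dens_k k H2 \<longrightarrow> strictly_k_balanced k H1) \<and>
     (max_dens_k k H1 > max_dens_k k H2 \<longrightarrow> strictly_balanced_wrt k H1 H2)"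

definition heart_of ::
  "nat \<Rightarrow> 'a hypergraph \<Rightarrow> 'b hypergraph \<Rightarrow> 'a hypergraph \<Rightarrow> 'b hypergraph \<Rightarrow> bool" where
  "heart_of k H1' H2' H1 H2 \<longleftrightarrow>
     heart k H1' H2' \<and> subhypergraph H1' H1 \<and> subhypergraph H2' H2 \<and>
     max_dens_k k H2' = max_dens_k k H2 \<and>
     (max_dens_k k H1 > max_dens_k k H2 \<longrightarrow> max_dens_k2 k H1' H2' = max_dens_k2 k H1 H2) \<and>
     (max_dens_k k H1 = max_dens_k k H2 \<longrightarrow> max_dens_k k H1' = max_dens_k k H1)"

definition weak_colouring :: "'a hypergraph \<Rightarrow> nat \<Rightarrow> ('a \<Rightarrow> nat) \<Rightarrow> bool" where
  "weak_colouring H t c \<longleftrightarrow>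
     c ` verts H \<subseteq> {..<t} \<and> \<not> (\<exists>e\<in>edges H. \<exists>s. \<forall>v\<in>e. c v = s)"

definition weak_chromatic :: "'a hypergraph \<Rightarrow> nat" where
  "weak_chromatic H = (LEAST t. \<exists>c. weak_colouring H t c)"

definition all_edges :: "nat \<Rightarrow> nat \<Rightarrow> nat set set" where
  "all_edges k n = {e. e \<subseteq> {..<n} \<and> card e = k}"

definition random_kgraph :: "nat \<Rightarrow> nat \<Rightarrow> real \<Rightarrow> nat hypergraph pmf" where
  "random_kgraph k n p =
     map_pmf (\<lambda>b. Hypergraph {..<n} {e \<in> all_edges k n. b e})
       (Pi_pmf (all_edges k n) False (\<lambda>_. bernoulli_pmf p))"

text \<open>The maxima and the minimum above are attained.\<close>

lemma finite_subhypergraphs: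
  assumes "kgraph k H"
  shows "finite {J. subhypergraph J H}"
proof (rule finite_subset)
  show "{J. subhypergraph J H} \<subseteq>
      (\<lambda>(V, E). Hypergraph V E) ` (Pow (verts H) \<times> Pow (Pow (verts H)))"
  proof
    fix J assume "J \<in> {J. subhypergraph J H}"
    then have "(verts J, edges J) \<in> Pow (verts H) \<times> Pow (Pow (verts H))"
      by (auto simp: subhypergraph_def)
    then have "(\<lambda>(V, E). Hypergraph V E) (verts J, edges J) \<in>
        (\<lambda>(V, E). Hypergraph V E) ` (Pow (verts H) \<times> Pow (Pow (verts H)))"
      by (rule imageI)
    then show "J \<in> (\<lambda>(V, E). Hypergraph V E) ` (Pow (verts H) \<times> Pow (Pow (verts H)))"
      by simp
  qed
  show "finite ((\<lambda>(V, E). Hypergraph V E) ` (Pow (verts H) \<times> Pow (Pow (verts H))))"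
    using assms by (simp add: kgraph_def)
qed

lemma subhypergraph_refl: "kgraph k H \<Longrightarrow> subhypergraph H H"
  by (auto simp: subhypergraph_def kgraph_def)

lemma weak_colouring_exists:
  assumes "kgraph k H" and "k \<ge> 2"
  shows "\<exists>c. weak_colouring H (vc H) c"
proof -
  obtain c where c: "bij_betw c (verts H) {0..<vc H}"
    using assms ex_bij_betw_finite_nat unfolding kgraph_def vc_def by blast
  have "\<not> (\<forall>v\<in>e. c v = s)" if e: "e \<in> edges H" for e s
  proof
    assume *: "\<forall>v\<in>e. c v = s"
    have "e \<subseteq> verts H" "card e = k"
      using e assms(1) by (auto simp: kgraph_def)
    moreover have "inj_on c e"
      using c \<open>e \<subseteq> verts H\<close> by (meson bij_betw_def inj_on_subset)
    ultimately have "card (c ` e) = k"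
      by (simp add: card_image)
    moreover have "card (c ` e) \<le> card {s}"
      using * by (intro card_mono) auto
    ultimately show False
      using assms(2) by simp
  qed
  moreover have "c ` verts H \<subseteq> {..<vc H}"
    using c by (auto simp: bij_betw_def)
  ultimately show ?thesis
    by (auto simp: weak_colouring_def)
qed

end

theory Submission
  imports Defs "HOL-Real_Asymp.Real_Asymp"
begin

text \<open>
  Let \<open>\<theta> = m\<^sub>k(H\<^sub>1, H\<^sub>2)\<close>, \<open>\<alpha> = 1/\<theta>\<close>, \<open>m = m\<^sub>k(H\<^sub>2)\<close>, and for an edge set \<open>S\<close> let
  \<open>\<lambda>(S) = v(S) - \<alpha> e(S)\<close> (called \<open>excess\<close> below), so that the expected number of copies of \<open>S\<close> at \<open>p = b n\<^sup>-\<^sup>\<alpha>\<close> is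
  about \<open>b\<^bsup>e(S)\<^esup> n\<^bsup>\<lambda>(S)\<^esup>\<close>. If a graph has no good colouring, pick a minimal system of copies
  of the heart that witnesses this and let \<open>C\<close> be the union of its edges. Starting from a single
  edge, \<open>C\<close> is exposed by bounded steps: a step adds a copy of \<open>H\<^sub>1'\<close> meeting the exposed part, or
  a copy of \<open>H\<^sub>2'\<close>, in the case \<open>\<theta> > m\<close> together with, for each of its new edges \<open>f\<close>, a copy of \<open>H\<^sub>1'\<close> meeting it
  exactly in \<open>f\<close>. Balancedness shows that \<open>\<lambda>\<close> never increases, and stays constant only if the new
  part is glued on along one edge. A first moment computation over all such explorations shows that
  with high probability no \<open>C\<close> with \<open>\<lambda>(C) < 0\<close> occurs. If \<open>\<lambda>(C) \<ge> 0\<close>, monotonicity along the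
  exploration started at an arbitrary \<open>S \<subseteq> C\<close> gives \<open>e(S) \<le> \<theta> v(S)\<close> for all \<open>S \<subseteq> C\<close>, and a
  deterministic argument colours \<open>C\<close>: under (i), partition the vertices into \<open>k\<close> classes without a
  copy of \<open>H\<^sub>1'\<close> inside classes and give the crossing edges the second colour; under (ii), orient the
  edges towards vertices with bounded in-degree and give a bounded number at every vertex the second
  colour.
\<close>

section \<open>Explorations\<close>

text \<open>The set \<open>C\<close> may be arbitrarily large, so a union bound over all
  \<open>C\<close> is hopeless. Explorations are therefore cut off after about
  \<open>(k + 1) * log 2 n\<close> steps: either \<open>C\<close> is complete, with excess bounded
  away from 0, or the factor 1/2 gained in each step beats \<open>n ^ k\<close>. Steps that preserve
  the excess gain no power of n, so their choices must be bounded by a constant, which the constant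
  in p pays for. Steps that lower it have polylogarithmically many choices, paid by a power of n; as
  1/\<theta> is rational, such a drop is never arbitrarily small.

  The compound step answers to \<theta> > m: glued along one edge, a copy of H2' alone raises the
  excess, because 1/\<theta> < 1/m. But the excess of H1' for 1/\<theta> and that of H2' for 1/m
  have the same value \<kappa> = k - 1/m. Hanging a copy of H1' on an edge that is not yet counted
  contributes \<kappa> - k = -1/m, so H2' with such copies on its new edges behaves like H2' at its
  own density m. Minimality of the system supplies these copies.\<close>

definition excess :: "real \<Rightarrow> 'v set set \<Rightarrow> real" where
  "excess \<alpha> S = real (card (\<Union>S)) - \<alpha> * real (card S)"

text \<open>\<open>e\<close> is the edge at which the step is attached. In the alternative without a
  strict drop, the new edges touch old vertices only inside \<open>e\<close>; this locality is what
  makes the number of such steps bounded.\<close>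

definition grow :: "real \<Rightarrow> nat \<Rightarrow> 'v set set \<Rightarrow> 'v set \<Rightarrow> 'v set set \<Rightarrow> bool" where
  "grow \<alpha> M S e T \<longleftrightarrow> S \<subset> T \<and> card T \<le> card S + M \<and>
     (excess \<alpha> T < excess \<alpha> S \<or> excess \<alpha> T \<le> excess \<alpha> S \<and> \<Union>(T - S) \<inter> \<Union>S \<subseteq> e)"

text \<open>\<open>\<D>\<close> stands for the copies in the system. Steps are demanded from every
  \<open>S \<subseteq> C\<close>, so that an exploration may start anywhere, and at every edge from
  which some \<open>D\<close> leaves \<open>S\<close>, so that the bookkeeping and not
  \<open>C\<close> decides where to attach next.\<close>

definition explorable :: "real \<Rightarrow> nat \<Rightarrow> 'v set set \<Rightarrow> bool" where
  "explorable \<alpha> M C \<longleftrightarrow> finite C \<and> C \<noteq> {} \<and> (\<exists>\<D>.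
     (\<forall>S. S \<noteq> {} \<and> S \<subset> C \<longrightarrow> (\<exists>D\<in>\<D>. D \<inter> S \<noteq> {} \<and> \<not> D \<subseteq> S)) \<and>
     (\<forall>S D e. S \<subseteq> C \<and> D \<in> \<D> \<and> e \<in> D \<inter> S \<and> \<not> D \<subseteq> S \<longrightarrow> (\<exists>T\<subseteq>C. grow \<alpha> M S e T)))"

lemma explorable_excess_le:
  assumes "explorable \<alpha> M C" "S \<noteq> {}" "S \<subseteq> C"
  shows "excess \<alpha> C \<le> excess \<alpha> S"
proof -
  obtain \<D> where conn: "\<And>S. S \<noteq> {} \<Longrightarrow> S \<subset> C \<Longrightarrow> \<exists>D\<in>\<D>. D \<inter> S \<noteq> {} \<and> \<not> D \<subseteq> S"
    and step: "\<And>S D e. S \<subseteq> C \<Longrightarrow> D \<in> \<D> \<Longrightarrow> e \<in> D \<inter> S \<Longrightarrow> \<not> D \<subseteq> S \<Longrightarrow> \<exists>T\<subseteq>C. grow \<alpha> M S e T"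
    and fin: "finite C"
    using assms(1) unfolding explorable_def by metis
  show ?thesis using assms(2,3)
  proof (induction "card (C - S)" arbitrary: S rule: less_induct)
    case less
    show ?case
    proof (cases "S = C")
      case False
      then obtain D e where D: "D \<in> \<D>" "e \<in> D \<inter> S" "\<not> D \<subseteq> S"
        using conn[of S] less.prems by blast
      then obtain T where T: "T \<subseteq> C" "grow \<alpha> M S e T"
        using step[of S D e] less.prems by auto
      then have "S \<subset> T" "excess \<alpha> T \<le> excess \<alpha> S" by (auto simp: grow_def)
      moreover have "card (C - T) < card (C - S)"
        using fin T(1) \<open>S \<subset> T\<close> by (intro psubset_card_mono) auto
      then have "excess \<alpha> C \<le> excess \<alpha> T"
        using less.hyps[of T] T(1) \<open>S \<subset> T\<close> by auto
      ultimately show ?thesis by simp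
    qed simp
  qed
qed

section \<open>Exploration states and how they follow a given edge set\<close>

definition neutral :: "nat \<Rightarrow> nat \<Rightarrow> real \<Rightarrow> nat \<Rightarrow> nat set set \<Rightarrow> nat set \<Rightarrow> nat set set set" where
  "neutral n k \<alpha> M S e = {T. S \<subset> T \<and> T \<subseteq> all_edges k n \<and> card T \<le> card S + M \<and>
     excess \<alpha> T \<le> excess \<alpha> S \<and> \<Union>(T - S) \<inter> \<Union>S \<subseteq> e}"

definition degenerate :: "nat \<Rightarrow> nat \<Rightarrow> real \<Rightarrow> nat \<Rightarrow> real \<Rightarrow> nat set set \<Rightarrow> nat set set set" where
  "degenerate n k \<alpha> M \<delta> S = {T. S \<subset> T \<and> T \<subseteq> all_edges k n \<and> card T \<le> card S + M \<and>
     excess \<alpha> T \<le> excess \<alpha> S - \<delta>}"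

text \<open>Any rule would do, provided the edge depends on the state alone: the counting then never
  pays for choosing an edge of \<open>S\<close>.\<close>

definition select_edge :: "'v set set \<Rightarrow> 'v set set \<Rightarrow> 'v set" where
  "select_edge S U = (SOME e. e \<in> S - U)"

definition successors :: "nat \<Rightarrow> nat \<Rightarrow> real \<Rightarrow> nat \<Rightarrow> real \<Rightarrow> nat set set \<times> nat set set
    \<Rightarrow> (nat set set \<times> nat set set) set" where
  "successors n k \<alpha> M \<delta> x = (case x of (S, U) \<Rightarrow>
     (if S \<subseteq> U then {} else {(S, insert (select_edge S U) U)} \<union>
        (\<lambda>T. (T, U)) ` neutral n k \<alpha> M S (select_edge S U) \<union> (\<lambda>T. (T, U)) ` degenerate n k \<alpha> M \<delta> S))"

text \<open>
  In a state \<open>(S, U)\<close>, \<open>S\<close> is the exposed edge set and \<open>U \<subseteq> S\<close> collects the edges at which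
  nothing further is to be attached. Attaching at a prescribed edge outside \<open>U\<close> keeps the number of
  excess-preserving successors bounded, instead of proportional to \<open>card S\<close>.
\<close>

primrec states :: "nat \<Rightarrow> nat \<Rightarrow> real \<Rightarrow> nat \<Rightarrow> real \<Rightarrow> nat \<Rightarrow> (nat set set \<times> nat set set) set" where
  "states n k \<alpha> M \<delta> 0 = (\<lambda>e. ({e}, {})) ` all_edges k n"
| "states n k \<alpha> M \<delta> (Suc i) = (\<Union>x\<in>states n k \<alpha> M \<delta> i. successors n k \<alpha> M \<delta> x)"

lemma finite_all_edges: "finite (all_edges k n)"
  unfolding all_edges_def by (rule finite_subset[of _ "Pow {..<n}"]) auto

lemma finite_neutral: "finite (neutral n k \<alpha> M S e)"
  by (rule finite_subset[of _ "Pow (all_edges k n)"]) (auto simp: neutral_def finite_all_edges)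

lemma finite_degenerate: "finite (degenerate n k \<alpha> M \<delta> S)"
  by (rule finite_subset[of _ "Pow (all_edges k n)"]) (auto simp: degenerate_def finite_all_edges)

lemma select_edge_in: "\<not> S \<subseteq> U \<Longrightarrow> select_edge S U \<in> S - U"
  unfolding select_edge_def by (rule someI_ex) auto

lemma states_invariant:
  assumes "(S, U) \<in> states n k \<alpha> M \<delta> i" "\<delta> \<ge> 0"
  shows "S \<subseteq> all_edges k n \<and> U \<subseteq> S \<and> card S \<le> Suc (i * M) \<and> excess \<alpha> S \<le> k - \<alpha>"
  using assms(1)
proof (induction i arbitrary: S U)
  case 0
  then show ?case by (auto simp: excess_def all_edges_def)
next
  case (Suc i)
  then obtain S0 U0 where 0: "(S0, U0) \<in> states n k \<alpha> M \<delta> i" "(S, U) \<in> successors n k \<alpha> M \<delta> (S0, U0)"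
    by auto
  note IH = Suc.IH[OF 0(1)]
  have nsub: "\<not> S0 \<subseteq> U0" using 0(2) by (auto simp: successors_def)
  note s = select_edge_in[OF nsub]
  from 0(2) nsub consider "S = S0" "U = insert (select_edge S0 U0) U0"
    | "U = U0" "S \<in> neutral n k \<alpha> M S0 (select_edge S0 U0)" | "U = U0" "S \<in> degenerate n k \<alpha> M \<delta> S0"
    by (auto simp: successors_def)
  then show ?case
    using IH s assms(2) by cases (auto simp: neutral_def degenerate_def)
qed

lemma finite_states: "finite (states n k \<alpha> M \<delta> i)"
proof (induction i)
  case (Suc i)
  then show ?case by (auto simp: successors_def finite_neutral finite_degenerate split: prod.split)
qed (simp add: finite_all_edges)

text \<open>The run follows \<open>C\<close> and puts an edge into \<open>U\<close> only once every
  member of \<open>\<D>\<close> through it lies in \<open>S\<close>. While \<open>S\<close> is a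
  proper part of \<open>C\<close>, some member meets \<open>S\<close> and leaves it, and the edges
  where they meet are outside \<open>U\<close>; so the run can stop only at \<open>C\<close> itself.
  \<open>gap\<close> turns strict drops into steps counted by \<open>degenerate\<close>.\<close>

lemma explorable_reached:
  assumes "explorable \<alpha> M C" "C \<subseteq> all_edges k n"
    and gap: "\<And>(S :: nat set set) (T :: nat set set). excess \<alpha> T < excess \<alpha> S \<Longrightarrow> excess \<alpha> T \<le> excess \<alpha> S - \<delta>"
  shows "(\<exists>j\<le>i. \<exists>U\<subseteq>C. (C, U) \<in> states n k \<alpha> M \<delta> j) \<or>
    (\<exists>S U. S \<subseteq> C \<and> (S, U) \<in> states n k \<alpha> M \<delta> i)"
proof -
  obtain \<D> where conn: "\<And>S. S \<noteq> {} \<Longrightarrow> S \<subset> C \<Longrightarrow> \<exists>D\<in>\<D>. D \<inter> S \<noteq> {} \<and> \<not> D \<subseteq> S"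
    and step: "\<And>S D e. S \<subseteq> C \<Longrightarrow> D \<in> \<D> \<Longrightarrow> e \<in> D \<inter> S \<Longrightarrow> \<not> D \<subseteq> S \<Longrightarrow> \<exists>T\<subseteq>C. grow \<alpha> M S e T"
    and fin: "finite C" and ne: "C \<noteq> {}"
    using assms(1) unfolding explorable_def by metis
  define dead where "dead S U \<longleftrightarrow> (\<forall>e\<in>U. \<forall>D\<in>\<D>. e \<in> D \<longrightarrow> D \<subseteq> S)" for S U
  have dead_mono: "dead T U" if "dead S U" "S \<subseteq> T" for S T U
    using that unfolding dead_def by blast
  have "(\<exists>j\<le>i. \<exists>U\<subseteq>C. (C, U) \<in> states n k \<alpha> M \<delta> j) \<or>
    (\<exists>S U. S \<subseteq> C \<and> (S, U) \<in> states n k \<alpha> M \<delta> i \<and> S \<noteq> {} \<and> U \<subseteq> S \<and> dead S U)"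
  proof (induction i)
    case 0
    from ne obtain e where "e \<in> C" by auto
    then have "{e} \<subseteq> C" "({e}, {}) \<in> states n k \<alpha> M \<delta> 0" "dead {e} {}"
      using assms(2) by (auto simp: dead_def)
    then show ?case by blast
  next
    case (Suc i)
    then consider j U where "j \<le> i" "U \<subseteq> C" "(C, U) \<in> states n k \<alpha> M \<delta> j"
      | S U where "S \<subset> C" "(S, U) \<in> states n k \<alpha> M \<delta> i" "S \<noteq> {}" "U \<subseteq> S" "dead S U"
      by (metis le_refl psubsetI)
    then show ?case
    proof cases
      case 1
      then show ?thesis by (meson le_SucI)
    next
      case (2 S U)
      then obtain D where D: "D \<in> \<D>" "D \<inter> S \<noteq> {}" "\<not> D \<subseteq> S" using conn[of S] by blast
      have nsub: "\<not> S \<subseteq> U" using D 2(5) unfolding dead_def by blast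
      define e where "e = select_edge S U"
      have e: "e \<in> S" "e \<notin> U" using select_edge_in[OF nsub] by (auto simp: e_def)
      show ?thesis
      proof (cases "dead S (insert e U)")
        case True
        have "(S, insert e U) \<in> states n k \<alpha> M \<delta> (Suc i)"
          using 2(2) nsub by (auto simp: successors_def e_def intro!: bexI[of _ "(S, U)"])
        then show ?thesis using True 2 e by blast
      next
        case False
        then obtain D where "D \<in> \<D>" "e \<in> D" "\<not> D \<subseteq> S" using 2(5) by (auto simp: dead_def)
        then obtain T where T: "T \<subseteq> C" "grow \<alpha> M S e T" using step[of S D e] e 2(1) by auto
        have "T \<in> neutral n k \<alpha> M S e \<union> degenerate n k \<alpha> M \<delta> S"
          using T assms(2) gap[of T S] by (auto simp: grow_def neutral_def degenerate_def)
        then have "(T, U) \<in> states n k \<alpha> M \<delta> (Suc i)"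
          using 2(2) nsub by (auto simp: successors_def e_def intro!: bexI[of _ "(S, U)"])
        moreover have "T \<noteq> {}" "U \<subseteq> T" "dead T U"
          using T(2) 2 dead_mono[of S U T] by (auto simp: grow_def)
        ultimately show ?thesis using T(1) by blast
      qed
    qed
  qed
  then show ?thesis by blast
qed

section \<open>Counting the extensions of an exposed edge set\<close>

lemma binomial_le_power: "n choose k \<le> n ^ k"
  by (cases "k \<le> n") (auto intro: binomial_le_pow simp: binomial_eq_0)

lemma card_small_subsets:
  assumes "finite Q"
  shows "finite {X. X \<subseteq> Q \<and> card X \<le> M} \<and> card {X. X \<subseteq> Q \<and> card X \<le> M} \<le> (card Q + 1) ^ M"
proof (induction M)
  case 0
  have "{X. X \<subseteq> Q \<and> card X \<le> 0} = {{}}" using assms by (auto dest: finite_subset)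
  then show ?case by simp
next
  case (Suc M)
  let ?A = "\<lambda>M. {X. X \<subseteq> Q \<and> card X \<le> M}"
  let ?f = "\<lambda>(x, X). case x of None \<Rightarrow> X | Some a \<Rightarrow> insert a X"
  have sub: "?A (Suc M) \<subseteq> ?f ` (insert None (Some ` Q) \<times> ?A M)"
  proof
    fix X assume X: "X \<in> ?A (Suc M)"
    show "X \<in> ?f ` (insert None (Some ` Q) \<times> ?A M)"
    proof (cases "card X \<le> M")
      case True
      then show ?thesis using X by (intro image_eqI[of _ _ "(None, X)"]) auto
    next
      case False
      then obtain a where a: "a \<in> X" by fastforce
      have "finite X" using X assms finite_subset by blast
      then show ?thesis using X a
        by (intro image_eqI[of _ _ "(Some a, X - {a})"]) (auto simp: insert_absorb)
    qed
  qed
  have fin: "finite (insert None (Some ` Q) \<times> ?A M)" using Suc assms by auto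
  have "card (?A (Suc M)) \<le> card (insert None (Some ` Q) \<times> ?A M)"
    using sub fin by (rule surj_card_le[rotated])
  also have "\<dots> = (card Q + 1) * card (?A M)"
    using assms by (simp add: card_cartesian_product card_image)
  also have "\<dots> \<le> (card Q + 1) * (card Q + 1) ^ M" using Suc by (intro mult_le_mono2) simp
  also have "\<dots> = (card Q + 1) ^ Suc M" by simp
  finally show ?case using finite_subset[OF sub] fin by blast
qed

lemma card_Union_edges_le:
  assumes "finite S" "\<And>e. e \<in> S \<Longrightarrow> card e \<le> k"
  shows "card (\<Union>S) \<le> k * card S"
proof -
  have "card (\<Union>S) \<le> (\<Sum>e\<in>S. card e)" by (rule card_Union_le_sum_card)
  also have "\<dots> \<le> card S * k" using assms(2) sum_bounded_above[of S card k] by simp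
  finally show ?thesis by (simp add: mult.commute)
qed

lemma card_Union_diff_eq:
  assumes "S \<subseteq> T" "finite T" "\<And>e. e \<in> T \<Longrightarrow> finite e"
  shows "card (\<Union>T) = card (\<Union>S) + card (\<Union>T - \<Union>S)"
proof -
  have "finite (\<Union>T)" "\<Union>S \<subseteq> \<Union>T" using assms by auto
  then show ?thesis
    by (metis card_Diff_subset card_mono finite_subset le_add_diff_inverse)
qed

lemma all_edgesD: "e \<in> all_edges k n \<Longrightarrow> finite e \<and> card e = k \<and> e \<subseteq> {..<n}"
  unfolding all_edges_def by (auto intro: finite_subset)

text \<open>Extensions are grouped by the set \<open>N\<close> of their new vertices. There are at
  most \<open>n ^ x\<close> sets of size \<open>x\<close>, which the summand
  \<open>1 / n ^ x\<close> cancels, so each of the \<open>k * M + 1\<close> possible sizes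
  contributes at most \<open>Q\<close>.\<close>

lemma extension_sum_le:
  fixes Q :: nat
  assumes n: "n \<ge> 1" and S: "S \<subseteq> all_edges k n"
    and P: "\<And>T. T \<in> P \<Longrightarrow> S \<subset> T \<and> T \<subseteq> all_edges k n \<and> card T \<le> card S + M"
    and fibre: "\<And>N. finite N \<Longrightarrow> card N \<le> k * M \<Longrightarrow> card {T \<in> P. \<Union>T - \<Union>S = N} \<le> Q"
  shows "(\<Sum>T\<in>P. 1 / real n ^ card (\<Union>T - \<Union>S)) \<le> real (k * M + 1) * real Q"
proof -
  have finS: "finite S" using S finite_all_edges finite_subset by blast
  have finP: "finite P"
    by (rule finite_subset[of _ "Pow (all_edges k n)"]) (use P finite_all_edges in auto)
  define NN where "NN = {N. N \<subseteq> {..<n} \<and> card N \<le> k * M}"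
  have finNN: "finite NN" unfolding NN_def by (rule finite_subset[of _ "Pow {..<n}"]) auto
  have sub: "(\<lambda>T. \<Union>T - \<Union>S) ` P \<subseteq> NN"
  proof (rule image_subsetI)
    fix T assume "T \<in> P"
    note T = P[OF this]
    have finT: "finite T" using T finite_all_edges finite_subset by blast
    have "card (T - S) = card T - card S" using T finS by (intro card_Diff_subset) auto
    then have "card (T - S) \<le> M" using T by linarith
    have "\<Union>T - \<Union>S \<subseteq> \<Union>(T - S)" by auto
    moreover have "finite (\<Union>(T - S))" using finT T all_edgesD by blast
    ultimately have "card (\<Union>T - \<Union>S) \<le> card (\<Union>(T - S))" by (intro card_mono)
    also have "\<dots> \<le> k * card (T - S)"
    proof (rule card_Union_edges_le)
      show "card e \<le> k" if "e \<in> T - S" for e using that T all_edgesD[of e k n] by auto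
    qed (use finT in simp)
    also have "\<dots> \<le> k * M" using \<open>card (T - S) \<le> M\<close> by simp
    finally have "card (\<Union>T - \<Union>S) \<le> k * M" .
    moreover have "\<Union>T \<subseteq> {..<n}" using T unfolding all_edges_def by fast
    ultimately show "\<Union>T - \<Union>S \<in> NN" unfolding NN_def by blast
  qed
  have "(\<Sum>T\<in>P. 1 / real n ^ card (\<Union>T - \<Union>S)) =
      (\<Sum>N\<in>NN. \<Sum>T\<in>{T \<in> P. \<Union>T - \<Union>S = N}. 1 / real n ^ card (\<Union>T - \<Union>S))"
    by (rule sum.group[OF finP finNN sub, symmetric])
  also have "\<dots> = (\<Sum>N\<in>NN. real (card {T \<in> P. \<Union>T - \<Union>S = N}) * (1 / real n ^ card N))"
    by (intro sum.cong refl) simp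
  also have "\<dots> \<le> (\<Sum>N\<in>NN. real Q * (1 / real n ^ card N))"
  proof (intro sum_mono mult_right_mono)
    fix N assume "N \<in> NN"
    then have "finite N" "card N \<le> k * M" by (auto simp: NN_def intro: finite_subset[of N "{..<n}"])
    then show "real (card {T \<in> P. \<Union>T - \<Union>S = N}) \<le> real Q" using fibre by simp
  qed simp
  also have "\<dots> = (\<Sum>x\<in>{..k*M}. \<Sum>N\<in>{N \<in> NN. card N = x}. real Q * (1 / real n ^ card N))"
    by (rule sum.group[symmetric]) (auto simp: NN_def finNN[unfolded NN_def])
  also have "\<dots> \<le> (\<Sum>x\<in>{..k*M}. real Q)"
  proof (rule sum_mono)
    fix x assume x: "x \<in> {..k*M}"
    have "{N \<in> NN. card N = x} = {N. N \<subseteq> {..<n} \<and> card N = x}" using x by (auto simp: NN_def)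
    then have "card {N \<in> NN. card N = x} = n choose x" using n_subsets[of "{..<n}" x] by simp
    moreover have "n choose x \<le> n ^ x" by (rule binomial_le_power)
    ultimately have "real (card {N \<in> NN. card N = x}) \<le> real n ^ x"
      by (metis of_nat_le_iff of_nat_power)
    then have "real (card {N \<in> NN. card N = x}) / real n ^ x \<le> 1" using n by (simp add: divide_simps)
    then have "real Q * (real (card {N \<in> NN. card N = x}) / real n ^ x) \<le> real Q * 1"
      by (intro mult_left_mono) auto
    then show "(\<Sum>N\<in>{N \<in> NN. card N = x}. real Q * (1 / real n ^ card N)) \<le> real Q" by (simp add: ac_simps)
  qed
  also have "\<dots> = real (k * M + 1) * real Q" by simp
  finally show ?thesis .
qed

lemma card_fibre_le:
  assumes "finite B" "\<And>T. T \<in> P \<Longrightarrow> S \<subseteq> T \<and> T - S \<in> B"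
  shows "card P \<le> card B"
proof (rule card_inj_on_le[of "\<lambda>T. T - S"])
  show "inj_on (\<lambda>T. T - S) P" using assms(2) by (fastforce simp: inj_on_def)
qed (use assms in auto)

text \<open>Once the new vertices \<open>N\<close> are fixed, all new edges lie in
  \<open>e \<union> N\<close>. The resulting bound does not depend on the size of
  \<open>S\<close>.\<close>

lemma neutral_sum_le:
  assumes n: "n \<ge> 1" and S: "S \<subseteq> all_edges k n" and e: "e \<in> S"
  shows "(\<Sum>T\<in>neutral n k \<alpha> M S e. 1 / real n ^ card (\<Union>T - \<Union>S)) \<le>
    real (k * M + 1) * real (2 ^ 2 ^ (k + k * M))"
proof (rule extension_sum_le[OF n S])
  fix N :: "nat set" assume N: "finite N" "card N \<le> k * M"
  have fe: "finite e" "card e = k" using e S all_edgesD by auto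
  have "card {T \<in> neutral n k \<alpha> M S e. \<Union>T - \<Union>S = N} \<le> card (Pow (Pow (e \<union> N)))"
    by (rule card_fibre_le[where S = S]) (use N fe in \<open>auto simp: neutral_def\<close>)
  also have "\<dots> = 2 ^ 2 ^ card (e \<union> N)" using N fe by (simp add: card_Pow)
  also have "\<dots> \<le> 2 ^ 2 ^ (k + k * M)"
    using card_Un_le[of e N] N fe by (intro power_increasing) auto
  finally show "card {T \<in> neutral n k \<alpha> M S e. \<Union>T - \<Union>S = N} \<le> 2 ^ 2 ^ (k + k * M)" .
qed (auto simp: neutral_def)

text \<open>Here new edges may use any exposed vertex, so for fixed \<open>N\<close> one chooses at
  most \<open>M\<close> of the k-subsets of \<open>\<Union>S \<union> N\<close>; the bound is
  polynomial in \<open>s\<close>.\<close>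

lemma degenerate_sum_le:
  assumes n: "n \<ge> 1" and S: "S \<subseteq> all_edges k n" and s: "card S \<le> s"
  shows "(\<Sum>T\<in>degenerate n k \<alpha> M \<delta> S. 1 / real n ^ card (\<Union>T - \<Union>S)) \<le>
    real (k * M + 1) * real (((k * s + k * M) ^ k + 1) ^ M)"
proof (rule extension_sum_le[OF n S])
  fix N :: "nat set" assume N: "finite N" "card N \<le> k * M"
  have finS: "finite S" using S finite_all_edges finite_subset by blast
  have finV: "finite (\<Union>S)" using finS S all_edgesD by blast
  let ?V = "\<Union>S \<union> N" let ?E = "{e. e \<subseteq> ?V \<and> card e = k}"
  have "card (\<Union>S) \<le> k * card S"
  proof (rule card_Union_edges_le[OF finS])
    show "card e \<le> k" if "e \<in> S" for e using that S all_edgesD[of e k n] by auto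
  qed
  then have V: "card ?V \<le> k * s + k * M"
    using card_Un_le[of "\<Union>S" N] N(2) mult_le_mono2[OF s, of k] by linarith
  have "card ?E = card ?V choose k" using n_subsets[of ?V k] finV N by simp
  also have "\<dots> \<le> card ?V ^ k" by (rule binomial_le_power)
  also have "\<dots> \<le> (k * s + k * M) ^ k" using V by (rule power_mono) simp
  finally have E: "card ?E \<le> (k * s + k * M) ^ k" .
  have finE: "finite ?E" using finV N by (intro finite_subset[of ?E "Pow ?V"]) auto
  have "card {T \<in> degenerate n k \<alpha> M \<delta> S. \<Union>T - \<Union>S = N} \<le> card {X. X \<subseteq> ?E \<and> card X \<le> M}"
  proof (rule card_fibre_le[where S = S])
    fix T assume T: "T \<in> {T \<in> degenerate n k \<alpha> M \<delta> S. \<Union>T - \<Union>S = N}"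
    then have "card (T - S) = card T - card S" using finS
      by (intro card_Diff_subset) (auto simp: degenerate_def)
    moreover have "card T \<le> card S + M" using T by (simp add: degenerate_def)
    ultimately have "card (T - S) \<le> M" by linarith
    then show "S \<subseteq> T \<and> T - S \<in> {X. X \<subseteq> ?E \<and> card X \<le> M}"
      using T by (auto simp: degenerate_def all_edges_def)
  qed (use card_small_subsets[OF finE] in auto)
  also have "\<dots> \<le> (card ?E + 1) ^ M" using card_small_subsets[OF finE] by auto
  also have "\<dots> \<le> ((k * s + k * M) ^ k + 1) ^ M" using E by (intro power_mono) auto
  finally show "card {T \<in> degenerate n k \<alpha> M \<delta> S. \<Union>T - \<Union>S = N} \<le> ((k * s + k * M) ^ k + 1) ^ M" .
qed (auto simp: degenerate_def)

text \<open>
  The factor \<open>(1/4) ^ card U\<close> makes closing an edge lossy; it is recovered from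
  \<open>p \<le> \<beta>/4 n powr - \<alpha>\<close> and \<open>card U \<le> card S\<close>. The small \<open>\<eta>\<close> leaves a negative power of \<open>n\<close> to
  absorb the polynomially many choices of a step that decreases the excess.
\<close>

definition weight :: "nat \<Rightarrow> real \<Rightarrow> real \<Rightarrow> real \<Rightarrow> 'v set set \<times> 'v set set \<Rightarrow> real" where
  "weight n \<alpha> \<eta> \<beta> = (\<lambda>(S, U). \<beta> ^ card S * (1/4) ^ card U *
     real n powr (- (\<alpha> * real (card S)) - (1 - \<eta>) * excess \<alpha> S))"

text \<open>With \<open>x\<close> new vertices and \<open>y\<close> new edges the exponent changes
  by \<open>- x + \<eta> * (x - \<alpha> * y)\<close>. The first summand pays for the choice of the
  new vertices, the second is \<open>\<eta>\<close> times the change of the excess. One new edge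
  supplies the factor \<open>\<beta>\<close>.\<close>

lemma weight_extension_le:
  assumes "S \<subset> T" "T \<subseteq> all_edges k n" "n \<ge> 1" "0 < \<beta>" "\<beta> \<le> 1" "0 \<le> \<eta>" "excess \<alpha> T \<le> excess \<alpha> S - d"
  shows "weight n \<alpha> \<eta> \<beta> (T, U) \<le>
    weight n \<alpha> \<eta> \<beta> (S, U) * (\<beta> * real n powr (- (\<eta> * d))) * (1 / real n ^ card (\<Union>T - \<Union>S))"
proof -
  have finT: "finite T" using assms(2) finite_all_edges finite_subset by blast
  define x where "x = card (\<Union>T - \<Union>S)"
  define y where "y = card T - card S"
  have y: "card T = card S + y" "y \<ge> 1"
    using psubset_card_mono[OF finT assms(1)] by (auto simp: y_def)
  have x: "card (\<Union>T) = card (\<Union>S) + x"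
    unfolding x_def using assms finT all_edgesD by (intro card_Union_diff_eq) auto
  have lamT: "excess \<alpha> T = excess \<alpha> S + (real x - \<alpha> * real y)"
    by (simp add: excess_def x y algebra_simps)
  have ex: "- (\<alpha> * real (card T)) - (1 - \<eta>) * excess \<alpha> T =
     (- (\<alpha> * real (card S)) - (1 - \<eta>) * excess \<alpha> S) + \<eta> * (real x - \<alpha> * real y) - real x"
    by (simp add: lamT y algebra_simps)
  have "\<eta> * (real x - \<alpha> * real y) \<le> \<eta> * (- d)"
    using assms(6,7) lamT by (intro mult_left_mono) auto
  then have "real n powr (- (\<alpha> * real (card T)) - (1 - \<eta>) * excess \<alpha> T) \<le>
      real n powr ((- (\<alpha> * real (card S)) - (1 - \<eta>) * excess \<alpha> S) + (- (\<eta> * d)) - real x)"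
    unfolding ex using assms(3) by (intro powr_mono) auto
  also have "\<dots> = real n powr (- (\<alpha> * real (card S)) - (1 - \<eta>) * excess \<alpha> S) *
      real n powr (- (\<eta> * d)) * (1 / real n ^ x)"
    using assms(3) by (simp only: powr_diff powr_add) (simp add: powr_realpow)
  finally have 1: "real n powr (- (\<alpha> * real (card T)) - (1 - \<eta>) * excess \<alpha> T) \<le> \<dots>" .
  have "\<beta> ^ card T \<le> \<beta> ^ card S * \<beta>"
    using power_decreasing[of "card S + 1" "card T" \<beta>] y assms(4,5) by (simp add: mult.commute)
  then have "\<beta> ^ card T * (1/4) ^ card U \<le> \<beta> ^ card S * \<beta> * (1/4) ^ card U"
    by (intro mult_right_mono) auto
  from mult_mono[OF this 1] show ?thesis
    using assms(4) by (simp add: weight_def x_def ac_simps)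
qed

lemma weight_nonneg: "0 < \<beta> \<Longrightarrow> 0 \<le> weight n \<alpha> \<eta> \<beta> x"
  by (auto simp: weight_def split: prod.split)

text \<open>Closing the selected edge leaves a quarter of the weight. The boundedly many neutral
  steps add at most an eighth because \<open>\<beta>\<close> is small, the degenerate ones at most
  another eighth because of \<open>n powr (- (\<eta> * \<delta>))\<close>.\<close>

lemma successors_weight_le:
  assumes "U \<subseteq> S" "S \<subseteq> all_edges k n" "card S \<le> s"
    and n: "n \<ge> 1" and \<beta>: "0 < \<beta>" "\<beta> \<le> 1" and "0 \<le> \<eta>" "0 \<le> \<delta>"
    and neu: "real (k * M + 1) * real (2 ^ 2 ^ (k + k * M)) * \<beta> \<le> 1/8"
    and deg: "real (k * M + 1) * real (((k * s + k * M) ^ k + 1) ^ M) * real n powr (- (\<eta> * \<delta>)) \<le> 1/8"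
  shows "(\<Sum>y\<in>successors n k \<alpha> M \<delta> (S, U). weight n \<alpha> \<eta> \<beta> y) \<le> weight n \<alpha> \<eta> \<beta> (S, U) / 2"
proof (cases "S \<subseteq> U")
  case True
  then show ?thesis using weight_nonneg[OF \<beta>(1), of n \<alpha> \<eta> "(S, U)"] by (simp add: successors_def)
next
  case False
  define e where "e = select_edge S U"
  have e: "e \<in> S" "e \<notin> U" using select_edge_in[OF False] by (auto simp: e_def)
  let ?w = "weight n \<alpha> \<eta> \<beta>" let ?N = "neutral n k \<alpha> M S e" let ?D = "degenerate n k \<alpha> M \<delta> S"
  have fin: "finite S" "finite U"
    using finite_subset[OF assms(2) finite_all_edges] finite_subset[OF assms(1)] by auto
  note finND = finite_neutral[of n k \<alpha> M S e] finite_degenerate[of n k \<alpha> M \<delta> S]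
  have w0: "0 \<le> ?w y" for y using weight_nonneg[OF \<beta>(1)] .
  have A: "?w (S, insert e U) = ?w (S, U) / 4" using e fin by (simp add: weight_def)
  have B: "(\<Sum>T\<in>?N. ?w (T, U)) \<le> ?w (S, U) / 8"
  proof -
    have "(\<Sum>T\<in>?N. ?w (T, U)) \<le> (\<Sum>T\<in>?N. ?w (S, U) * (\<beta> * real n powr (- (\<eta> * 0))) * (1 / real n ^ card (\<Union>T - \<Union>S)))"
      using n \<beta> \<open>0 \<le> \<eta>\<close> by (intro sum_mono weight_extension_le[where k = k]) (auto simp: neutral_def)
    also have "\<dots> = ?w (S, U) * (\<beta> * (\<Sum>T\<in>?N. 1 / real n ^ card (\<Union>T - \<Union>S)))"
      using n by (simp add: sum_distrib_left ac_simps)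
    also have "\<dots> \<le> ?w (S, U) * (\<beta> * (real (k * M + 1) * real (2 ^ 2 ^ (k + k * M))))"
      using neutral_sum_le[OF n assms(2) e(1)] w0 \<beta> by (intro mult_left_mono) auto
    also have "\<dots> \<le> ?w (S, U) * (1 / 8)" using neu w0 by (intro mult_left_mono) (auto simp: ac_simps)
    finally show ?thesis by simp
  qed
  have C: "(\<Sum>T\<in>?D. ?w (T, U)) \<le> ?w (S, U) / 8"
  proof -
    let ?p = "real n powr (- (\<eta> * \<delta>))"
    have "(\<Sum>T\<in>?D. ?w (T, U)) \<le> (\<Sum>T\<in>?D. ?w (S, U) * (\<beta> * ?p) * (1 / real n ^ card (\<Union>T - \<Union>S)))"
      using n \<beta> \<open>0 \<le> \<eta>\<close> by (intro sum_mono weight_extension_le[where k = k]) (auto simp: degenerate_def)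
    also have "\<dots> = ?w (S, U) * (\<beta> * (?p * (\<Sum>T\<in>?D. 1 / real n ^ card (\<Union>T - \<Union>S))))"
      by (simp add: sum_distrib_left ac_simps)
    also have "\<dots> \<le> ?w (S, U) * (1 * (?p * (real (k * M + 1) * real (((k * s + k * M) ^ k + 1) ^ M))))"
      using degenerate_sum_le[OF n assms(2,3)] w0 \<beta>
      by (intro mult_left_mono mult_mono) (auto intro!: sum_nonneg mult_nonneg_nonneg)
    also have "\<dots> \<le> ?w (S, U) * (1 / 8)" using deg w0 by (intro mult_left_mono) (auto simp: ac_simps)
    finally show ?thesis by simp
  qed
  have "(\<Sum>y\<in>successors n k \<alpha> M \<delta> (S, U). ?w y) \<le>
      (\<Sum>y\<in>{(S, insert e U)}. ?w y) + (\<Sum>y\<in>(\<lambda>T. (T, U)) ` ?N. ?w y) + (\<Sum>y\<in>(\<lambda>T. (T, U)) ` ?D. ?w y)"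
  proof -
    have un: "(\<Sum>y\<in>A \<union> B \<union> C. ?w y) \<le> (\<Sum>y\<in>A. ?w y) + (\<Sum>y\<in>B. ?w y) + (\<Sum>y\<in>C. ?w y)"
      if "finite A" "finite B" "finite C" for A B C
    proof -
      have "(\<Sum>y\<in>A \<union> B \<union> C. ?w y) \<le> (\<Sum>y\<in>A \<union> B. ?w y) + (\<Sum>y\<in>C. ?w y)"
        using that w0 by (subst sum_Un) (auto intro!: sum_nonneg)
      also have "(\<Sum>y\<in>A \<union> B. ?w y) \<le> (\<Sum>y\<in>A. ?w y) + (\<Sum>y\<in>B. ?w y)"
        using that w0 by (subst sum_Un) (auto intro!: sum_nonneg)
      finally show ?thesis by simp
    qed
    have eq: "successors n k \<alpha> M \<delta> (S, U) =
        {(S, insert e U)} \<union> (\<lambda>T. (T, U)) ` ?N \<union> (\<lambda>T. (T, U)) ` ?D"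
      using False by (simp add: successors_def e_def)
    show ?thesis unfolding eq by (rule un) (use finND in auto)
  qed
  also have "\<dots> = ?w (S, insert e U) + (\<Sum>T\<in>?N. ?w (T, U)) + (\<Sum>T\<in>?D. ?w (T, U))"
    by (simp add: sum.reindex inj_on_def)
  also have "\<dots> \<le> ?w (S, U) / 2" using A B C by simp
  finally show ?thesis .
qed

lemma sum_UN_le:
  fixes f :: "'b \<Rightarrow> real"
  assumes "finite A" "\<And>x. x \<in> A \<Longrightarrow> finite (B x)" "\<And>y. 0 \<le> f y"
  shows "(\<Sum>y\<in>(\<Union>x\<in>A. B x). f y) \<le> (\<Sum>x\<in>A. \<Sum>y\<in>B x. f y)"
  using assms
proof (induction A rule: finite_induct)
  case (insert a A)
  have "(\<Sum>y\<in>B a \<union> (\<Union>x\<in>A. B x). f y) \<le> (\<Sum>y\<in>B a. f y) + (\<Sum>y\<in>(\<Union>x\<in>A. B x). f y)"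
    using insert by (subst sum_Un) (auto intro!: sum_nonneg)
  then show ?case using insert by auto
qed simp

text \<open>The factor \<open>n powr (\<eta> * k)\<close> is the weight at the start: at most
  \<open>n ^ k\<close> single edges, each of weight at most
  \<open>n powr (- k + \<eta> * k)\<close>. \<open>Suc (L * M)\<close> bounds the number of edges
  exposed within \<open>L\<close> steps.\<close>

lemma states_weight_le:
  assumes n: "n \<ge> 1" and \<beta>: "0 < \<beta>" "\<beta> \<le> 1" and "0 \<le> \<eta>" "0 \<le> \<delta>" "0 \<le> \<alpha>"
    and neu: "real (k * M + 1) * real (2 ^ 2 ^ (k + k * M)) * \<beta> \<le> 1/8"
    and deg: "real (k * M + 1) * real (((k * Suc (L * M) + k * M) ^ k + 1) ^ M) * real n powr (- (\<eta> * \<delta>)) \<le> 1/8"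
    and "i \<le> L"
  shows "(\<Sum>x\<in>states n k \<alpha> M \<delta> i. weight n \<alpha> \<eta> \<beta> x) \<le> (1/2) ^ i * real n powr (\<eta> * real k)"
  using \<open>i \<le> L\<close>
proof (induction i)
  case 0
  have "(\<Sum>x\<in>states n k \<alpha> M \<delta> 0. weight n \<alpha> \<eta> \<beta> x) = (\<Sum>e\<in>all_edges k n. weight n \<alpha> \<eta> \<beta> ({e}, {}))"
    by (simp add: sum.reindex inj_on_def)
  also have "\<dots> \<le> (\<Sum>e\<in>all_edges k n. real n powr (- real k + \<eta> * real k))"
  proof (rule sum_mono)
    fix e assume "e \<in> all_edges k n"
    then have e: "card e = k" by (simp add: all_edges_def)
    have "- \<alpha> - (1 - \<eta>) * (real k - \<alpha>) \<le> - real k + \<eta> * real k"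
      using \<open>0 \<le> \<eta>\<close> \<open>0 \<le> \<alpha>\<close> by (simp add: algebra_simps)
    then have "real n powr (- \<alpha> - (1 - \<eta>) * (real k - \<alpha>)) \<le> real n powr (- real k + \<eta> * real k)"
      using n by (intro powr_mono) auto
    then have "\<beta> * real n powr (- \<alpha> - (1 - \<eta>) * (real k - \<alpha>)) \<le> 1 * real n powr (- real k + \<eta> * real k)"
      using \<beta> by (intro mult_mono) auto
    then show "weight n \<alpha> \<eta> \<beta> ({e}, {}) \<le> real n powr (- real k + \<eta> * real k)"
      using e by (simp add: weight_def excess_def)
  qed
  also have "\<dots> = real (card (all_edges k n)) * real n powr (- real k + \<eta> * real k)" by simp
  also have "\<dots> \<le> real n powr real k * real n powr (- real k + \<eta> * real k)"
  proof (rule mult_right_mono)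
    have "card (all_edges k n) = n choose k" using n_subsets[of "{..<n}" k] by (simp add: all_edges_def)
    also have "\<dots> \<le> n ^ k" by (rule binomial_le_power)
    finally show "real (card (all_edges k n)) \<le> real n powr real k"
      using n by (simp add: powr_realpow flip: of_nat_power)
  qed auto
  also have "\<dots> = real n powr (\<eta> * real k)" by (simp flip: powr_add)
  finally show ?case by simp
next
  case (Suc i)
  have "(\<Sum>x\<in>states n k \<alpha> M \<delta> (Suc i). weight n \<alpha> \<eta> \<beta> x) \<le>
      (\<Sum>x\<in>states n k \<alpha> M \<delta> i. \<Sum>y\<in>successors n k \<alpha> M \<delta> x. weight n \<alpha> \<eta> \<beta> y)"
  proof -
    have "finite (successors n k \<alpha> M \<delta> x)" if "x \<in> states n k \<alpha> M \<delta> i" for x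
      using finite_states[of n k \<alpha> M \<delta> "Suc i"] that by (auto intro: finite_subset)
    then show ?thesis unfolding states.simps
      by (intro sum_UN_le finite_states weight_nonneg[OF \<beta>(1)])
  qed
  also have "\<dots> \<le> (\<Sum>x\<in>states n k \<alpha> M \<delta> i. weight n \<alpha> \<eta> \<beta> x / 2)"
  proof (rule sum_mono)
    fix x assume x: "x \<in> states n k \<alpha> M \<delta> i"
    obtain S U where xe: "x = (S, U)" by (cases x)
    note inv = states_invariant[OF x[unfolded xe] \<open>0 \<le> \<delta>\<close>]
    have "i * M \<le> L * M" using Suc.prems by (intro mult_le_mono1) simp
    then have "card S \<le> Suc (L * M)" using inv by linarith
    then show "(\<Sum>y\<in>successors n k \<alpha> M \<delta> x. weight n \<alpha> \<eta> \<beta> y) \<le> weight n \<alpha> \<eta> \<beta> x / 2"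
      unfolding xe using inv by (intro successors_weight_le[OF _ _ _ n \<beta> \<open>0 \<le> \<eta>\<close> \<open>0 \<le> \<delta>\<close> neu deg]) auto
  qed
  also have "\<dots> = (\<Sum>x\<in>states n k \<alpha> M \<delta> i. weight n \<alpha> \<eta> \<beta> x) / 2" by (simp add: sum_divide_distrib)
  also have "\<dots> \<le> (1/2) ^ Suc i * real n powr (\<eta> * real k)" using Suc by simp
  finally show ?case .
qed

section \<open>First moment over truncated explorations\<close>

lemma prob_contains:
  assumes "S \<subseteq> all_edges k n" "0 \<le> p" "p \<le> 1"
  shows "measure_pmf.prob (random_kgraph k n p) {G. S \<subseteq> edges G} = p ^ card S"
proof -
  let ?B = "\<lambda>e. if e \<in> S then {True} else UNIV"
  have "measure_pmf.prob (random_kgraph k n p) {G. S \<subseteq> edges G} =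
      measure_pmf.prob (Pi_pmf (all_edges k n) False (\<lambda>_. bernoulli_pmf p)) (Pi (all_edges k n) ?B)"
    unfolding random_kgraph_def measure_map_pmf using assms(1)
    by (intro arg_cong[where f = "measure_pmf.prob _"]) (auto simp: Pi_def)
  also have "\<dots> = (\<Prod>e\<in>all_edges k n. measure_pmf.prob (bernoulli_pmf p) (?B e))"
    by (rule measure_Pi_pmf_Pi[OF finite_all_edges])
  also have "\<dots> = (\<Prod>e\<in>all_edges k n. if e \<in> S then p else 1)"
    using assms by (intro prod.cong refl) (auto simp: measure_pmf_single)
  also have "\<dots> = (\<Prod>e\<in>all_edges k n \<inter> S. p)"
    by (rule prod.inter_restrict[OF finite_all_edges, symmetric])
  also have "\<dots> = p ^ card S" using assms(1) by (simp add: Int_absorb1)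
  finally show ?thesis .
qed

lemma excess_gap:
  assumes "\<alpha> \<in> \<rat>"
  obtains \<delta> where "\<delta> > 0"
    "\<And>(S :: 'v set set) (T :: 'v set set). excess \<alpha> T < excess \<alpha> S \<Longrightarrow> excess \<alpha> T \<le> excess \<alpha> S - \<delta>"
    "\<And>T :: 'v set set. excess \<alpha> T < 0 \<Longrightarrow> excess \<alpha> T \<le> - \<delta>"
proof -
  obtain a :: int and q :: nat where q: "q \<noteq> 0" "\<alpha> = real_of_int a / real q"
    using assms by (auto simp: Rats_eq_int_div_nat)
  \<comment> \<open>For \<open>\<alpha> = a / q\<close> this integer is \<open>q\<close> times the
    excess, which gives the gap \<open>1 / q\<close>.\<close>
  define l where "l S = int q * int (card (\<Union>S)) - a * int (card S)" for S :: "'v set set"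
  have excess: "excess \<alpha> S = real_of_int (l S) / real q" for S :: "'v set set"
    using q by (simp add: excess_def l_def field_simps)
  show thesis
  proof (rule that[of "1 / real q"])
    fix S T :: "'v set set" assume "excess \<alpha> T < excess \<alpha> S"
    then have "l T < l S" using q(1) by (simp add: excess divide_less_cancel)
    then have "real_of_int (l T) \<le> real_of_int (l S) - 1" by linarith
    then show "excess \<alpha> T \<le> excess \<alpha> S - 1 / real q"
      using q(1) by (simp add: excess divide_right_mono flip: diff_divide_distrib)
  next
    fix T :: "'v set set" assume "excess \<alpha> T < 0"
    then have "l T < 0" using q(1) by (simp add: excess divide_less_0_iff)
    then have "real_of_int (l T) \<le> - 1" by linarith
    then have "real_of_int (l T) / real q \<le> - 1 / real q" by (rule divide_right_mono) simp
    then show "excess \<alpha> T \<le> - (1 / real q)" by (simp add: excess)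
  qed (use q in simp)
qed

lemma pow_le_weight:
  assumes "0 \<le> p" "p \<le> \<beta> / 4 * real n powr (- \<alpha>)" "0 < \<beta>" "n \<ge> 1" "0 \<le> \<eta>" "\<eta> \<le> 1"
    and "U \<subseteq> S" "finite S" "excess \<alpha> S \<le> d"
  shows "p ^ card S \<le> weight n \<alpha> \<eta> \<beta> (S, U) * real n powr ((1 - \<eta>) * d)"
proof -
  have "p ^ card S \<le> (\<beta> / 4 * real n powr (- \<alpha>)) ^ card S" using assms by (intro power_mono)
  also have "\<dots> = \<beta> ^ card S * (1/4) ^ card S * real n powr (- (\<alpha> * real (card S)))"
    using assms(4) by (simp add: power_mult_distrib power_divide powr_realpow[symmetric] powr_powr)
  also have "\<dots> \<le> \<beta> ^ card S * (1/4) ^ card U * real n powr (- (\<alpha> * real (card S)))"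
    using assms card_mono[OF assms(8,7)]
    by (intro mult_right_mono mult_left_mono power_decreasing) auto
  also have "\<dots> \<le> \<beta> ^ card S * (1/4) ^ card U *
     real n powr ((- (\<alpha> * real (card S)) - (1 - \<eta>) * excess \<alpha> S) + (1 - \<eta>) * d)"
    using assms mult_left_mono[OF assms(9), of "1 - \<eta>"] by (intro mult_left_mono powr_mono) auto
  also have "\<dots> = weight n \<alpha> \<eta> \<beta> (S, U) * real n powr ((1 - \<eta>) * d)"
    by (simp add: weight_def powr_add)
  finally show ?thesis .
qed

text \<open>Completed sets have excess at most \<open>- \<delta>\<close>, and their contributions
  over all lengths form a geometric series. A state that survives \<open>L\<close> steps is only
  known to have excess at most \<open>k\<close>, so its power \<open>n powr k\<close> is left for
  \<open>(1/2) ^ L\<close> to beat.\<close>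

lemma prob_explorable_le:
  assumes n: "n \<ge> 1" and \<beta>: "0 < \<beta>" "\<beta> \<le> 1" and \<eta>: "0 \<le> \<eta>" "\<eta> \<le> 1" and "0 < \<delta>" "0 \<le> \<alpha>"
    and neu: "real (k * M + 1) * real (2 ^ 2 ^ (k + k * M)) * \<beta> \<le> 1/8"
    and deg: "real (k * M + 1) * real (((k * Suc (L * M) + k * M) ^ k + 1) ^ M) * real n powr (- (\<eta> * \<delta>)) \<le> 1/8"
    and gap: "\<And>(S :: nat set set) (T :: nat set set). excess \<alpha> T < excess \<alpha> S \<Longrightarrow> excess \<alpha> T \<le> excess \<alpha> S - \<delta>"
    and gap0: "\<And>T :: nat set set. excess \<alpha> T < 0 \<Longrightarrow> excess \<alpha> T \<le> - \<delta>"
    and p: "0 \<le> p" "p \<le> 1" "p \<le> \<beta> / 4 * real n powr (- \<alpha>)"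
  shows "measure_pmf.prob (random_kgraph k n p)
      {G. \<exists>C\<subseteq>edges G. explorable \<alpha> M C \<and> excess \<alpha> C < 0} \<le>
    2 * real n powr (\<eta> * real k - (1 - \<eta>) * \<delta>) + (1/2) ^ L * real n powr real k"
proof -
  let ?R = "random_kgraph k n p" let ?w = "weight n \<alpha> \<eta> \<beta>"
  let ?X = "\<lambda>i. states n k \<alpha> M \<delta> i"
  define A where "A = (\<Union>i\<in>{..L}. {x \<in> ?X i. excess \<alpha> (fst x) < 0}) \<union> ?X L"
  have finA: "finite A" unfolding A_def by (auto simp: finite_states)
  have edges: "edges G \<subseteq> all_edges k n" if "G \<in> set_pmf ?R" for G
    using that by (auto simp: random_kgraph_def)
  have prob: "measure_pmf.prob ?R {G. fst x \<subseteq> edges G} \<le> ?w x * real n powr ((1 - \<eta>) * d)"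
    if "x \<in> ?X i" "excess \<alpha> (fst x) \<le> d" for x i d
  proof -
    obtain S U where x: "x = (S, U)" by (cases x)
    have inv: "S \<subseteq> all_edges k n" "U \<subseteq> S"
      using states_invariant[of S U n k \<alpha> M \<delta> i] that x \<open>0 < \<delta>\<close> by auto
    have "finite S" using finite_subset[OF inv(1) finite_all_edges] .
    then have "p ^ card S \<le> ?w (S, U) * real n powr ((1 - \<eta>) * d)"
      using inv that x n \<eta> \<beta> p by (intro pow_le_weight) auto
    then show ?thesis using prob_contains[OF inv(1) p(1,2)] x by simp
  qed
  have W: "(\<Sum>x\<in>?X i. ?w x) \<le> (1/2) ^ i * real n powr (\<eta> * real k)" if "i \<le> L" for i
    by (rule states_weight_le[OF n \<beta> \<eta>(1) _ \<open>0 \<le> \<alpha>\<close> neu deg that]) (use \<open>0 < \<delta>\<close> in simp)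
  have "measure_pmf.prob ?R {G. \<exists>C\<subseteq>edges G. explorable \<alpha> M C \<and> excess \<alpha> C < 0} \<le>
      measure_pmf.prob ?R (\<Union>x\<in>A. {G. fst x \<subseteq> edges G})"
  proof (rule measure_pmf.finite_measure_mono_AE)
    show "AE G in measure_pmf ?R. G \<in> {G. \<exists>C\<subseteq>edges G. explorable \<alpha> M C \<and> excess \<alpha> C < 0} \<longrightarrow>
      G \<in> (\<Union>x\<in>A. {G. fst x \<subseteq> edges G})"
    proof (rule AE_pmfI, rule impI)
      fix G assume G: "G \<in> set_pmf ?R" "G \<in> {G. \<exists>C\<subseteq>edges G. explorable \<alpha> M C \<and> excess \<alpha> C < 0}"
      then obtain C where C: "C \<subseteq> edges G" "explorable \<alpha> M C" "excess \<alpha> C < 0" by auto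
      then have "C \<subseteq> all_edges k n" using edges[OF G(1)] by auto
      then have "(\<exists>j\<le>L. \<exists>U\<subseteq>C. (C, U) \<in> ?X j) \<or> (\<exists>S U. S \<subseteq> C \<and> (S, U) \<in> ?X L)"
        by (rule explorable_reached[OF C(2)]) (rule gap)
      then consider j U where "j \<le> L" "(C, U) \<in> ?X j" | S U where "S \<subseteq> C" "(S, U) \<in> ?X L" by blast
      then show "G \<in> (\<Union>x\<in>A. {G. fst x \<subseteq> edges G})"
      proof cases
        case 1
        then show ?thesis using C by (intro UN_I[of "(C, U)"]) (auto simp: A_def)
      next
        case 2
        then show ?thesis using C by (intro UN_I[of "(S, U)"]) (auto simp: A_def)
      qed
    qed
  qed auto
  also have "\<dots> \<le> (\<Sum>x\<in>A. measure_pmf.prob ?R {G. fst x \<subseteq> edges G})"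
    by (rule measure_pmf.finite_measure_subadditive_finite[OF finA]) auto
  also have "\<dots> \<le> (\<Sum>x\<in>(\<Union>i\<in>{..L}. {x \<in> ?X i. excess \<alpha> (fst x) < 0}). measure_pmf.prob ?R {G. fst x \<subseteq> edges G})
      + (\<Sum>x\<in>?X L. measure_pmf.prob ?R {G. fst x \<subseteq> edges G})"
    unfolding A_def by (subst sum_Un) (auto simp: finite_states intro!: sum_nonneg)
  also have "\<dots> \<le> 2 * real n powr (\<eta> * real k - (1 - \<eta>) * \<delta>) + (1/2) ^ L * real n powr real k"
  proof (rule add_mono)
    have "(\<Sum>x\<in>(\<Union>i\<in>{..L}. {x \<in> ?X i. excess \<alpha> (fst x) < 0}). measure_pmf.prob ?R {G. fst x \<subseteq> edges G})
      \<le> (\<Sum>i\<in>{..L}. \<Sum>x\<in>{x \<in> ?X i. excess \<alpha> (fst x) < 0}. measure_pmf.prob ?R {G. fst x \<subseteq> edges G})"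
      by (rule sum_UN_le) (auto simp: finite_states)
    also have "\<dots> \<le> (\<Sum>i\<in>{..L}. (1/2) ^ i * real n powr (\<eta> * real k - (1 - \<eta>) * \<delta>))"
    proof (rule sum_mono)
      fix i assume i: "i \<in> {..L}"
      have "(\<Sum>x\<in>{x \<in> ?X i. excess \<alpha> (fst x) < 0}. measure_pmf.prob ?R {G. fst x \<subseteq> edges G}) \<le>
          (\<Sum>x\<in>{x \<in> ?X i. excess \<alpha> (fst x) < 0}. ?w x * real n powr ((1 - \<eta>) * (- \<delta>)))"
        by (rule sum_mono) (use prob gap0 in blast)
      also have "\<dots> \<le> (\<Sum>x\<in>?X i. ?w x * real n powr ((1 - \<eta>) * (- \<delta>)))"
        using weight_nonneg[OF \<beta>(1)] by (intro sum_mono2) (auto simp: finite_states intro!: mult_nonneg_nonneg)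
      also have "\<dots> = (\<Sum>x\<in>?X i. ?w x) * real n powr ((1 - \<eta>) * (- \<delta>))"
        by (simp add: sum_distrib_right)
      also have "\<dots> \<le> ((1/2) ^ i * real n powr (\<eta> * real k)) * real n powr ((1 - \<eta>) * (- \<delta>))"
        using W i by (intro mult_right_mono) auto
      also have "\<dots> = (1/2) ^ i * real n powr (\<eta> * real k - (1 - \<eta>) * \<delta>)"
      proof -
        have "real n powr (\<eta> * real k) * real n powr ((1 - \<eta>) * (- \<delta>)) =
            real n powr (\<eta> * real k - (1 - \<eta>) * \<delta>)"
          by (subst powr_add[symmetric]) simp
        then show ?thesis by (simp only: mult.assoc)
      qed
      finally show "(\<Sum>x\<in>{x \<in> ?X i. excess \<alpha> (fst x) < 0}. measure_pmf.prob ?R {G. fst x \<subseteq> edges G}) \<le> \<dots>" .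
    qed
    also have "\<dots> = (\<Sum>i\<in>{..L}. (1/2) ^ i) * real n powr (\<eta> * real k - (1 - \<eta>) * \<delta>)"
      by (simp add: sum_distrib_right)
    also have "\<dots> \<le> 2 * real n powr (\<eta> * real k - (1 - \<eta>) * \<delta>)"
    proof (rule mult_right_mono)
      have "(\<Sum>i\<in>{..L}. (1/2::real) ^ i) = 2 - (1/2) ^ L"
        by (induction L) (auto simp: field_simps)
      then show "(\<Sum>i\<in>{..L}. (1/2::real) ^ i) \<le> 2" by simp
    qed simp
    finally show "(\<Sum>x\<in>(\<Union>i\<in>{..L}. {x \<in> ?X i. excess \<alpha> (fst x) < 0}). measure_pmf.prob ?R {G. fst x \<subseteq> edges G}) \<le> \<dots>" .
  next
    have "(\<Sum>x\<in>?X L. measure_pmf.prob ?R {G. fst x \<subseteq> edges G}) \<le>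
        (\<Sum>x\<in>?X L. ?w x * real n powr ((1 - \<eta>) * real k))"
    proof (rule sum_mono)
      fix x assume x: "x \<in> ?X L"
      then have "excess \<alpha> (fst x) \<le> real k"
        using states_invariant[of "fst x" "snd x" n k \<alpha> M \<delta> L] \<open>0 < \<delta>\<close> \<open>0 \<le> \<alpha>\<close> by auto
      then show "measure_pmf.prob ?R {G. fst x \<subseteq> edges G} \<le> ?w x * real n powr ((1 - \<eta>) * real k)"
        using prob x by blast
    qed
    also have "\<dots> = (\<Sum>x\<in>?X L. ?w x) * real n powr ((1 - \<eta>) * real k)" by (simp add: sum_distrib_right)
    also have "\<dots> \<le> ((1/2) ^ L * real n powr (\<eta> * real k)) * real n powr ((1 - \<eta>) * real k)"
      using W by (intro mult_right_mono) auto
    also have "\<dots> = (1/2) ^ L * real n powr real k"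
    proof -
      have "real n powr (\<eta> * real k) * real n powr ((1 - \<eta>) * real k) = real n powr real k"
        by (subst powr_add[symmetric]) (simp add: algebra_simps)
      then show ?thesis by (simp only: mult.assoc)
    qed
    finally show "(\<Sum>x\<in>?X L. measure_pmf.prob ?R {G. fst x \<subseteq> edges G}) \<le> \<dots>" .
  qed
  finally show ?thesis .
qed

theorem explorable_rare:
  assumes "\<alpha> \<in> \<rat>" "\<alpha> > 0"
  shows "\<exists>b::real. b > 0 \<and> (\<forall>p :: nat \<Rightarrow> real.
     (\<forall>n. 0 \<le> p n \<and> p n \<le> 1) \<and> (\<forall>n\<ge>1. p n \<le> b * real n powr (- \<alpha>)) \<longrightarrow>
     (\<lambda>n. measure_pmf.prob (random_kgraph k n (p n))
        {G. \<exists>C\<subseteq>edges G. explorable \<alpha> M C \<and> excess \<alpha> C < 0}) \<longlonglongrightarrow> 0)"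
proof -
  obtain \<delta> where "\<delta> > 0"
    and gap: "\<And>(S :: nat set set) (T :: nat set set). excess \<alpha> T < excess \<alpha> S \<Longrightarrow> excess \<alpha> T \<le> excess \<alpha> S - \<delta>"
    and gap0: "\<And>T :: nat set set. excess \<alpha> T < 0 \<Longrightarrow> excess \<alpha> T \<le> - \<delta>"
    using excess_gap[OF assms(1)] by metis
  \<comment> \<open>Solves \<open>\<eta> * (k + \<delta>) = \<delta> / 2\<close>, so that completed
    sets contribute only \<open>n powr (- (\<delta> / 2))\<close>.\<close>
  define \<eta> where "\<eta> = \<delta> / (2 * (real k + \<delta>))"
  have \<eta>: "0 < \<eta>" "\<eta> \<le> 1" using \<open>\<delta> > 0\<close> by (auto simp: \<eta>_def field_simps)
  have \<eta>\<delta>: "\<eta> * real k - (1 - \<eta>) * \<delta> = - (\<delta> / 2)"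
  proof -
    have "\<eta> * (real k + \<delta>) = \<delta> / 2" using \<open>\<delta> > 0\<close> by (simp add: \<eta>_def divide_simps)
    then show ?thesis by (simp add: algebra_simps)
  qed
  define K where "K = real (k * M + 1) * real (2 ^ 2 ^ (k + k * M))"
  define \<beta> where "\<beta> = 1 / (8 * K)"
  have "K \<ge> 1 * 1" unfolding K_def by (intro mult_mono) auto
  then have \<beta>: "0 < \<beta>" "\<beta> \<le> 1" "K * \<beta> \<le> 1/8" by (auto simp: \<beta>_def field_simps)
  \<comment> \<open>Long enough for \<open>(1/2) ^ L n\<close> to be at most
    \<open>n powr (- (k + 1))\<close>, so that surviving explorations contribute at most
    \<open>1 / n\<close>; short enough to keep the degenerate choices polylogarithmic.\<close>
  define L where "L n = nat \<lceil>real (k + 1) * log 2 (real n)\<rceil>" for n :: nat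
  \<comment> \<open>\<open>a * log 2 n + c\<close> is a linear majorant for the number of vertices
    within reach of a degenerate step, plus one.\<close>
  define a where "a = real k * (real (k + 1) * real M) + 1"
  define c where "c = real k * (1 + real M) + real (k * M) + 1"
  have "a > 0" "c \<ge> 0" by (auto simp: a_def c_def add_nonneg_pos)
  have "(\<lambda>n. (a * log 2 (real n) + c) ^ (k * M) * real n powr (- (\<eta> * \<delta>))) \<longlonglongrightarrow> 0"
    using mult_pos_pos[OF \<eta>(1) \<open>\<delta> > 0\<close>] \<open>a > 0\<close> by real_asymp
  then have "(\<lambda>n. real (k * M + 1) * 2 ^ M * ((a * log 2 (real n) + c) ^ (k * M) * real n powr (- (\<eta> * \<delta>)))) \<longlonglongrightarrow> 0"
    by (rule tendsto_mult_right_zero)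
  then have "eventually (\<lambda>n. real (k * M + 1) * 2 ^ M *
      ((a * log 2 (real n) + c) ^ (k * M) * real n powr (- (\<eta> * \<delta>))) < 1/8) sequentially"
    by (rule order_tendstoD) simp
  then have deg: "eventually (\<lambda>n. real (k * M + 1) * real (((k * Suc (L n * M) + k * M) ^ k + 1) ^ M) *
      real n powr (- (\<eta> * \<delta>)) \<le> 1/8) sequentially"
    using eventually_ge_at_top[of 1]
  proof eventually_elim
    case (elim n)
    have log: "log 2 (real n) \<ge> 0" using elim(2) by simp
    define x where "x = real (k * Suc (L n * M) + k * M)"
    have "real (L n) \<le> real (k + 1) * log 2 (real n) + 1" using log unfolding L_def by simp
    then have "x \<le> real k * (1 + (real (k + 1) * log 2 (real n) + 1) * real M) + real (k * M)"
    proof -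
      assume "real (L n) \<le> real (k + 1) * log 2 (real n) + 1"
      then have "real k * (1 + real (L n) * real M) \<le> real k * (1 + (real (k + 1) * log 2 (real n) + 1) * real M)"
        by (intro mult_left_mono add_mono mult_right_mono) auto
      moreover have "x = real k * (1 + real (L n) * real M) + real (k * M)"
        by (simp add: x_def algebra_simps)
      ultimately show ?thesis by simp
    qed
    then have x: "0 \<le> x" "x + 1 \<le> a * log 2 (real n) + c"
      using log by (auto simp: a_def c_def algebra_simps x_def)
    have "x ^ k + 1 \<le> 2 * (x + 1) ^ k"
      using power_mono[of x "x + 1" k] one_le_power[of "x + 1" k] x(1) by linarith
    also have "\<dots> \<le> 2 * (a * log 2 (real n) + c) ^ k" using x by (intro mult_left_mono power_mono) auto
    finally have "(x ^ k + 1) ^ M \<le> (2 * (a * log 2 (real n) + c) ^ k) ^ M"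
      using x(1) by (intro power_mono) auto
    also have "\<dots> = 2 ^ M * (a * log 2 (real n) + c) ^ (k * M)" by (simp add: power_mult_distrib power_mult)
    finally have "real (k * M + 1) * (x ^ k + 1) ^ M * real n powr (- (\<eta> * \<delta>)) \<le>
        real (k * M + 1) * (2 ^ M * (a * log 2 (real n) + c) ^ (k * M)) * real n powr (- (\<eta> * \<delta>))"
      by (intro mult_right_mono mult_left_mono) auto
    also have "\<dots> \<le> 1/8" using elim(1) by (simp add: mult.assoc)
    finally show ?case unfolding x_def by (metis of_nat_1 of_nat_add of_nat_power)
  qed
  show ?thesis
  proof (rule exI[of _ "\<beta> / 4"], intro conjI allI impI)
    fix p :: "nat \<Rightarrow> real"
    assume p: "(\<forall>n. 0 \<le> p n \<and> p n \<le> 1) \<and> (\<forall>n\<ge>1. p n \<le> \<beta> / 4 * real n powr - \<alpha>)"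
    let ?P = "\<lambda>n. measure_pmf.prob (random_kgraph k n (p n))
        {G. \<exists>C\<subseteq>edges G. explorable \<alpha> M C \<and> excess \<alpha> C < 0}"
    have ev: "eventually (\<lambda>n. ?P n \<le> 2 * real n powr (- (\<delta> / 2)) + 1 / real n) sequentially"
      using deg eventually_ge_at_top[of 1]
    proof eventually_elim
      case (elim n)
      have "?P n \<le> 2 * real n powr (\<eta> * real k - (1 - \<eta>) * \<delta>) + (1/2) ^ L n * real n powr real k"
        using elim p \<eta> \<beta> \<open>\<delta> > 0\<close> assms(2) gap gap0
        by (intro prob_explorable_le[where \<beta> = \<beta>]) (auto simp: K_def)
      moreover have "(1/2) ^ L n * real n powr real k \<le> 1 / real n"
      proof -
        have "real n powr real (k + 1) = (2 powr log 2 (real n)) powr real (k + 1)"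
          using elim(2) by simp
        also have "\<dots> = 2 powr (real (k + 1) * log 2 (real n))"
          by (simp only: powr_powr mult.commute)
        also have "\<dots> \<le> 2 powr real (L n)"
          unfolding L_def by (intro powr_mono real_nat_ceiling_ge) auto
        also have "\<dots> = 2 ^ L n" by (simp add: powr_realpow)
        finally have "real n * real n powr real k \<le> 2 ^ L n"
          using elim(2) by (simp add: powr_add mult.commute)
        then show ?thesis using elim(2) by (simp add: field_simps power_one_over)
      qed
      ultimately show ?case unfolding \<eta>\<delta> by linarith
    qed
    have lim: "(\<lambda>n. 2 * real n powr (- d) + 1 / real n) \<longlonglongrightarrow> 0" if "d > 0" for d :: real
    proof -
      have "(\<lambda>n. real n powr (- d)) \<longlonglongrightarrow> 0"
        using that by (intro tendsto_neg_powr filterlim_real_sequentially) simp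
      from tendsto_add[OF tendsto_mult_right_zero[OF this, of 2] lim_1_over_n] show ?thesis by simp
    qed
    show "?P \<longlonglongrightarrow> 0"
    proof (rule tendsto_sandwich[OF _ ev tendsto_const])
      show "(\<lambda>n. 2 * real n powr (- (\<delta> / 2)) + 1 / real n) \<longlonglongrightarrow> 0"
        using \<open>\<delta> > 0\<close> by (intro lim) simp
    qed (rule always_eventually, simp)
  qed (use \<beta> in simp)
qed

section \<open>Balanced edge sets and exploration steps\<close>

text \<open>
  With \<open>\<kappa> = k - 1/m\<close> and \<open>s = 1\<close> this is strict balancedness with respect to \<open>d\<^sub>k(\<cdot>, H\<^sub>2)\<close>; with
  \<open>\<alpha> = 1/m\<close> and \<open>s = 2\<close> it is strict \<open>k\<close>-balancedness, where single edges attain \<open>\<kappa>\<close>.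
\<close>

definition balanced :: "nat \<Rightarrow> real \<Rightarrow> real \<Rightarrow> nat \<Rightarrow> 'v set set \<Rightarrow> bool" where
  "balanced k \<alpha> \<kappa> s F \<longleftrightarrow> finite F \<and> (\<forall>e\<in>F. finite e \<and> card e = k) \<and> excess \<alpha> F = \<kappa> \<and>
     (s = 1 \<or> s = 2 \<and> \<kappa> = real k - \<alpha>) \<and> (\<forall>J. J \<subset> F \<and> s \<le> card J \<longrightarrow> \<kappa> < excess \<alpha> J)"

lemma balanced_excess_ge:
  assumes "balanced k \<alpha> \<kappa> s F" "J \<subseteq> F" "J \<noteq> {}"
  shows "\<kappa> \<le> excess \<alpha> J"
proof (cases "J = F \<or> s \<le> card J")
  case True
  show ?thesis
  proof (cases "J = F")
    case False
    then have "\<kappa> < excess \<alpha> J" using True assms by (simp add: balanced_def psubset_eq)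
    then show ?thesis by simp
  qed (use assms in \<open>simp add: balanced_def\<close>)
next
  case False
  have "finite J" using finite_subset[OF assms(2)] assms(1) by (simp add: balanced_def)
  then have "card J \<noteq> 0" using assms(3) by simp
  then have s: "s = 2" "card J = 1" using False assms(1) by (auto simp: balanced_def)
  then obtain e where "J = {e}" by (auto simp: card_1_singleton_iff)
  then show ?thesis using assms(1,2) s by (simp add: balanced_def excess_def)
qed

lemma excess_union_diff:
  assumes "finite S" "finite A" "\<forall>e\<in>S. finite e" "\<forall>e\<in>A. finite e"
  shows "excess \<alpha> (S \<union> A) - excess \<alpha> S = real (card (\<Union>A - \<Union>S)) - \<alpha> * real (card (A - S))"
proof -
  have "card (S \<union> A) = card S + card (A - S)"
    using assms(1,2) by (subst card_Un_disjoint[symmetric]) auto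
  moreover have "card (\<Union>(S \<union> A)) = card (\<Union>S) + card (\<Union>A - \<Union>S)"
  proof -
    have eq: "\<Union>(S \<union> A) = \<Union>S \<union> (\<Union>A - \<Union>S)" by auto
    show ?thesis unfolding eq using assms by (subst card_Un_disjoint) auto
  qed
  ultimately show ?thesis by (simp add: excess_def algebra_simps)
qed

text \<open>Common vertices are subtracted whether or not a common edge covers them, so additional
  contacts between \<open>A\<close> and \<open>S\<close> can only lower the excess.\<close>

lemma excess_union_balanced:
  assumes "balanced k \<alpha> \<kappa> s A" "finite S" "\<forall>e\<in>S. finite e"
  shows "excess \<alpha> (S \<union> A) - excess \<alpha> S = \<kappa> - (real (card (\<Union>A \<inter> \<Union>S)) - \<alpha> * real (card (A \<inter> S)))"
proof -
  have fin: "finite A" "\<forall>e\<in>A. finite e" and lamA: "excess \<alpha> A = \<kappa>" using assms(1) by (auto simp: balanced_def)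
  have "card (A - S) + card (A \<inter> S) = card A"
    using fin by (metis Int_commute add.commute card_Diff_subset_Int card_mono finite_Int inf_le1 le_add_diff_inverse2 inf_le2)
  moreover have "card (\<Union>A - \<Union>S) + card (\<Union>A \<inter> \<Union>S) = card (\<Union>A)"
  proof -
    have "finite (\<Union>A)" using fin by auto
    then show ?thesis by (metis add.commute card_Diff_subset_Int card_mono finite_Int inf_le1 le_add_diff_inverse2)
  qed
  ultimately have r: "real (card (A - S)) = real (card A) - real (card (A \<inter> S))"
    "real (card (\<Union>A - \<Union>S)) = real (card (\<Union>A)) - real (card (\<Union>A \<inter> \<Union>S))" by linarith+
  have "real (card (\<Union>A)) = \<kappa> + \<alpha> * real (card A)" using lamA by (simp add: excess_def)
  then show ?thesis
    unfolding excess_union_diff[OF assms(2) fin(1) assms(3) fin(2), of \<alpha>] r by (simp add: algebra_simps)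
qed

lemma card_Union_Int_le:
  assumes "finite A" "\<forall>e\<in>A. finite e"
  shows "card (\<Union>(A \<inter> S)) \<le> card (\<Union>A \<inter> \<Union>S)"
  using assms by (intro card_mono) auto

lemma excess_union_balanced_le:
  assumes "balanced k \<alpha> \<kappa> s A" "finite S" "\<forall>e\<in>S. finite e" "A \<inter> S \<noteq> {}"
  shows "excess \<alpha> (S \<union> A) \<le> excess \<alpha> S"
proof -
  have "\<kappa> \<le> excess \<alpha> (A \<inter> S)" using balanced_excess_ge[OF assms(1) _ assms(4)] by simp
  moreover have "real (card (\<Union>(A \<inter> S))) \<le> real (card (\<Union>A \<inter> \<Union>S))"
    using assms(1) card_Union_Int_le[of A S] by (simp add: balanced_def)
  ultimately show ?thesis using excess_union_balanced[OF assms(1-3)] by (simp add: excess_def)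
qed

text \<open>The change is at most \<open>\<kappa> - excess \<alpha> (A \<inter> S)\<close>, negative
  by strict balancedness unless \<open>s = 2\<close> and \<open>A \<inter> S\<close> is the single
  edge \<open>e\<close>. Then it equals \<open>k\<close> minus the number of common vertices, which
  vanishes only if \<open>A\<close> is glued on exactly along \<open>e\<close>.\<close>

lemma grow_union_balanced:
  assumes A: "balanced k \<alpha> \<kappa> s A" and S: "finite S" "\<forall>e\<in>S. finite e"
    and e: "e \<in> A \<inter> S" and nsub: "\<not> A \<subseteq> S" and M: "card A \<le> M"
  shows "grow \<alpha> M S e (S \<union> A)"
proof -
  have fin: "finite A" "\<forall>e\<in>A. finite e" "card e = k" using A e by (auto simp: balanced_def)
  note diff = excess_union_balanced[OF A S]
  have le: "real (card (\<Union>(A \<inter> S))) \<le> real (card (\<Union>A \<inter> \<Union>S))"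
    using card_Union_Int_le[OF fin(1,2)] by simp
  have "excess \<alpha> (S \<union> A) < excess \<alpha> S \<or>
      excess \<alpha> (S \<union> A) \<le> excess \<alpha> S \<and> \<Union>(S \<union> A - S) \<inter> \<Union>S \<subseteq> e"
  proof (cases "s \<le> card (A \<inter> S)")
    case True
    have "\<kappa> < excess \<alpha> (A \<inter> S)" using True A nsub by (auto simp: balanced_def)
    then show ?thesis using diff le by (simp add: excess_def)
  next
    case False
    have "card (A \<inter> S) \<noteq> 0" using e fin by auto
    then have s: "s = 2" "card (A \<inter> S) = 1" "\<kappa> = real k - \<alpha>" using False A by (auto simp: balanced_def)
    have sub: "e \<subseteq> \<Union>A \<inter> \<Union>S" using e by auto
    have fU: "finite (\<Union>A \<inter> \<Union>S)" using fin by auto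
    have diff': "excess \<alpha> (S \<union> A) - excess \<alpha> S = real k - real (card (\<Union>A \<inter> \<Union>S))"
      using diff s by simp
    show ?thesis
    proof (cases "\<Union>A \<inter> \<Union>S = e")
      case True
      then show ?thesis using diff' fin(3) by auto
    next
      case False
      then have "card e < card (\<Union>A \<inter> \<Union>S)" using sub fU by (intro psubset_card_mono) auto
      then show ?thesis using diff' fin(3) by simp
    qed
  qed
  moreover have "card (S \<union> A) \<le> card S + M" using card_Un_le[of S A] M by simp
  ultimately show ?thesis using nsub by (auto simp: grow_def)
qed

lemma excess_union_balanced_less:
  assumes "balanced k \<alpha> \<kappa> 1 A" "finite S" "\<forall>e\<in>S. finite e" "A \<inter> S \<noteq> {}" "\<not> A \<subseteq> S"
  shows "excess \<alpha> (S \<union> A) < excess \<alpha> S"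
proof -
  have fin: "finite A" "\<forall>e\<in>A. finite e" using assms(1) by (auto simp: balanced_def)
  have "card (A \<inter> S) \<noteq> 0" using assms(4) fin by auto
  then have "\<kappa> < excess \<alpha> (A \<inter> S)" using assms(1,5) by (auto simp: balanced_def)
  then show ?thesis
    using excess_union_balanced[OF assms(1-3)] card_Union_Int_le[OF fin, of S] by (simp add: excess_def)
qed

text \<open>
  The sets \<open>A f\<close> may share edges. They are merged into clusters of excess at most \<open>\<kappa>\<close>; a cluster
  meeting \<open>F\<close> in \<open>K\<close> then costs no more than \<open>card K\<close> separate sets because \<open>\<kappa> \<le> excess (1/m) K\<close>.
\<close>

lemma cluster_bound:
  fixes A :: "'v set \<Rightarrow> 'v set set"
  assumes "finite F" "finite V" "\<Union>F \<subseteq> V" "m > 0"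
    and A: "\<And>f. f \<in> F \<Longrightarrow> balanced k \<alpha> \<kappa> s (A f) \<and> f \<in> A f"
    and F: "\<And>K. K \<noteq> {} \<Longrightarrow> K \<subseteq> F \<Longrightarrow> \<kappa> \<le> excess (1 / m) K"
  shows "real (card (\<Union>(\<Union>f\<in>F. A f) - V)) - \<alpha> * real (card (\<Union>f\<in>F. A f)) \<le> - (real (card F) / m)"
  using assms(1,3) A F
proof (induction "card F" arbitrary: F rule: less_induct)
  case less
  let ?Y = "\<lambda>K. \<Union>f\<in>K. A f"
  note A = less.prems(3)
  have finA: "finite (A f)" "\<forall>e\<in>A f. finite e" if "f \<in> F" for f using A[OF that] by (auto simp: balanced_def)
  show ?case
  proof (cases "F = {}")
    case False
    \<comment> \<open>Candidates for a cluster; a largest one is split off and induction handles the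
      rest of \<open>F\<close>.\<close>
    define KK where "KK = {K. K \<noteq> {} \<and> K \<subseteq> F \<and> excess \<alpha> (?Y K) \<le> \<kappa>}"
    have finKK: "finite KK" unfolding KK_def by (rule finite_subset[of _ "Pow F"]) (use less.prems in auto)
    from False obtain f0 where f0: "f0 \<in> F" by auto
    then have "{f0} \<in> KK" using A[OF f0] by (auto simp: KK_def balanced_def)
    then have "Max (card ` KK) \<in> card ` KK" using finKK by (intro Max_in) auto
    then obtain K where K: "K \<in> KK" and Kmax': "card K = Max (card ` KK)" by auto
    have Kmax: "card K' \<le> card K" if "K' \<in> KK" for K' unfolding Kmax' using finKK that by simp
    have K': "K \<noteq> {}" "K \<subseteq> F" "excess \<alpha> (?Y K) \<le> \<kappa>" using K by (auto simp: KK_def)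
    have finK: "finite K" using K'(2) less.prems(1) finite_subset by auto
    have finY: "finite (?Y K)" "\<forall>e\<in>?Y K. finite e" using finK K'(2) finA by auto
    \<comment> \<open>An \<open>A f\<close> sharing an edge with the cluster could be merged into it
      without raising the excess, against maximality. Common vertices alone are harmless, since they
      only shrink the union.\<close>
    have disj1: "A f \<inter> ?Y K = {}" if f: "f \<in> F - K" for f
    proof (rule ccontr)
      assume "A f \<inter> ?Y K \<noteq> {}"
      then have "excess \<alpha> (?Y K \<union> A f) \<le> excess \<alpha> (?Y K)"
        using excess_union_balanced_le[of k \<alpha> \<kappa> s "A f" "?Y K"] A[of f] f finY by auto
      moreover have "?Y (insert f K) = ?Y K \<union> A f" by auto
      ultimately have "insert f K \<in> KK" using K' f by (auto simp: KK_def)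
      from Kmax[OF this] show False using f finK by simp
    qed
    let ?\<phi> = "\<lambda>K. real (card (\<Union>(?Y K) - V)) - \<alpha> * real (card (?Y K))"
    have YF: "?Y F = ?Y K \<union> ?Y (F - K)" using K' by auto
    have fin2: "finite (?Y (F - K))" "\<forall>e\<in>?Y (F - K). finite e" using less.prems(1) finA by auto
    have "card (?Y F) = card (?Y K) + card (?Y (F - K))"
      unfolding YF using disj1 finY fin2 by (intro card_Un_disjoint) auto
    moreover have "card (\<Union>(?Y F) - V) \<le> card (\<Union>(?Y K) - V) + card (\<Union>(?Y (F - K)) - V)"
    proof -
      have "\<Union>(?Y F) - V = (\<Union>(?Y K) - V) \<union> (\<Union>(?Y (F - K)) - V)" unfolding YF by auto
      then show ?thesis by (simp add: card_Un_le)
    qed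
    ultimately have "?\<phi> F \<le> ?\<phi> K + ?\<phi> (F - K)" by (simp add: algebra_simps)
    \<comment> \<open>The cluster contains all of \<open>K\<close>, whose vertices lie in
      \<open>V\<close> and are not counted: what remains is at most
      \<open>\<kappa> - card (\<Union>K)\<close>, and
      \<open>\<kappa> \<le> excess (1 / m) K\<close>.\<close>
    moreover have "?\<phi> K \<le> - (real (card K) / m)"
    proof -
      have sub: "\<Union>K \<subseteq> \<Union>(?Y K)" using A K'(2) by auto
      have finU: "finite (\<Union>(?Y K))" using finY by auto
      have "card (\<Union>(?Y K) - V) \<le> card (\<Union>(?Y K) - \<Union>K)"
        using finU less.prems(2) K'(2) by (intro card_mono) auto
      also have "\<dots> = card (\<Union>(?Y K)) - card (\<Union>K)"
        using sub finU by (intro card_Diff_subset) (auto intro: finite_subset)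
      finally have "real (card (\<Union>(?Y K) - V)) \<le> real (card (\<Union>(?Y K))) - real (card (\<Union>K))"
        using card_mono[OF finU sub] by linarith
      then have "?\<phi> K \<le> \<kappa> - real (card (\<Union>K))" using K'(3) by (simp add: excess_def)
      also have "\<dots> \<le> - (real (card K) / m)"
        using less.prems(4)[OF K'(1,2)] by (simp add: excess_def)
      finally show ?thesis .
    qed
    moreover have "?\<phi> (F - K) \<le> - (real (card (F - K)) / m)"
    proof (rule less.hyps)
      show "card (F - K) < card F" using K' less.prems(1) by (intro psubset_card_mono) auto
      show "\<kappa> \<le> excess (1 / m) J" if "J \<noteq> {}" "J \<subseteq> F - K" for J
        using less.prems(4)[of J] that by auto
    qed (use less.prems in auto)
    moreover have "real (card F) / m = real (card K) / m + real (card (F - K)) / m"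
      using card_Diff_subset[OF finK K'(2)] card_mono[OF less.prems(1) K'(2)]
      by (simp flip: add_divide_distrib)
    ultimately show ?thesis by linarith
  qed simp
qed

text \<open>By \<open>cluster_bound\<close> the new edges of \<open>B\<close> together with
  everything hanging on them cost at least \<open>1 / m\<close> each, so the step is no worse than
  adding \<open>B\<close> at density \<open>m\<close>. The case distinction of
  \<open>grow_union_balanced\<close> then applies with \<open>1 / m\<close> in place of
  \<open>\<alpha>\<close>.\<close>

lemma grow_union_cluster:
  fixes A :: "'v set \<Rightarrow> 'v set set"
  assumes B: "balanced k (1 / m) \<kappa> 2 B" and "m > 0" and S: "finite S" "\<forall>e\<in>S. finite e"
    and e: "e \<in> B \<inter> S" and nsub: "\<not> B \<subseteq> S"
    and A: "\<And>f. f \<in> B - S \<Longrightarrow> balanced k \<alpha> \<kappa> s (A f) \<and> A f \<inter> B = {f} \<and> A f \<inter> S = {} \<and> card (A f) \<le> N"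
    and M: "card B * N \<le> M"
  shows "grow \<alpha> M S e (S \<union> (\<Union>f\<in>B - S. A f))"
proof -
  define F where "F = B - S"
  define Y where "Y = (\<Union>f\<in>F. A f)"
  define V where "V = \<Union>B"
  have finB: "finite B" "\<forall>e\<in>B. finite e" "card e = k" and \<kappa>: "\<kappa> = real k - 1 / m"
    and lamB: "excess (1 / m) B = \<kappa>"
    using B e by (auto simp: balanced_def)
  have AF: "balanced k \<alpha> \<kappa> s (A f)" "f \<in> A f" "A f \<inter> S = {}" "card (A f) \<le> N" if "f \<in> F" for f
    using A[of f] that by (auto simp: F_def)
  have finF: "finite F" using finB by (simp add: F_def)
  have finY: "finite Y" "\<forall>e\<in>Y. finite e" using AF(1) finF by (auto simp: Y_def balanced_def)
  have YS: "Y \<inter> S = {}" using AF(3) by (auto simp: Y_def)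
  have FY: "F \<subseteq> Y" using AF(2) by (auto simp: Y_def)
  have finV: "finite V" using finB by (auto simp: V_def)
  have clus: "real (card (\<Union>Y - V)) - \<alpha> * real (card Y) \<le> - (real (card F) / m)"
    unfolding Y_def
  proof (rule cluster_bound[OF finF finV _ \<open>m > 0\<close>])
    show "\<kappa> \<le> excess (1 / m) K" if "K \<noteq> {}" "K \<subseteq> F" for K
      using balanced_excess_ge[OF B, of K] that by (auto simp: F_def)
  qed (use AF in \<open>auto simp: F_def V_def\<close>)
  \<comment> \<open>Vertices exposed already: \<open>W\<close> within \<open>B\<close>, and
    \<open>O'\<close> among the outer vertices of the attached copies. A neutral step must have
    \<open>W = e\<close> and empty \<open>O'\<close>.\<close>
  define W where "W = V \<inter> \<Union>S"
  define O' where "O' = (\<Union>Y - V) \<inter> \<Union>S"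
  have finUY: "finite (\<Union>Y)" using finY by auto
  have "card (\<Union>Y - \<Union>S) \<le> card ((V - W) \<union> ((\<Union>Y - V) - O'))"
    using finV finUY by (intro card_mono) (auto simp: W_def O'_def)
  also have "\<dots> \<le> card (V - W) + card ((\<Union>Y - V) - O')" by (rule card_Un_le)
  also have "card (V - W) = card V - card W"
    using finV by (intro card_Diff_subset) (auto simp: W_def)
  also have "card ((\<Union>Y - V) - O') = card (\<Union>Y - V) - card O'"
    using finUY by (intro card_Diff_subset) (auto simp: O'_def)
  finally have 1: "real (card (\<Union>Y - \<Union>S)) \<le> real (card V) - real (card W) + (real (card (\<Union>Y - V)) - real (card O'))"
    using card_mono[of V W] card_mono[of "\<Union>Y - V" O'] finV finUY by (auto simp: W_def O'_def)
  have "card F = card B - card (B \<inter> S)" unfolding F_def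
    using finB by (metis card_Diff_subset_Int finite_Int)
  then have cF: "real (card F) = real (card B) - real (card (B \<inter> S))"
    using card_mono[of B "B \<inter> S"] finB by auto
  have diff: "excess \<alpha> (S \<union> Y) - excess \<alpha> S = real (card (\<Union>Y - \<Union>S)) - \<alpha> * real (card Y)"
    using excess_union_diff[OF S(1) finY(1) S(2) finY(2), of \<alpha>] YS by (simp add: Diff_triv)
  have "excess \<alpha> (S \<union> Y) - excess \<alpha> S \<le> real (card V) - real (card W) - real (card O') - real (card F) / m"
    using diff 1 clus by linarith
  also have "real (card V) = \<kappa> + real (card B) / m" using lamB by (simp add: excess_def V_def)
  finally have 2: "excess \<alpha> (S \<union> Y) - excess \<alpha> S \<le> \<kappa> + real (card (B \<inter> S)) / m - real (card W) - real (card O')"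
    by (simp add: cF diff_divide_distrib)
  have "excess \<alpha> (S \<union> Y) < excess \<alpha> S \<or>
      excess \<alpha> (S \<union> Y) \<le> excess \<alpha> S \<and> \<Union>(S \<union> Y - S) \<inter> \<Union>S \<subseteq> e"
  proof (cases "2 \<le> card (B \<inter> S)")
    case True
    then have "\<kappa> < excess (1 / m) (B \<inter> S)" using B nsub by (auto simp: balanced_def)
    also have "\<dots> \<le> real (card W) - real (card (B \<inter> S)) / m"
      using card_Union_Int_le[OF finB(1,2), of S] by (simp add: excess_def W_def V_def)
    finally show ?thesis using 2 by linarith
  next
    case False
    have "card (B \<inter> S) \<noteq> 0" using e finB by auto
    then have "card (B \<inter> S) = 1" using False by simp
    then have 3: "excess \<alpha> (S \<union> Y) - excess \<alpha> S \<le> real k - real (card W) - real (card O')"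
      using 2 \<kappa> by simp
    have sub: "e \<subseteq> W" using e by (auto simp: W_def V_def)
    show ?thesis
    proof (cases "W = e \<and> O' = {}")
      case True
      then have "\<Union>(S \<union> Y - S) \<inter> \<Union>S \<subseteq> e" by (auto simp: W_def O'_def)
      then show ?thesis using 3 True finB(3) by auto
    next
      case False
      have "finite O'" "finite W" using finUY finV by (auto simp: O'_def W_def)
      then have "k \<le> card W" "k < card W \<or> 0 < card O'"
        using False sub finB(3) card_mono[of W e] psubset_card_mono[of W e] by (auto simp: card_gt_0_iff)
      then show ?thesis using 3 by auto
    qed
  qed
  moreover have "card (S \<union> Y) \<le> card S + M"
  proof -
    have "card Y \<le> (\<Sum>f\<in>F. card (A f))" unfolding Y_def using finF by (rule card_UN_le)
    also have "\<dots> \<le> card F * N" using sum_bounded_above[of F "\<lambda>f. card (A f)" N] AF(4) by simp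
    also have "\<dots> \<le> card B * N" using finB by (intro mult_le_mono1 card_mono) (auto simp: F_def)
    finally show ?thesis using card_Un_le[of S Y] M by linarith
  qed
  moreover have "S \<subset> S \<union> Y" using nsub FY YS by (auto simp: F_def)
  ultimately show ?thesis unfolding grow_def Y_def F_def by blast
qed

section \<open>Critical systems of copies\<close>

text \<open>\<open>c e\<close> says that \<open>e\<close> has the first colour; \<open>\<A>\<close>
  will consist of copies of H1', \<open>\<B>\<close> of copies of H2'.\<close>

definition two_colouring :: "'e set set \<Rightarrow> 'e set set \<Rightarrow> ('e \<Rightarrow> bool) \<Rightarrow> bool" where
  "two_colouring \<A> \<B> c \<longleftrightarrow> (\<forall>A\<in>\<A>. \<exists>e\<in>A. \<not> c e) \<and> (\<forall>B\<in>\<B>. \<exists>e\<in>B. c e)"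

definition critical :: "'e set set \<Rightarrow> 'e set set \<Rightarrow> bool" where
  "critical \<A> \<B> \<longleftrightarrow> (\<nexists>c. two_colouring \<A> \<B> c) \<and>
     (\<forall>\<A>' \<B>'. \<A>' \<subseteq> \<A> \<and> \<B>' \<subseteq> \<B> \<and> (\<A>' \<noteq> \<A> \<or> \<B>' \<noteq> \<B>) \<longrightarrow> (\<exists>c. two_colouring \<A>' \<B>' c))"

lemma criticalD:
  assumes "critical \<A> \<B>"
  shows "\<not> two_colouring \<A> \<B> c"
    and "\<A>' \<subseteq> \<A> \<Longrightarrow> \<B>' \<subseteq> \<B> \<Longrightarrow> \<A>' \<noteq> \<A> \<or> \<B>' \<noteq> \<B> \<Longrightarrow> \<exists>c. two_colouring \<A>' \<B>' c"
  using assms by (simp_all add: critical_def)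

lemma critical_exists:
  assumes "finite \<A>" "finite \<B>" "\<nexists>c. two_colouring \<A> \<B> c"
  obtains \<A>' \<B>' where "\<A>' \<subseteq> \<A>" "\<B>' \<subseteq> \<B>" "critical \<A>' \<B>'"
proof -
  have "\<exists>\<A>'\<subseteq>\<A>. \<exists>\<B>'\<subseteq>\<B>. critical \<A>' \<B>'"
    using assms
  proof (induction "card \<A> + card \<B>" arbitrary: \<A> \<B> rule: less_induct)
    case less
    show ?case
    proof (cases "critical \<A> \<B>")
      case False
      then obtain \<A>' \<B>' where 1: "\<A>' \<subseteq> \<A>" "\<B>' \<subseteq> \<B>" "\<A>' \<noteq> \<A> \<or> \<B>' \<noteq> \<B>" "\<nexists>c. two_colouring \<A>' \<B>' c"
        using less.prems(3) unfolding critical_def by blast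
      have fin: "finite \<A>'" "finite \<B>'" using 1 less.prems finite_subset by blast+
      have "card \<A>' \<le> card \<A>" "card \<B>' \<le> card \<B>" using 1 less.prems by (auto intro: card_mono)
      moreover have "card \<A>' < card \<A> \<or> card \<B>' < card \<B>"
        using 1 less.prems psubset_card_mono by blast
      ultimately have "card \<A>' + card \<B>' < card \<A> + card \<B>" by linarith
      from less.hyps[OF this fin 1(4)] show ?thesis using 1(1,2) by (meson order_trans)
    qed blast
  qed
  then show ?thesis using that by blast
qed

text \<open>A colouring that works without \<open>B\<close> must give all of \<open>B\<close> the
  second colour. Recolouring \<open>e\<close> repairs \<open>B\<close>, hence destroys some
  \<open>A\<close>; all other edges of that \<open>A\<close> had the first colour, so they avoid
  \<open>B\<close>.\<close>

lemma critical_link: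
  assumes "critical \<A> \<B>" "B \<in> \<B>" "e \<in> B"
  shows "\<exists>A\<in>\<A>. A \<inter> B = {e}"
proof -
  note no = criticalD(1)[OF assms(1)]
  have "\<exists>c. two_colouring \<A> (\<B> - {B}) c" using assms(2) by (intro criticalD(2)[OF assms(1)]) auto
  then obtain c where c: "two_colouring \<A> (\<B> - {B}) c" by blast
  have cB: "\<not> c x" if "x \<in> B" for x
  proof
    assume "c x"
    then have "two_colouring \<A> \<B> c" using c that unfolding two_colouring_def by blast
    then show False using no by blast
  qed
  have "\<not> two_colouring \<A> \<B> (c(e := True))" by (rule no)
  moreover have "\<forall>B\<in>\<B>. \<exists>x\<in>B. (c(e := True)) x"
    using c assms(2,3) unfolding two_colouring_def by (metis DiffI fun_upd_apply singletonD)
  ultimately obtain A where A: "A \<in> \<A>" "\<forall>x\<in>A. (c(e := True)) x" unfolding two_colouring_def by blast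
  obtain x where "x \<in> A" "\<not> c x" using c A(1) unfolding two_colouring_def by blast
  then have "e \<in> A" using A(2) by (auto split: if_splits)
  then have "A \<inter> B = {e}" using A(2) cB assms(3) by (auto split: if_splits)
  then show ?thesis using A(1) by blast
qed

text \<open>Otherwise every member lies inside \<open>S\<close> or is disjoint from it, and
  colourings of the two proper subsystems can be combined.\<close>

lemma critical_connected:
  assumes "critical \<A> \<B>" "S \<noteq> {}" "S \<subset> \<Union>\<A> \<union> \<Union>\<B>"
  shows "\<exists>D\<in>\<A> \<union> \<B>. D \<inter> S \<noteq> {} \<and> \<not> D \<subseteq> S"
proof (rule ccontr)
  assume "\<not> ?thesis"
  then have split: "D \<inter> S = {} \<or> D \<subseteq> S" if "D \<in> \<A> \<union> \<B>" for D using that by blast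
  define \<A>1 \<B>1 \<A>2 \<B>2 where "\<A>1 = {D \<in> \<A>. D \<subseteq> S}" and "\<B>1 = {D \<in> \<B>. D \<subseteq> S}"
    and "\<A>2 = {D \<in> \<A>. D \<inter> S = {}}" and "\<B>2 = {D \<in> \<B>. D \<inter> S = {}}"
  note defs = \<A>1_def \<B>1_def \<A>2_def \<B>2_def
  obtain x where "x \<in> S" using assms(2) by blast
  then obtain D1 where D1: "D1 \<in> \<A> \<union> \<B>" "x \<in> D1" using assms(3) by blast
  obtain y where "y \<notin> S" "y \<in> \<Union>\<A> \<union> \<Union>\<B>" using assms(3) by blast
  then obtain D2 where D2: "D2 \<in> \<A> \<union> \<B>" "y \<in> D2" by blast
  have "\<A>1 \<noteq> \<A> \<or> \<B>1 \<noteq> \<B>" using D2 \<open>y \<notin> S\<close> unfolding defs by blast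
  then have "\<exists>c. two_colouring \<A>1 \<B>1 c"
    by (intro criticalD(2)[OF assms(1)]) (auto simp: defs)
  then obtain c1 where c1: "two_colouring \<A>1 \<B>1 c1" by blast
  have "\<A>2 \<noteq> \<A> \<or> \<B>2 \<noteq> \<B>" using D1 \<open>x \<in> S\<close> unfolding defs by blast
  then have "\<exists>c. two_colouring \<A>2 \<B>2 c"
    by (intro criticalD(2)[OF assms(1)]) (auto simp: defs)
  then obtain c2 where c2: "two_colouring \<A>2 \<B>2 c2" by blast
  define c where "c e = (if e \<in> S then c1 e else c2 e)" for e
  have "\<exists>e\<in>A. \<not> c e" if "A \<in> \<A>" for A
  proof (cases "A \<subseteq> S")
    case True
    then have "A \<in> \<A>1" using that by (simp add: defs)
    then show ?thesis using c1 True unfolding two_colouring_def c_def by (metis subsetD)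
  next
    case False
    then have "A \<in> \<A>2" "A \<inter> S = {}" using that split[of A] by (auto simp: defs)
    then show ?thesis using c2 unfolding two_colouring_def c_def by (metis disjoint_iff)
  qed
  moreover have "\<exists>e\<in>B. c e" if "B \<in> \<B>" for B
  proof (cases "B \<subseteq> S")
    case True
    then have "B \<in> \<B>1" using that by (simp add: defs)
    then show ?thesis using c1 True unfolding two_colouring_def c_def by (metis subsetD)
  next
    case False
    then have "B \<in> \<B>2" "B \<inter> S = {}" using that split[of B] by (auto simp: defs)
    then show ?thesis using c2 unfolding two_colouring_def c_def by (metis disjoint_iff)
  qed
  ultimately have "two_colouring \<A> \<B> c" by (simp add: two_colouring_def)
  then show False using criticalD(1)[OF assms(1)] by blast
qed

text \<open>The delicate situation is a copy \<open>D\<close> of H2' with \<open>s = 1\<close>. If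
  some copy of H1' is partly exposed, completing it strictly lowers the excess, so it may be added
  even when it lies far from \<open>e\<close>. If none is, the copies linked to the new edges of
  \<open>D\<close> are disjoint from \<open>S\<close>, as the compound step requires.\<close>

lemma critical_explorable:
  fixes \<A> \<B> :: "'v set set set"
  assumes crit: "critical \<A> \<B>" and fin: "finite \<A>" "finite \<B>"
    and A: "\<And>A. A \<in> \<A> \<Longrightarrow> balanced k \<alpha> \<kappa> s A \<and> card A \<le> e1"
    and B: "\<And>B. B \<in> \<B> \<Longrightarrow> balanced k (1 / m) \<kappa> 2 B \<and> card B \<le> e2"
    and "m > 0" "\<kappa> \<noteq> 0" and s: "s = 1 \<or> \<alpha> = 1 / m"
  shows "explorable \<alpha> (e1 + e2 + e2 * e1) (\<Union>\<A> \<union> \<Union>\<B>)"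
proof -
  let ?C = "\<Union>\<A> \<union> \<Union>\<B>" let ?M = "e1 + e2 + e2 * e1"
  have finC: "finite ?C" using fin A B by (auto simp: balanced_def)
  have finC': "\<forall>e\<in>?C. finite e"
  proof
    fix e assume "e \<in> ?C"
    then consider D where "D \<in> \<A>" "e \<in> D" | D where "D \<in> \<B>" "e \<in> D" by blast
    then show "finite e" using A B by cases (auto simp: balanced_def)
  qed
  have "?C \<noteq> {}"
  proof
    assume "?C = {}"
    \<comment> \<open>The empty edge set has excess 0, so \<open>\<kappa> \<noteq> 0\<close>
      excludes empty members.\<close>
    moreover have "{} \<notin> \<A>" "{} \<notin> \<B>"
      using A[of "{}"] B[of "{}"] \<open>\<kappa> \<noteq> 0\<close> by (auto simp: balanced_def excess_def)
    ultimately have "\<A> = {}" "\<B> = {}" by (metis Un_empty Union_empty_conv all_not_in_conv)+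
    then show False using criticalD(1)[OF crit] by (simp add: two_colouring_def)
  qed
  moreover have "\<exists>T\<subseteq>?C. grow \<alpha> ?M S e T"
    if S: "S \<subseteq> ?C" and D: "D \<in> \<A> \<union> \<B>" "e \<in> D \<inter> S" "\<not> D \<subseteq> S" for S D e
  proof -
    have finS: "finite S" "\<forall>e\<in>S. finite e" using S finC finC' by (auto intro: finite_subset)
    consider "D \<in> \<A>" | A where "D \<in> \<B>" "s = 1" "A \<in> \<A>" "A \<inter> S \<noteq> {}" "\<not> A \<subseteq> S"
      | "D \<in> \<B>" "\<forall>A\<in>\<A>. A \<inter> S \<noteq> {} \<longrightarrow> A \<subseteq> S" | "D \<in> \<B>" "\<alpha> = 1 / m"
      using D(1) s by blast
    then show ?thesis
    proof cases
      case 1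
      note bD = A[OF 1]
      have "grow \<alpha> ?M S e (S \<union> D)"
        by (rule grow_union_balanced[OF conjunct1[OF bD] finS D(2,3)]) (use conjunct2[OF bD] in linarith)
      moreover have "S \<union> D \<subseteq> ?C" using S 1 by blast
      ultimately show ?thesis by blast
    next
      case (2 A)
      have bA: "balanced k \<alpha> \<kappa> 1 A" "card A \<le> e1" using assms(4)[OF 2(3)] 2(2) by auto
      have "excess \<alpha> (S \<union> A) < excess \<alpha> S" by (rule excess_union_balanced_less[OF bA(1) finS 2(4,5)])
      moreover have "card (S \<union> A) \<le> card S + ?M" using card_Un_le[of S A] bA(2) by simp
      ultimately have "grow \<alpha> ?M S e (S \<union> A)" using 2(5) unfolding grow_def by blast
      moreover have "S \<union> A \<subseteq> ?C" using S 2(3) by blast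
      ultimately show ?thesis by blast
    next
      case 3
      have "\<forall>f\<in>D. \<exists>A\<in>\<A>. A \<inter> D = {f}" using critical_link[OF crit 3(1)] by blast
      then obtain a where a: "\<And>f. f \<in> D \<Longrightarrow> a f \<in> \<A> \<and> a f \<inter> D = {f}" by metis
      have "grow \<alpha> ?M S e (S \<union> (\<Union>f\<in>D - S. a f))"
      proof (rule grow_union_cluster[OF _ \<open>m > 0\<close> finS D(2,3)])
        fix f assume f: "f \<in> D - S"
        have "\<not> a f \<subseteq> S" using f a[of f] by blast
        then have "a f \<inter> S = {}" using 3(2) a[of f] f by blast
        then show "balanced k \<alpha> \<kappa> s (a f) \<and> a f \<inter> D = {f} \<and> a f \<inter> S = {} \<and> card (a f) \<le> e1"
          using a[of f] f A[of "a f"] by simp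
      next
        have "card D * e1 \<le> e2 * e1" using B[OF 3(1)] by (intro mult_le_mono1) simp
        then show "card D * e1 \<le> ?M" by (rule trans_le_add2)
      qed (use B[OF 3(1)] in simp)
      moreover have "S \<union> (\<Union>f\<in>D - S. a f) \<subseteq> ?C" using S a by blast
      ultimately show ?thesis by blast
    next
      case 4
      note bD = B[OF 4(1), folded 4(2)]
      have "grow \<alpha> ?M S e (S \<union> D)"
        by (rule grow_union_balanced[OF conjunct1[OF bD] finS D(2,3)]) (use conjunct2[OF bD] in linarith)
      moreover have "S \<union> D \<subseteq> ?C" using S 4(1) by blast
      ultimately show ?thesis by blast
    qed
  qed
  ultimately show ?thesis
    using finC critical_connected[OF crit] unfolding explorable_def
    by (intro conjI exI[of _ "\<A> \<union> \<B>"] allI impI) metis+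
qed

section \<open>Sparse set systems\<close>

lemma homogeneous_system:
  fixes a :: "'q \<Rightarrow> 'v \<Rightarrow> real"
  assumes "finite Q" "finite V" "card Q < card V"
  shows "\<exists>x. (\<exists>v\<in>V. x v \<noteq> 0) \<and> (\<forall>q\<in>Q. (\<Sum>v\<in>V. a q v * x v) = 0)"
  using assms
proof (induction Q arbitrary: V a rule: finite_induct)
  case empty
  then have "V \<noteq> {}" by auto
  then show ?case by (intro exI[of _ "\<lambda>_. 1"]) auto
next
  case (insert q Q)
  show ?case
  proof (cases "\<forall>v\<in>V. a q v = 0")
    case True
    obtain x where "\<exists>v\<in>V. x v \<noteq> 0" "\<forall>q\<in>Q. (\<Sum>v\<in>V. a q v * x v) = 0"
      using insert.IH[of V a] insert.prems insert.hyps by auto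
    then show ?thesis using True by (intro exI[of _ x]) auto
  next
    case False
    then obtain w where w: "w \<in> V" "a q w \<noteq> 0" by auto
    \<comment> \<open>Gaussian elimination with pivot \<open>a q w\<close>: the system left after
      solving equation \<open>q\<close> for the variable \<open>w\<close>.\<close>
    define b where "b r v = a r v - a r w * a q v / a q w" for r v
    have "card Q < card (V - {w})" using insert.prems insert.hyps w by simp
    then obtain x where x: "\<exists>v\<in>V - {w}. x v \<noteq> 0" "\<forall>r\<in>Q. (\<Sum>v\<in>V - {w}. b r v * x v) = 0"
      using insert.IH[of "V - {w}" b] insert.prems by auto
    define y where "y = x(w := - (\<Sum>v\<in>V - {w}. a q v * x v) / a q w)"
    have y: "(\<Sum>v\<in>V. a r v * y v) =
        (\<Sum>v\<in>V - {w}. a r v * x v) - a r w * (\<Sum>v\<in>V - {w}. a q v * x v) / a q w" for r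
    proof -
      have "(\<Sum>v\<in>V. a r v * y v) = a r w * y w + (\<Sum>v\<in>V - {w}. a r v * y v)"
        by (rule sum.remove[OF insert.prems(1) w(1)])
      also have "(\<Sum>v\<in>V - {w}. a r v * y v) = (\<Sum>v\<in>V - {w}. a r v * x v)"
        by (rule sum.cong) (auto simp: y_def)
      finally show ?thesis by (simp add: y_def)
    qed
    have "(\<Sum>v\<in>V. a q v * y v) = 0" using y[of q] w(2) by simp
    moreover have "(\<Sum>v\<in>V. a r v * y v) = 0" if "r \<in> Q" for r
    proof -
      have "(\<Sum>v\<in>V - {w}. b r v * x v) =
          (\<Sum>v\<in>V - {w}. a r v * x v) - (\<Sum>v\<in>V - {w}. a r w / a q w * (a q v * x v))"
        unfolding b_def by (subst sum_subtractf[symmetric]) (simp add: algebra_simps)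
      also have "(\<Sum>v\<in>V - {w}. a r w / a q w * (a q v * x v)) = a r w / a q w * (\<Sum>v\<in>V - {w}. a q v * x v)"
        by (rule sum_distrib_left[symmetric])
      finally show ?thesis using x(2) that y[of r] by simp
    qed
    moreover have "\<exists>v\<in>V. y v \<noteq> 0" using x(1) by (auto simp: y_def)
    ultimately show ?thesis by (intro exI[of _ y]) auto
  qed
qed

text \<open>Seymour's sign argument: a nonzero solution of \<open>\<Sum>v\<in>Q. x v = 0\<close> takes both signs on every
  block on which it does not vanish identically, and one recurses on its zero set.\<close>

lemma sparse_family_two_colourable:
  assumes "finite V" "\<And>W. W \<subseteq> V \<Longrightarrow> W \<noteq> {} \<Longrightarrow> card {Q \<in> \<Q>. Q \<subseteq> W} < card W" "{} \<notin> \<Q>"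
  shows "\<exists>c :: 'v \<Rightarrow> bool. \<forall>Q\<in>\<Q>. Q \<subseteq> V \<longrightarrow> (\<exists>u\<in>Q. c u) \<and> (\<exists>u\<in>Q. \<not> c u)"
  using assms(1,2)
proof (induction "card V" arbitrary: V rule: less_induct)
  case less
  show ?case
  proof (cases "V = {}")
    case True
    then show ?thesis using assms(3) by auto
  next
    case False
    have "finite {Q \<in> \<Q>. Q \<subseteq> V}"
      by (rule finite_subset[of _ "Pow V"]) (use less.prems(1) in auto)
    moreover have "card {Q \<in> \<Q>. Q \<subseteq> V} < card V" using less.prems(2)[of V] False by simp
    ultimately have "\<exists>x. (\<exists>v\<in>V. x v \<noteq> 0) \<and>
        (\<forall>Q\<in>{Q \<in> \<Q>. Q \<subseteq> V}. (\<Sum>v\<in>V. (if v \<in> Q then 1 else 0) * x v) = (0::real))"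
      by (intro homogeneous_system less.prems(1))
    then obtain x :: "'v \<Rightarrow> real" where x: "\<exists>v\<in>V. x v \<noteq> 0"
      and "\<forall>Q\<in>{Q \<in> \<Q>. Q \<subseteq> V}. (\<Sum>v\<in>V. (if v \<in> Q then 1 else 0) * x v) = 0"
      by blast
    then have sum0: "(\<Sum>v\<in>V. (if v \<in> Q then 1 else 0) * x v) = 0" if "Q \<in> \<Q>" "Q \<subseteq> V" for Q
      using that by blast
    have sumQ: "(\<Sum>v\<in>Q. x v) = 0" if "Q \<in> \<Q>" "Q \<subseteq> V" for Q
    proof -
      have "(\<Sum>v\<in>V. (if v \<in> Q then 1 else 0) * x v) = (\<Sum>v\<in>V. if v \<in> Q then x v else 0)"
        by (rule sum.cong) auto
      also have "\<dots> = (\<Sum>v\<in>V \<inter> Q. x v)" by (rule sum.inter_restrict[OF less.prems(1), symmetric])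
      finally show ?thesis using sum0[OF that] that(2) by (simp add: Int_absorb1)
    qed
    define Z where "Z = {v \<in> V. x v = 0}"
    have Z: "Z \<subset> V" using x by (auto simp: Z_def)
    have "card Z < card V" using Z less.prems(1) by (intro psubset_card_mono)
    moreover have "finite Z" using Z less.prems(1) by (auto intro: finite_subset)
    moreover have "card {Q \<in> \<Q>. Q \<subseteq> W} < card W" if "W \<subseteq> Z" "W \<noteq> {}" for W
      using less.prems(2)[of W] that Z by simp
    ultimately have "\<exists>c :: 'v \<Rightarrow> bool. \<forall>Q\<in>\<Q>. Q \<subseteq> Z \<longrightarrow> (\<exists>u\<in>Q. c u) \<and> (\<exists>u\<in>Q. \<not> c u)"
      by (rule less.hyps)
    then obtain c where c: "\<forall>Q\<in>\<Q>. Q \<subseteq> Z \<longrightarrow> (\<exists>u\<in>Q. c u) \<and> (\<exists>u\<in>Q. \<not> c u)"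
      by (rule exE)
    define d where "d v = (if x v = 0 then c v else x v > 0)" for v
    have "(\<exists>u\<in>Q. d u) \<and> (\<exists>u\<in>Q. \<not> d u)" if Q: "Q \<in> \<Q>" "Q \<subseteq> V" for Q
    proof (cases "Q \<subseteq> Z")
      case True
      then have "(\<exists>u\<in>Q. c u) \<and> (\<exists>u\<in>Q. \<not> c u)" using c Q(1) by blast
      moreover have "d u = c u" if "u \<in> Q" for u using that True by (auto simp: d_def Z_def)
      ultimately show ?thesis by simp
    next
      case False
      then obtain w where w: "w \<in> Q" "x w \<noteq> 0" using Q(2) by (auto simp: Z_def)
      have finQ: "finite Q" using Q(2) less.prems(1) by (rule finite_subset)
      have "\<exists>u\<in>Q. x u > 0"
      proof (rule ccontr)
        assume "\<not> ?thesis"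
        then have "\<forall>u\<in>Q. - x u \<ge> 0" by (auto simp: not_less)
        moreover have "(\<Sum>u\<in>Q. - x u) = 0" using sumQ[OF Q] by (simp add: sum_negf)
        ultimately have "- x w = 0" using sum_nonneg_eq_0_iff[OF finQ, of "\<lambda>u. - x u"] w(1) by blast
        then show False using w(2) by simp
      qed
      moreover have "\<exists>u\<in>Q. x u < 0"
      proof (rule ccontr)
        assume "\<not> ?thesis"
        then have "\<forall>u\<in>Q. x u \<ge> 0" by (auto simp: not_less)
        then have "x w = 0" using sum_nonneg_eq_0_iff[OF finQ, of x] sumQ[OF Q] w(1) by blast
        then show False using w(2) by simp
      qed
      ultimately show ?thesis unfolding d_def by (metis less_asym' less_irrefl)
    qed
    then show ?thesis by blast
  qed
qed

section \<open>Matchings and orientations of bounded in-degree\<close>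

text \<open>If a nonempty proper \<open>J\<close> is tight, \<open>J\<close> is matched within its
  neighbourhood \<open>U\<close>, and the rest still satisfies the condition outside
  \<open>U\<close>. Without tight sets every nonempty proper subset has a neighbour to spare, so any
  \<open>i\<close> may be matched to any \<open>x \<in> A i\<close>.\<close>

lemma hall:
  assumes "finite I" "\<And>i. i \<in> I \<Longrightarrow> finite (A i)"
    and "\<And>J. J \<subseteq> I \<Longrightarrow> card J \<le> card (\<Union>j\<in>J. A j)"
  shows "\<exists>f. inj_on f I \<and> (\<forall>i\<in>I. f i \<in> A i)"
  using assms
proof (induction "card I" arbitrary: I A rule: less_induct)
  case less
  note hall = less.prems(3)
  show ?case
  proof (cases "\<exists>J. J \<subset> I \<and> J \<noteq> {} \<and> card (\<Union>j\<in>J. A j) = card J")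
    case True
    then obtain J where J: "J \<subset> I" "J \<noteq> {}" "card (\<Union>j\<in>J. A j) = card J" by auto
    define U where "U = (\<Union>j\<in>J. A j)"
    have finJ: "finite J" using J(1) less.prems(1) by (auto intro: finite_subset)
    have finU: "finite U" using finJ J(1) less.prems(2) by (auto simp: U_def)
    have "card J < card I" using J less.prems(1) by (intro psubset_card_mono)
    then obtain f where f: "inj_on f J" "\<forall>j\<in>J. f j \<in> A j"
      using less.hyps[of J A] finJ J(1) less.prems by auto
    have "\<exists>g. inj_on g (I - J) \<and> (\<forall>i\<in>I - J. g i \<in> A i - U)"
    proof (rule less.hyps)
      show "card (I - J) < card I" using J less.prems(1) by (intro psubset_card_mono) auto
      fix K assume K: "K \<subseteq> I - J"
      have finK: "finite K" using K less.prems(1) finite_subset by blast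
      have "card K + card J = card (K \<union> J)" using K finK finJ by (subst card_Un_disjoint) auto
      also have "\<dots> \<le> card (\<Union>j\<in>K \<union> J. A j)" using K J(1) by (intro hall) auto
      also have "(\<Union>j\<in>K \<union> J. A j) = (\<Union>j\<in>K. A j - U) \<union> U" by (auto simp: U_def)
      also have "card \<dots> \<le> card (\<Union>j\<in>K. A j - U) + card U" by (rule card_Un_le)
      finally show "card K \<le> card (\<Union>j\<in>K. A j - U)" using J(3) by (simp add: U_def)
    qed (use less.prems in auto)
    then obtain g where g: "inj_on g (I - J)" "\<forall>i\<in>I - J. g i \<in> A i - U" by auto
    define h where "h i = (if i \<in> J then f i else g i)" for i
    have fU: "f i \<in> U" if "i \<in> J" for i using f(2) that by (auto simp: U_def)
    have "inj_on h I"
    proof (rule inj_onI)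
      fix i j assume ij: "i \<in> I" "j \<in> I" "h i = h j"
      then have "i \<in> J \<longleftrightarrow> j \<in> J" using fU g(2) unfolding h_def by (metis DiffD2 DiffI)
      then show "i = j"
        using ij f(1) g(1) unfolding h_def by (cases "i \<in> J") (auto dest: inj_onD)
    qed
    moreover have "\<forall>i\<in>I. h i \<in> A i" using f(2) g(2) by (auto simp: h_def)
    ultimately show ?thesis by blast
  next
    case False
    show ?thesis
    proof (cases "I = {}")
      case False
      then obtain i where i: "i \<in> I" by auto
      have "card {i} \<le> card (\<Union>j\<in>{i}. A j)" using i by (intro hall) auto
      then obtain x where x: "x \<in> A i" by fastforce
      have "\<exists>g. inj_on g (I - {i}) \<and> (\<forall>j\<in>I - {i}. g j \<in> A j - {x})"
      proof (rule less.hyps)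
        show "card (I - {i}) < card I" using i less.prems(1) by (intro psubset_card_mono) auto
        fix K assume K: "K \<subseteq> I - {i}"
        show "card K \<le> card (\<Union>j\<in>K. A j - {x})"
        proof (cases "K = {}")
          case False
          have "K \<subset> I" using K i by auto
          have finU: "finite (\<Union>j\<in>K. A j)" using K less.prems(1,2) finite_subset by blast
          have "card K < card (\<Union>j\<in>K. A j)"
            using \<open>\<not> (\<exists>J. J \<subset> I \<and> J \<noteq> {} \<and> card (\<Union>j\<in>J. A j) = card J)\<close> \<open>K \<subset> I\<close> False hall[of K]
            by (metis le_neq_implies_less psubset_imp_subset)
          moreover have "(\<Union>j\<in>K. A j - {x}) = (\<Union>j\<in>K. A j) - {x}" by auto
          moreover have "card (\<Union>j\<in>K. A j) - 1 \<le> card ((\<Union>j\<in>K. A j) - {x})"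
            using finU by (simp add: card_Diff_singleton_if)
          ultimately show ?thesis by simp
        qed simp
      qed (use less.prems in auto)
      then obtain g where g: "inj_on g (I - {i})" "\<forall>j\<in>I - {i}. g j \<in> A j - {x}" by auto
      have "inj_on (g(i := x)) (insert i (I - {i}))"
        using g by (subst inj_on_insert) (auto simp: inj_on_def)
      moreover have "insert i (I - {i}) = I" using i by auto
      ultimately have "inj_on (g(i := x)) I" by simp
      moreover have "\<forall>j\<in>I. (g(i := x)) j \<in> A j" using g(2) x by auto
      ultimately show ?thesis by blast
    qed simp
  qed
qed

text \<open>Hall's condition for matching each edge to one of \<open>T\<close> copies of one of its
  vertices is exactly the density hypothesis.\<close>

lemma bounded_orientation:
  fixes C :: "'v set set"
  assumes "finite C" "\<And>e. e \<in> C \<Longrightarrow> finite e"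
    and "\<And>S. S \<subseteq> C \<Longrightarrow> card S \<le> T * card (\<Union>S)"
  shows "\<exists>\<phi>. \<forall>e\<in>C. \<phi> e \<in> e \<and> card {e' \<in> C. \<phi> e' = \<phi> e} \<le> T"
proof -
  have "\<exists>f. inj_on f C \<and> (\<forall>e\<in>C. f e \<in> e \<times> {..<T})"
  proof (rule hall)
    fix J assume "J \<subseteq> C"
    moreover have "(\<Union>j\<in>J. j \<times> {..<T}) = \<Union>J \<times> {..<T}" by auto
    ultimately show "card J \<le> card (\<Union>j\<in>J. j \<times> {..<T})"
      using assms(3)[of J] by (simp add: card_cartesian_product mult.commute)
  qed (use assms in auto)
  then obtain f where f: "inj_on f C" "\<And>e. e \<in> C \<Longrightarrow> f e \<in> e \<times> {..<T}" by blast
  have "card {e' \<in> C. fst (f e') = v} \<le> T" for v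
  proof -
    have "inj_on (\<lambda>e. snd (f e)) {e' \<in> C. fst (f e') = v}"
      using f(1) by (auto simp: inj_on_def prod_eq_iff)
    moreover have "(\<lambda>e. snd (f e)) ` {e' \<in> C. fst (f e') = v} \<subseteq> {..<T}"
      using f(2) by (force simp: mem_Times_iff)
    ultimately have "card {e' \<in> C. fst (f e') = v} \<le> card {..<T}"
      by (rule card_inj_on_le) simp
    then show ?thesis by simp
  qed
  moreover have "fst (f e) \<in> e" if "e \<in> C" for e using f(2)[OF that] by (simp add: mem_Times_iff)
  ultimately show ?thesis by (intro exI[of _ "\<lambda>e. fst (f e)"]) blast
qed

lemma oriented_card_le:
  assumes "finite S" "\<And>e. e \<in> S \<Longrightarrow> finite e \<and> \<phi> e \<in> e \<and> card {e' \<in> S. \<phi> e' = \<phi> e} \<le> t"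
  shows "card S \<le> t * card (\<Union>S)"
proof -
  have "S = (\<Union>v\<in>\<phi> ` S. {e \<in> S. \<phi> e = v})" by auto
  then have "card S \<le> (\<Sum>v\<in>\<phi> ` S. card {e \<in> S. \<phi> e = v})"
    using card_UN_le[of "\<phi> ` S" "\<lambda>v. {e \<in> S. \<phi> e = v}"] assms(1) by simp
  also have "\<dots> \<le> card (\<phi> ` S) * t"
    using sum_bounded_above[of "\<phi> ` S" "\<lambda>v. card {e \<in> S. \<phi> e = v}" t] assms(2) by fastforce
  also have "\<dots> \<le> card (\<Union>S) * t"
    using assms by (intro mult_le_mono1 card_mono) auto
  finally show ?thesis by (simp add: mult.commute)
qed

text \<open>At every vertex, up to \<open>t\<close> of the at most \<open>T\<close> edges oriented
  towards it go into \<open>X\<close>. Both parts inherit an orientation, with in-degrees at most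
  \<open>t\<close> and \<open>T - t\<close>, and counting by heads gives back the density bounds.
  The subtraction truncates: for \<open>t \<ge> T\<close> nothing remains outside
  \<open>X\<close>.\<close>

lemma sparse_split:
  fixes C :: "'v set set"
  assumes "finite C" "\<And>e. e \<in> C \<Longrightarrow> finite e"
    and "\<And>S. S \<subseteq> C \<Longrightarrow> card S \<le> T * card (\<Union>S)"
  obtains X where "X \<subseteq> C" "\<And>S. S \<subseteq> X \<Longrightarrow> card S \<le> t * card (\<Union>S)"
    "\<And>S. S \<subseteq> C - X \<Longrightarrow> card S \<le> (T - t) * card (\<Union>S)"
proof -
  obtain \<phi> where "\<forall>e\<in>C. \<phi> e \<in> e \<and> card {e' \<in> C. \<phi> e' = \<phi> e} \<le> T"
    using bounded_orientation[OF assms] by (rule exE)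
  then have \<phi>: "\<phi> e \<in> e" "card {e' \<in> C. \<phi> e' = \<phi> e} \<le> T" if "e \<in> C" for e
    using that by simp_all
  have "\<exists>Z. Z \<subseteq> {e \<in> C. \<phi> e = v} \<and> card Z = min t (card {e \<in> C. \<phi> e = v})" for v
    by (rule obtain_subset_with_card_n[of "min t (card {e \<in> C. \<phi> e = v})" "{e \<in> C. \<phi> e = v}"]) auto
  then have "\<exists>Z. \<forall>v. Z v \<subseteq> {e \<in> C. \<phi> e = v} \<and> card (Z v) = min t (card {e \<in> C. \<phi> e = v})"
    by (intro choice allI)
  then obtain Z where "\<forall>v. Z v \<subseteq> {e \<in> C. \<phi> e = v} \<and> card (Z v) = min t (card {e \<in> C. \<phi> e = v})"
    by (rule exE)
  then have Z: "Z v \<subseteq> {e \<in> C. \<phi> e = v}" "card (Z v) = min t (card {e \<in> C. \<phi> e = v})" for v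
    by simp_all
  define X where "X = {e \<in> C. e \<in> Z (\<phi> e)}"
  have finZ: "finite (Z v)" for v using finite_subset[OF Z(1)] assms(1) by simp
  show thesis
  proof (rule that[of X])
    fix S assume S: "S \<subseteq> X"
    show "card S \<le> t * card (\<Union>S)"
    proof (rule oriented_card_le[where \<phi> = \<phi>])
      fix e assume "e \<in> S"
      then have "e \<in> C" using S by (auto simp: X_def)
      moreover have "card {e' \<in> S. \<phi> e' = \<phi> e} \<le> card (Z (\<phi> e))"
        using S finZ by (intro card_mono) (auto simp: X_def)
      ultimately show "finite e \<and> \<phi> e \<in> e \<and> card {e' \<in> S. \<phi> e' = \<phi> e} \<le> t"
        using Z(2)[of "\<phi> e"] assms(2) \<phi>(1) by simp
    qed (use S assms(1) in \<open>auto simp: X_def intro: finite_subset\<close>)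
  next
    fix S assume S: "S \<subseteq> C - X"
    show "card S \<le> (T - t) * card (\<Union>S)"
    proof (rule oriented_card_le[where \<phi> = \<phi>])
      fix e assume "e \<in> S"
      then have e: "e \<in> C" using S by auto
      have "card {e' \<in> S. \<phi> e' = \<phi> e} \<le> card ({e' \<in> C. \<phi> e' = \<phi> e} - Z (\<phi> e))"
        using S assms(1) by (intro card_mono) (auto simp: X_def)
      also have "\<dots> = card {e' \<in> C. \<phi> e' = \<phi> e} - card (Z (\<phi> e))"
        by (rule card_Diff_subset[OF finZ Z(1)])
      also have "\<dots> \<le> T - t" using Z(2)[of "\<phi> e"] \<phi>(2)[OF e] by linarith
      finally show "finite e \<and> \<phi> e \<in> e \<and> card {e' \<in> S. \<phi> e' = \<phi> e} \<le> T - t"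
        using assms(2) \<phi>(1) e by simp
    qed (use S assms(1) in \<open>auto intro: finite_subset\<close>)
  qed (auto simp: X_def)
qed

section \<open>Vertex partitions without monochromatic copies\<close>

definition mono_edge :: "('v \<Rightarrow> nat) \<Rightarrow> 'v set \<Rightarrow> bool" where
  "mono_edge \<psi> e \<longleftrightarrow> (\<exists>s. \<forall>v\<in>e. \<psi> v = s)"

definition vdegree :: "'v set set \<Rightarrow> 'v \<Rightarrow> nat" where
  "vdegree S v = card {e \<in> S. v \<in> e}"

lemma sum_vdegree:
  assumes "finite S" "finite V" "\<And>e. e \<in> S \<Longrightarrow> e \<subseteq> V \<and> card e = k"
  shows "(\<Sum>v\<in>V. vdegree S v) = k * card S"
proof -
  have "(\<Sum>v\<in>V. vdegree S v) = (\<Sum>v\<in>V. \<Sum>e\<in>S. if v \<in> e then 1 else 0)"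
    unfolding vdegree_def using assms(1) by (intro sum.cong refl) (simp add: sum.If_cases Int_def)
  also have "\<dots> = (\<Sum>e\<in>S. \<Sum>v\<in>V. if v \<in> e then 1 else 0)" by (rule sum.swap)
  also have "\<dots> = (\<Sum>e\<in>S. k)"
  proof (rule sum.cong[OF refl])
    fix e assume "e \<in> S"
    then have "V \<inter> e = e" "card e = k" using assms(3) by auto
    then show "(\<Sum>v\<in>V. if v \<in> e then 1 else 0) = k"
      using assms(2) by (simp add: sum.If_cases)
  qed
  finally show ?thesis by (simp add: mult.commute)
qed

text \<open>The equality case of this degree bound is what makes cliques on \<open>k + 1\<close> vertices special.\<close>

lemma balanced_vdegree:
  assumes A: "balanced k \<alpha> \<kappa> s A" and "\<alpha> > 0" "\<kappa> < real k" "real k - 1 < \<kappa>" and c: "card A \<ge> 2" and v: "v \<in> \<Union>A"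
  shows "1 \<le> \<alpha> * real (vdegree A v)" "\<alpha> * real (vdegree A v) = 1 \<Longrightarrow> card (\<Union>A) = k + 1"
proof -
  have fin: "finite A" "\<And>e. e \<in> A \<Longrightarrow> finite e \<and> card e = k" and lamA: "excess \<alpha> A = \<kappa>"
    using A by (auto simp: balanced_def)
  have finU: "finite (\<Union>A)" using fin by auto
  define J where "J = {e \<in> A. v \<notin> e}"
  have "J \<subset> A" using v by (auto simp: J_def)
  have "A = J \<union> {e \<in> A. v \<in> e}" by (auto simp: J_def)
  then have "card A = card (J \<union> {e \<in> A. v \<in> e})" by simp
  also have "\<dots> = card J + vdegree A v" unfolding vdegree_def
    using fin by (intro card_Un_disjoint) (auto simp: J_def)
  finally have cA: "real (vdegree A v) = real (card A) - real (card J)" by simp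
  have UJ: "\<Union>J \<subset> \<Union>A" using v by (auto simp: J_def)
  then have ltU: "card (\<Union>J) < card (\<Union>A)" using finU by (intro psubset_card_mono)
  \<comment> \<open>If some edge avoids \<open>v\<close>, at least one vertex is lost and
    \<open>excess \<alpha> J \<ge> \<kappa>\<close>; equality then forces \<open>J\<close> to be one
    edge and \<open>v\<close> the only further vertex. If none does, the right side is
    \<open>card (\<Union>A) - \<kappa>\<close>, which exceeds 1.\<close>
  have deg: "\<alpha> * real (vdegree A v) = real (card (\<Union>A)) - real (card (\<Union>J)) + (excess \<alpha> J - \<kappa>)"
    using lamA unfolding excess_def cA by (simp add: algebra_simps)
  have "1 \<le> \<alpha> * real (vdegree A v) \<and> (\<alpha> * real (vdegree A v) = 1 \<longrightarrow> card (\<Union>A) = k + 1)"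
  proof (cases "J = {}")
    case True
    obtain e e' where e: "e \<in> A" "e' \<in> A" "e \<noteq> e'"
      using card_le_Suc0_iff_eq[OF fin(1)] c by fastforce
    have "k < card (\<Union>A)"
    proof (rule ccontr)
      assume "\<not> k < card (\<Union>A)"
      have "f = \<Union>A" if "f \<in> A" for f
      proof (rule card_subset_eq[OF finU])
        show "f \<subseteq> \<Union>A" using that by auto
        then have "card f \<le> card (\<Union>A)" by (rule card_mono[OF finU])
        then show "card f = card (\<Union>A)" using \<open>\<not> k < card (\<Union>A)\<close> fin(2)[OF that] by simp
      qed
      then show False using e by metis
    qed
    then have "real k + 1 \<le> real (card (\<Union>A))" by linarith
    then show ?thesis using deg True assms(3) by (simp add: excess_def)
  next
    case False
    have "\<kappa> \<le> excess \<alpha> J" using balanced_excess_ge[OF A _ False] \<open>J \<subset> A\<close> by simp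
    then have 1: "1 \<le> \<alpha> * real (vdegree A v)" using deg ltU by linarith
    moreover have "card (\<Union>A) = k + 1" if eq: "\<alpha> * real (vdegree A v) = 1"
    proof -
      have lamJ: "excess \<alpha> J = \<kappa>" "card (\<Union>A) = card (\<Union>J) + 1"
        using deg eq ltU \<open>\<kappa> \<le> excess \<alpha> J\<close> by linarith+
      have "\<not> s \<le> card J" using A \<open>J \<subset> A\<close> lamJ by (auto simp: balanced_def)
      moreover have "card J \<noteq> 0" using False fin \<open>J \<subset> A\<close> by (auto dest: finite_subset)
      ultimately have "card J = 1" using A by (auto simp: balanced_def)
      then obtain e where "J = {e}" by (auto simp: card_1_singleton_iff)
      then have "card (\<Union>J) = k" using fin \<open>J \<subset> A\<close> by auto
      then show ?thesis using lamJ by simp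
    qed
    ultimately show ?thesis by blast
  qed
  then show "1 \<le> \<alpha> * real (vdegree A v)" "\<alpha> * real (vdegree A v) = 1 \<Longrightarrow> card (\<Union>A) = k + 1" by blast+
qed

lemma two_large_subsets:
  assumes "finite Q" "card Q = k + 1" "e \<subseteq> Q" "e' \<subseteq> Q" "card e = k" "card e' = k" "e \<noteq> e'"
  shows "e \<union> e' = Q" "card (e \<inter> e') = k - 1"
proof -
  have fin: "finite e" "finite e'" using assms finite_subset by auto
  have "e \<noteq> e \<union> e'"
  proof
    assume "e = e \<union> e'"
    then have "e' \<subseteq> e" by auto
    then show False using card_subset_eq[OF fin(1)] assms by auto
  qed
  then have "card e < card (e \<union> e')" using fin by (intro psubset_card_mono) auto
  then have c: "card (e \<union> e') = k + 1"
    using card_mono[of Q "e \<union> e'"] assms by auto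
  then show "e \<union> e' = Q" using assms by (intro card_subset_eq) auto
  show "card (e \<inter> e') = k - 1" using card_Un_Int[OF fin] c assms by simp
qed

text \<open>
  A vertex \<open>v\<close> of degree at most \<open>k/\<alpha>\<close> that can be put into none of the \<open>k\<close> classes spends its whole
  degree on \<open>k\<close> edge-disjoint stars of size \<open>1/\<alpha>\<close>, one in each class. Two edges at \<open>v\<close> inside a
  common \<open>(k + 1)\<close>-set share a further vertex, hence lie in the same star.
\<close>

lemma stuck_vertex:
  fixes \<A> :: "'v set set set"
  assumes k: "k \<ge> 3" and \<alpha>: "0 < \<alpha>" "\<alpha> < 1" and \<kappa>: "\<kappa> < real k" "real k - 1 < \<kappa>"
    and A: "\<And>A. A \<in> \<A> \<Longrightarrow> balanced k \<alpha> \<kappa> s A \<and> A \<subseteq> C \<and> card A \<ge> 2 \<and> card (\<Union>A) = w"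
    and C: "finite C" and v: "v \<in> V"
    and deg: "\<alpha> * real (vdegree {e \<in> C. e \<subseteq> V} v) \<le> real k"
    and good: "\<And>A. A \<in> \<A> \<Longrightarrow> \<Union>A \<subseteq> V - {v} \<Longrightarrow> \<exists>e\<in>A. \<not> mono_edge \<psi> e"
    and stuck: "\<And>j. j < k \<Longrightarrow> \<exists>A\<in>\<A>. \<Union>A \<subseteq> V \<and> (\<forall>e\<in>A. mono_edge (\<psi>(v := j)) e)"
  shows "\<alpha> * real (vdegree {e \<in> C. e \<subseteq> V} v) = real k" "w = k + 1"
    "card {Q \<in> Union ` \<A>. Q \<subseteq> V \<and> v \<in> Q} \<le> k"
proof -
  obtain a where a: "\<And>j. j < k \<Longrightarrow> a j \<in> \<A> \<and> \<Union>(a j) \<subseteq> V \<and> (\<forall>e\<in>a j. mono_edge (\<psi>(v := j)) e)"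
    using stuck by metis
  define D where "D = {e \<in> C. e \<subseteq> V \<and> v \<in> e}"
  define E where "E j = {e \<in> a j. v \<in> e}" for j
  have cardE: "card (E j) = vdegree (a j) v" for j by (simp add: E_def vdegree_def)
  have fD: "finite D" using C by (simp add: D_def)
  have dD: "vdegree {e \<in> C. e \<subseteq> V} v = card D" unfolding vdegree_def D_def by (rule arg_cong[of _ _ card]) auto
  have va: "v \<in> \<Union>(a j)" if "j < k" for j
  proof (rule ccontr)
    assume nv: "v \<notin> \<Union>(a j)"
    then have "\<exists>e\<in>a j. \<not> mono_edge \<psi> e" using good[of "a j"] a[OF that] by blast
    then obtain e where "e \<in> a j" "\<not> mono_edge \<psi> e" by blast
    moreover from this nv have "mono_edge (\<psi>(v := j)) e = mono_edge \<psi> e"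
      unfolding mono_edge_def by (metis UnionI fun_upd_apply)
    ultimately show False using a[OF that] by blast
  qed
  have ED: "E j \<subseteq> D" if "j < k" for j using a[OF that] A unfolding E_def D_def by blast
  have finE: "finite (E j)" if "j < k" for j using ED[OF that] fD by (rule finite_subset)
  have col: "\<psi> x = j" if "j < k" "e \<in> E j" "x \<in> e" "x \<noteq> v" for j e x
  proof -
    have "mono_edge (\<psi>(v := j)) e" "v \<in> e" using a[OF that(1)] that(2) by (auto simp: E_def)
    then show ?thesis using that(3,4) unfolding mono_edge_def by (metis fun_upd_apply)
  qed
  have other: "\<exists>x\<in>e. x \<noteq> v" if "j < k" "e \<in> E j" for j e
  proof (rule ccontr)
    assume "\<not> ?thesis"
    then have "card e \<le> card {v}" by (intro card_mono) auto
    moreover have "card e = k" using a[OF that(1)] that(2) A[of "a j"] by (auto simp: E_def balanced_def)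
    ultimately show False using k by simp
  qed
  have disj: "E i \<inter> E j = {}" if "i < k" "j < k" "i \<noteq> j" for i j
    using col other that by blast
  have deg_ge: "1 \<le> \<alpha> * real (card (E j))" if "j < k" for j
    unfolding cardE using balanced_vdegree(1)[OF _ \<alpha>(1) \<kappa> _ va[OF that]] A[of "a j"] a[OF that] by blast
  have cU: "card (\<Union>j<k. E j) = (\<Sum>j<k. card (E j))"
    using finE disj by (intro card_UN_disjoint) auto
  have UD: "(\<Union>j<k. E j) \<subseteq> D" using ED by blast
  have "real k = (\<Sum>j<k. 1)" by simp
  also have "\<dots> \<le> (\<Sum>j<k. \<alpha> * real (card (E j)))" using deg_ge by (intro sum_mono) auto
  also have "\<dots> = \<alpha> * real (card (\<Union>j<k. E j))" by (simp add: cU sum_distrib_left)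
  finally have le1: "real k \<le> \<alpha> * real (card (\<Union>j<k. E j))" .
  have le2: "\<alpha> * real (card (\<Union>j<k. E j)) \<le> \<alpha> * real (card D)"
    using \<alpha>(1) card_mono[OF fD UD] by simp
  show eq: "\<alpha> * real (vdegree {e \<in> C. e \<subseteq> V} v) = real k" using le1 le2 deg dD by simp
  then have "\<alpha> * real (card (\<Union>j<k. E j)) = \<alpha> * real (card D)" using le1 le2 dD by simp
  then have "card (\<Union>j<k. E j) = card D" using \<alpha>(1) by simp
  then have UDeq: "(\<Union>j<k. E j) = D" using card_subset_eq[OF fD UD] by simp
  have each: "\<alpha> * real (card (E j)) = 1" if "j < k" for j
  proof (rule ccontr)
    assume "\<alpha> * real (card (E j)) \<noteq> 1"
    then have "1 < \<alpha> * real (card (E j))" using deg_ge[OF that] by simp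
    then have "(\<Sum>j<k. 1) < (\<Sum>j<k. \<alpha> * real (card (E j)))"
      using deg_ge that by (intro sum_strict_mono_ex1) auto
    also have "\<dots> = \<alpha> * real (card (\<Union>j<k. E j))" by (simp add: cU sum_distrib_left)
    finally show False using eq le2 dD by simp
  qed
  show w: "w = k + 1"
    using balanced_vdegree(2)[OF _ \<alpha>(1) \<kappa> _ va[of 0], of s] A[of "a 0"] a[of 0] each[of 0] k by (simp add: cardE)
  \<comment> \<open>Since \<open>\<alpha> < 1\<close>, a copy with vertex set \<open>Q\<close> has
    two edges at \<open>v\<close>. They lie in the star of one \<open>a j\<close>, and their union
    is already all of \<open>Q\<close>; equal sizes then give
    \<open>Q = \<Union>(a j)\<close>.\<close>
  have "{Q \<in> Union ` \<A>. Q \<subseteq> V \<and> v \<in> Q} \<subseteq> (\<lambda>j. \<Union>(a j)) ` {..<k}"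
  proof
    fix Q assume "Q \<in> {Q \<in> Union ` \<A>. Q \<subseteq> V \<and> v \<in> Q}"
    then obtain A' where A': "A' \<in> \<A>" "Q = \<Union>A'" "Q \<subseteq> V" "v \<in> Q" by blast
    note bA = A[OF A'(1)]
    have finA: "finite A'" and eA: "\<And>e. e \<in> A' \<Longrightarrow> finite e \<and> card e = k" using bA by (auto simp: balanced_def)
    have finQ: "finite Q" using finA eA A'(2) by auto
    have cQ: "card Q = k + 1" using bA A'(2) w by simp
    have "1 \<le> \<alpha> * real (vdegree A' v)" using balanced_vdegree(1)[OF _ \<alpha>(1) \<kappa>, of s A' v] bA A' by simp
    then have "vdegree A' v \<noteq> 0" "vdegree A' v \<noteq> 1" using \<alpha>(2) by (metis mult_zero_right not_one_le_zero of_nat_0, auto)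
    then have "2 \<le> card {e \<in> A'. v \<in> e}" unfolding vdegree_def by linarith
    then have "\<not> card {e \<in> A'. v \<in> e} \<le> Suc 0" by simp
    moreover have "finite {e \<in> A'. v \<in> e}" using finA by simp
    ultimately obtain e e' where e: "e \<in> A'" "e' \<in> A'" "v \<in> e" "v \<in> e'" "e \<noteq> e'"
      using card_le_Suc0_iff_eq[of "{e \<in> A'. v \<in> e}"] by blast
    have sub: "e \<subseteq> Q" "e' \<subseteq> Q" using e A'(2) by auto
    note large = two_large_subsets[OF finQ cQ sub _ _ e(5)]
    have "card (e \<inter> e') = k - 1" "e \<union> e' = Q" using large eA e by auto
    have "\<exists>x\<in>e \<inter> e'. x \<noteq> v"
    proof (rule ccontr)
      assume "\<not> ?thesis"
      then have "card (e \<inter> e') \<le> card {v}" by (intro card_mono) auto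
      then show False using \<open>card (e \<inter> e') = k - 1\<close> k by simp
    qed
    then obtain x where x: "x \<in> e" "x \<in> e'" "x \<noteq> v" by blast
    have "e \<in> D" "e' \<in> D" using e sub A'(3) bA by (auto simp: D_def)
    then obtain i j where ij: "i < k" "e \<in> E i" "j < k" "e' \<in> E j" using UDeq by blast
    then have "i = j" using col[of i e x] col[of j e' x] x by simp
    then have "Q \<subseteq> \<Union>(a j)" using ij \<open>e \<union> e' = Q\<close> by (auto simp: E_def)
    moreover have "card (\<Union>(a j)) = k + 1" "finite (\<Union>(a j))"
      using a[OF ij(3)] A[of "a j"] w by (auto simp: balanced_def)
    ultimately have "Q = \<Union>(a j)" using cQ by (intro card_subset_eq) auto
    then show "Q \<in> (\<lambda>j. \<Union>(a j)) ` {..<k}" using ij(3) by blast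
  qed
  then have "card {Q \<in> Union ` \<A>. Q \<subseteq> V \<and> v \<in> Q} \<le> card ((\<lambda>j. \<Union>(a j)) ` {..<k})"
    by (rule card_mono[rotated]) simp
  also have "\<dots> \<le> k" using card_image_le[of "{..<k}" "\<lambda>j. \<Union>(a j)"] by simp
  finally show "card {Q \<in> Union ` \<A>. Q \<subseteq> V \<and> v \<in> Q} \<le> k" .
qed

text \<open>Double counting incidences of blocks of size \<open>k + 1\<close> with vertices in at
  most \<open>k\<close> of them leaves fewer blocks than vertices in every \<open>W\<close>, so two
  colours suffice to make no block monochromatic. Any two edges in a block intersect; if all edges
  of a copy were monochromatic, so would be its block.\<close>

lemma block_colouring:
  fixes \<A> :: "'v set set set"
  assumes k: "k \<ge> 3" and V: "finite V"
    and A: "\<And>A. A \<in> \<A> \<Longrightarrow> A \<noteq> {} \<and> (\<forall>e\<in>A. card e = k) \<and> card (\<Union>A) = k + 1"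
    and blocks: "\<And>v. v \<in> V \<Longrightarrow> card {Q \<in> Union ` \<A>. Q \<subseteq> V \<and> v \<in> Q} \<le> k"
  shows "\<exists>\<psi> :: 'v \<Rightarrow> nat. range \<psi> \<subseteq> {..<k} \<and> (\<forall>A\<in>\<A>. \<Union>A \<subseteq> V \<longrightarrow> (\<exists>e\<in>A. \<not> mono_edge \<psi> e))"
proof -
  have "\<exists>c :: 'v \<Rightarrow> bool. \<forall>Q\<in>Union ` \<A>. Q \<subseteq> V \<longrightarrow> (\<exists>u\<in>Q. c u) \<and> (\<exists>u\<in>Q. \<not> c u)"
  proof (rule sparse_family_two_colourable[OF V])
    fix W assume W: "W \<subseteq> V" "W \<noteq> {}"
    let ?B = "{Q \<in> Union ` \<A>. Q \<subseteq> W}"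
    have finW: "finite W" using W V finite_subset by auto
    have finB: "finite ?B" by (rule finite_subset[of _ "Pow W"]) (use finW in auto)
    have "(k + 1) * card ?B = (\<Sum>v\<in>W. vdegree ?B v)"
      by (rule sum_vdegree[OF finB finW, symmetric]) (use A in auto)
    also have "\<dots> \<le> (\<Sum>v\<in>W. k)"
    proof (rule sum_mono)
      fix v assume v: "v \<in> W"
      have "finite {Q \<in> Union ` \<A>. Q \<subseteq> V \<and> v \<in> Q}"
        by (rule finite_subset[of _ "Pow V"]) (use V in auto)
      then have "vdegree ?B v \<le> card {Q \<in> Union ` \<A>. Q \<subseteq> V \<and> v \<in> Q}"
        unfolding vdegree_def using W by (intro card_mono) auto
      then show "vdegree ?B v \<le> k" using blocks[of v] v W by auto
    qed
    finally have le: "(k + 1) * card ?B \<le> k * card W" by (simp add: mult.commute)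
    have "card W > 0" using W finW by (simp add: card_gt_0_iff)
    show "card ?B < card W"
    proof (rule ccontr)
      assume "\<not> card ?B < card W"
      then have "(k + 1) * card W \<le> (k + 1) * card ?B" by (intro mult_le_mono2) simp
      then show False using le \<open>card W > 0\<close> by simp
    qed
  next
    show "{} \<notin> Union ` \<A>"
    proof
      assume "{} \<in> Union ` \<A>"
      then obtain A' where A': "A' \<in> \<A>" "\<Union>A' = {}" by (metis imageE)
      then have "card (\<Union>A') = 0" by (simp only: card.empty)
      then show False using A[OF A'(1)] by linarith
    qed
  qed
  then obtain c :: "'v \<Rightarrow> bool" where c: "\<forall>Q\<in>Union ` \<A>. Q \<subseteq> V \<longrightarrow> (\<exists>u\<in>Q. c u) \<and> (\<exists>u\<in>Q. \<not> c u)" ..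
  define \<psi> :: "'v \<Rightarrow> nat" where "\<psi> v = (if c v then 1 else 0)" for v
  have "\<exists>e\<in>A'. \<not> mono_edge \<psi> e" if A': "A' \<in> \<A>" "\<Union>A' \<subseteq> V" for A'
  proof (rule ccontr)
    assume "\<not> ?thesis"
    then have mono: "\<And>e. e \<in> A' \<Longrightarrow> mono_edge \<psi> e" by blast
    obtain u w where u: "u \<in> \<Union>A'" "c u" and w: "w \<in> \<Union>A'" "\<not> c w" using c A' by blast
    then obtain e e' where e: "e \<in> A'" "u \<in> e" and e': "e' \<in> A'" "w \<in> e'" by blast
    have "finite (\<Union>A')" using A'(2) V by (rule finite_subset)
    have "e \<inter> e' \<noteq> {}"
    proof (cases "e = e'")
      case True
      then show ?thesis using e by auto
    next
      case False
      have "card (e \<inter> e') = k - 1"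
        using two_large_subsets(2)[OF \<open>finite (\<Union>A')\<close> _ _ _ _ _ False] A[OF A'(1)] e e' by auto
      then show ?thesis using k by auto
    qed
    then obtain x where "x \<in> e" "x \<in> e'" by blast
    then have "\<psi> u = \<psi> x" "\<psi> w = \<psi> x" using mono[OF e(1)] mono[OF e'(1)] e(2) e'(2)
      unfolding mono_edge_def by metis+
    then show False using u(2) w(2) by (simp add: \<psi>_def)
  qed
  moreover have "range \<psi> \<subseteq> {..<k}" using k by (auto simp: \<psi>_def)
  ultimately show ?thesis by blast
qed

text \<open>Sparseness bounds the average of \<open>\<alpha>\<close> times the degree by
  \<open>k\<close>. A vertex that respects this bound and violates some conclusion of
  \<open>stuck_vertex\<close> can be removed and put back after colouring the rest. If there is no
  such vertex, all degrees equal \<open>k / \<alpha>\<close>, the copies live on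
  \<open>k + 1\<close> vertices, every vertex lies in at most \<open>k\<close> blocks, and
  \<open>block_colouring\<close> applies.\<close>

lemma vertex_partition:
  fixes \<A> :: "'v set set set"
  assumes k: "k \<ge> 3" and \<alpha>: "0 < \<alpha>" "\<alpha> < 1" and \<kappa>: "\<kappa> < real k" "real k - 1 < \<kappa>"
    and A: "\<And>A. A \<in> \<A> \<Longrightarrow> balanced k \<alpha> \<kappa> s A \<and> A \<subseteq> C \<and> card A \<ge> 2 \<and> card (\<Union>A) = w"
    and C: "finite C" "\<And>e. e \<in> C \<Longrightarrow> finite e \<and> card e = k"
    and sparse: "\<And>S. S \<subseteq> C \<Longrightarrow> \<alpha> * real (card S) \<le> real (card (\<Union>S))"
    and "finite V"
  shows "\<exists>\<psi> :: 'v \<Rightarrow> nat. range \<psi> \<subseteq> {..<k} \<and> (\<forall>A\<in>\<A>. \<Union>A \<subseteq> V \<longrightarrow> (\<exists>e\<in>A. \<not> mono_edge \<psi> e))"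
  using \<open>finite V\<close>
proof (induction "card V" arbitrary: V rule: less_induct)
  case less
  let ?C = "{e \<in> C. e \<subseteq> V}"
  let ?goal = "\<lambda>V \<psi>. range \<psi> \<subseteq> {..<k} \<and> (\<forall>A\<in>\<A>. \<Union>A \<subseteq> V \<longrightarrow> (\<exists>e\<in>A. \<not> mono_edge \<psi> e))"
  have finC: "finite ?C" using C by simp
  have peel: "\<exists>\<psi>. ?goal V \<psi>"
    if v: "v \<in> V" and deg: "\<alpha> * real (vdegree ?C v) \<le> real k"
      and nst: "\<alpha> * real (vdegree ?C v) < real k \<or> w \<noteq> k + 1 \<or>
        k < card {Q \<in> Union ` \<A>. Q \<subseteq> V \<and> v \<in> Q}" for v
  proof -
    have "card (V - {v}) < card V" using v less.prems by (intro psubset_card_mono) auto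
    then have "\<exists>\<psi>. ?goal (V - {v}) \<psi>" by (rule less.hyps) (use less.prems in simp)
    then obtain \<psi> where "?goal (V - {v}) \<psi>" by (rule exE)
    then have \<psi>: "range \<psi> \<subseteq> {..<k}"
      "\<And>A. A \<in> \<A> \<Longrightarrow> \<Union>A \<subseteq> V - {v} \<Longrightarrow> \<exists>e\<in>A. \<not> mono_edge \<psi> e" by simp_all
    have "\<exists>j<k. \<forall>A\<in>\<A>. \<Union>A \<subseteq> V \<longrightarrow> (\<exists>e\<in>A. \<not> mono_edge (\<psi>(v := j)) e)"
    proof (rule ccontr)
      assume neg: "\<not> ?thesis"
      have stuck: "\<exists>A\<in>\<A>. \<Union>A \<subseteq> V \<and> (\<forall>e\<in>A. mono_edge (\<psi>(v := j)) e)" if "j < k" for j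
        using neg that by simp
      note st = stuck_vertex[OF k \<alpha> \<kappa> A C(1) v deg \<psi>(2) stuck]
      show False using st nst by linarith
    qed
    then obtain j where j: "j < k" "\<forall>A\<in>\<A>. \<Union>A \<subseteq> V \<longrightarrow> (\<exists>e\<in>A. \<not> mono_edge (\<psi>(v := j)) e)" by blast
    have "range (\<psi>(v := j)) \<subseteq> {..<k}" using \<psi>(1) j(1) by auto
    then show ?thesis using j(2) by blast
  qed
  have "real (k * card ?C) = real (\<Sum>v\<in>V. vdegree ?C v)"
    using sum_vdegree[OF finC less.prems, of k] C(2) by simp
  then have sumdeg: "(\<Sum>v\<in>V. \<alpha> * real (vdegree ?C v)) = real k * (\<alpha> * real (card ?C))"
    by (simp add: sum_distrib_left[symmetric])
  also have "\<dots> \<le> real k * real (card V)"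
  proof (rule mult_left_mono)
    have "card (\<Union>?C) \<le> card V" using less.prems by (intro card_mono) auto
    moreover have "\<alpha> * real (card ?C) \<le> real (card (\<Union>?C))" by (rule sparse) auto
    ultimately show "\<alpha> * real (card ?C) \<le> real (card V)" by linarith
  qed simp
  also have "\<dots> = (\<Sum>v\<in>V. real k)" by simp
  finally have sumle: "(\<Sum>v\<in>V. \<alpha> * real (vdegree ?C v)) \<le> (\<Sum>v\<in>V. real k)" .
  show ?case
  proof (cases "\<exists>v\<in>V. \<alpha> * real (vdegree ?C v) < real k")
    case True
    then obtain v where "v \<in> V" "\<alpha> * real (vdegree ?C v) < real k" by (rule bexE)
    then show ?thesis using peel[of v] by simp
  next
    case False
    then have ge: "\<And>v. v \<in> V \<Longrightarrow> real k \<le> \<alpha> * real (vdegree ?C v)" by force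
    have eq: "\<alpha> * real (vdegree ?C v) = real k" if "v \<in> V" for v
    proof (rule ccontr)
      assume "\<alpha> * real (vdegree ?C v) \<noteq> real k"
      then have "real k < \<alpha> * real (vdegree ?C v)" using ge[OF that] by simp
      then have "(\<Sum>v\<in>V. real k) < (\<Sum>v\<in>V. \<alpha> * real (vdegree ?C v))"
        using ge that less.prems by (intro sum_strict_mono_ex1) auto
      then show False using sumle by simp
    qed
    show ?thesis
    proof (cases "\<exists>v\<in>V. w \<noteq> k + 1 \<or> k < card {Q \<in> Union ` \<A>. Q \<subseteq> V \<and> v \<in> Q}")
      case True
      then obtain v where "v \<in> V" "w \<noteq> k + 1 \<or> k < card {Q \<in> Union ` \<A>. Q \<subseteq> V \<and> v \<in> Q}"
        by (rule bexE)
      then show ?thesis using peel[of v] eq[of v] by simp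
    next
      case False
      show ?thesis
      proof (cases "V = {}")
        case True
        have "\<not> \<Union>A' \<subseteq> V" if "A' \<in> \<A>" for A'
        proof
          assume "\<Union>A' \<subseteq> V"
          then have "A' \<subseteq> {{}}" using True by auto
          then have "card A' \<le> card {{} :: 'v set}" by (rule card_mono[rotated]) simp
          then show False using A[OF that] by simp
        qed
        then show ?thesis using k by (intro exI[of _ "\<lambda>_. 0"]) auto
      next
        case V: False
        have "w = k + 1" using False V by auto
        show ?thesis
        proof (rule block_colouring[OF k less.prems])
          fix A' assume "A' \<in> \<A>"
          then show "A' \<noteq> {} \<and> (\<forall>e\<in>A'. card e = k) \<and> card (\<Union>A') = k + 1"
            using A[of A'] \<open>w = k + 1\<close> by (auto simp: balanced_def)
        next
          fix v assume "v \<in> V"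
          then show "card {Q \<in> Union ` \<A>. Q \<subseteq> V \<and> v \<in> Q} \<le> k" using False by auto
        qed
      qed
    qed
  qed
qed

section \<open>Hearts\<close>

text \<open>Copies are mere edge sets; isolated vertices, which \<open>excess\<close> does not see,
  are dropped.\<close>

definition is_copy :: "'a set set \<Rightarrow> 'v set set \<Rightarrow> bool" where
  "is_copy F D \<longleftrightarrow> (\<exists>f. inj_on f (\<Union>F) \<and> D = (\<lambda>e. f ` e) ` F)"

lemma card_image_edges:
  assumes "inj_on f (\<Union>F)" "J \<subseteq> F"
  shows "card ((\<lambda>e. f ` e) ` J) = card J" "card (\<Union>((\<lambda>e. f ` e) ` J)) = card (\<Union>J)"
proof -
  have inj: "inj_on f (\<Union>J)" using assms by (meson Union_mono inj_on_subset)
  then show "card ((\<lambda>e. f ` e) ` J) = card J" by (intro card_image inj_on_image)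
  have "\<Union>((\<lambda>e. f ` e) ` J) = f ` \<Union>J" by auto
  then show "card (\<Union>((\<lambda>e. f ` e) ` J)) = card (\<Union>J)" using inj by (simp add: card_image)
qed

lemma balanced_copy:
  assumes F: "balanced k \<alpha> \<kappa> s F" and D: "is_copy F D"
  shows "balanced k \<alpha> \<kappa> s D" "card D = card F" "card (\<Union>D) = card (\<Union>F)"
proof -
  obtain f where f: "inj_on f (\<Union>F)" "D = (\<lambda>e. f ` e) ` F" using D by (auto simp: is_copy_def)
  note ci = card_image_edges[OF f(1)]
  have fin: "finite F" "\<And>e. e \<in> F \<Longrightarrow> finite e \<and> card e = k" using F by (auto simp: balanced_def)
  show c: "card D = card F" "card (\<Union>D) = card (\<Union>F)" using ci[of F] f(2) by auto
  have "finite e \<and> card e = k" if "e \<in> D" for e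
  proof -
    obtain e0 where e0: "e0 \<in> F" "e = f ` e0" using \<open>e \<in> D\<close> f(2) by auto
    have "inj_on f e0" by (rule inj_on_subset[OF f(1)]) (use e0 in auto)
    then show ?thesis using fin(2)[OF e0(1)] e0(2) by (simp add: card_image)
  qed
  moreover have "\<kappa> < excess \<alpha> J" if J: "J \<subset> D" "s \<le> card J" for J
  proof -
    define J0 where "J0 = {e \<in> F. f ` e \<in> J}"
    have J0: "J = (\<lambda>e. f ` e) ` J0" "J0 \<subseteq> F" using J f(2) by (auto simp: J0_def)
    then have "J0 \<subset> F" using J f(2) by auto
    moreover have "card J = card J0" "card (\<Union>J) = card (\<Union>J0)" using ci[OF J0(2)] J0(1) by auto
    ultimately show ?thesis using F J(2) by (auto simp: balanced_def excess_def)
  qed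
  ultimately show "balanced k \<alpha> \<kappa> s D"
    using F c fin f(2) unfolding balanced_def excess_def by auto
qed

lemma subhypergraph_edges:
  assumes "kgraph k H" "E \<subseteq> edges H"
  shows "subhypergraph (Hypergraph (\<Union>E) E) H"
  using assms unfolding subhypergraph_def kgraph_def by auto

lemma kgraph_finite_edges: "kgraph k H \<Longrightarrow> finite (edges H)"
  unfolding kgraph_def by (meson Pow_iff finite_Pow_iff finite_subset subsetI)

lemma card_Union_two_edges:
  assumes "finite E" "\<And>e. e \<in> E \<Longrightarrow> finite e \<and> card e = k" "2 \<le> card E"
  shows "k + 1 \<le> card (\<Union>E)"
proof -
  have "\<not> card E \<le> Suc 0" using assms(3) by simp
  then obtain e e' where e: "e \<in> E" "e' \<in> E" "e \<noteq> e'"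
    using card_le_Suc0_iff_eq[OF assms(1)] by blast
  have finU: "finite (\<Union>E)" using assms by auto
  have "f = \<Union>E" if "f \<in> E" "\<not> k + 1 \<le> card (\<Union>E)" for f
  proof (rule card_subset_eq[OF finU])
    show "f \<subseteq> \<Union>E" using that by auto
    then have "card f \<le> card (\<Union>E)" by (rule card_mono[OF finU])
    then show "card f = card (\<Union>E)" using that assms(2)[OF that(1)] by simp
  qed
  then show ?thesis using e by metis
qed

lemma max_dens_k:
  assumes "kgraph k H"
  shows "subhypergraph J H \<Longrightarrow> dens_k k J \<le> max_dens_k k H"
    and "\<exists>J. subhypergraph J H \<and> dens_k k J = max_dens_k k H"
proof -
  have eq: "{dens_k k J |J. subhypergraph J H} = dens_k k ` {J. subhypergraph J H}" by auto
  have fin: "finite {dens_k k J |J. subhypergraph J H}"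
    unfolding eq using finite_subhypergraphs[OF assms] by simp
  show "dens_k k J \<le> max_dens_k k H" if "subhypergraph J H"
    unfolding max_dens_k_def by (rule Max_ge[OF fin]) (use that in auto)
  have "max_dens_k k H \<in> {dens_k k J |J. subhypergraph J H}"
    unfolding max_dens_k_def by (rule Max_in[OF fin]) (use subhypergraph_refl[OF assms] in auto)
  then show "\<exists>J. subhypergraph J H \<and> dens_k k J = max_dens_k k H" by auto
qed

lemma max_dens_k2:
  assumes "kgraph k H"
  shows "subhypergraph J H \<Longrightarrow> dens_k2 k J H2 \<le> max_dens_k2 k H H2"
    and "\<exists>J. subhypergraph J H \<and> dens_k2 k J H2 = max_dens_k2 k H H2"
proof -
  have eq: "{dens_k2 k J H2 |J. subhypergraph J H} = (\<lambda>J. dens_k2 k J H2) ` {J. subhypergraph J H}" by auto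
  have fin: "finite {dens_k2 k J H2 |J. subhypergraph J H}"
    unfolding eq using finite_subhypergraphs[OF assms] by simp
  show "dens_k2 k J H2 \<le> max_dens_k2 k H H2" if "subhypergraph J H"
    unfolding max_dens_k2_def by (rule Max_ge[OF fin]) (use that in auto)
  have "max_dens_k2 k H H2 \<in> {dens_k2 k J H2 |J. subhypergraph J H}"
    unfolding max_dens_k2_def by (rule Max_in[OF fin]) (use subhypergraph_refl[OF assms] in auto)
  then show "\<exists>J. subhypergraph J H \<and> dens_k2 k J H2 = max_dens_k2 k H H2" by auto
qed

lemma max_dens_attained:
  assumes "kgraph k H"
  shows "\<exists>J. subhypergraph J H \<and> dens J = max_dens H"
proof -
  have eq: "{dens J |J. subhypergraph J H} = dens ` {J. subhypergraph J H}" by auto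
  have fin: "finite {dens J |J. subhypergraph J H}"
    unfolding eq using finite_subhypergraphs[OF assms] by simp
  have "max_dens H \<in> {dens J |J. subhypergraph J H}"
    unfolding max_dens_def by (rule Max_in[OF fin]) (use subhypergraph_refl[OF assms] in auto)
  then show ?thesis by auto
qed

lemma dens_k_gt_1:
  assumes "1 \<le> k" "dens_k k J > 1"
  shows "nonempty J" "vc J \<ge> k + 1" "real (ec J) - 1 = dens_k k J * (real (vc J) - real k)" "ec J \<ge> 2"
proof -
  have "1 / real k \<le> 1" using assms(1) by simp
  then have *: "nonempty J \<and> vc J \<ge> k + 1"
    using assms(2) unfolding dens_k_def by (auto split: if_splits)
  then show "nonempty J" "vc J \<ge> k + 1" by auto
  show eq: "real (ec J) - 1 = dens_k k J * (real (vc J) - real k)"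
    using * by (simp add: dens_k_def)
  have "1 * 1 < dens_k k J * (real (vc J) - real k)"
    using * assms(2) by (intro mult_less_le_imp_less) auto
  then show "ec J \<ge> 2" using eq by linarith
qed

lemma subhypergraph_ec_le:
  assumes "kgraph k H" "subhypergraph J H"
  shows "ec J \<le> ec H" "vc J \<le> vc H"
  using assms kgraph_finite_edges[OF assms(1)]
  by (auto simp: ec_def vc_def subhypergraph_def kgraph_def intro: card_mono)

text \<open>For at least two edges, \<open>(e - 1) / (v - k) < m\<close> rearranges to
  \<open>k - 1 / m < v - e / m\<close>; this is why \<open>s = 2\<close>.\<close>

lemma strictly_k_balanced_balanced:
  assumes H: "kgraph k H" "strictly_k_balanced k H" and m: "m = max_dens_k k H" "m > 1" and "1 \<le> k"
  shows "balanced k (1 / m) (real k - 1 / m) 2 (edges H)" "card (edges H) \<ge> 2"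
proof -
  have fin: "finite (edges H)" "\<And>e. e \<in> edges H \<Longrightarrow> finite e \<and> card e = k"
    using kgraph_finite_edges[OF H(1)] H(1) by (auto simp: kgraph_def intro: finite_subset)
  have dH: "dens_k k H = m"
    using max_dens_k(2)[OF H(1)] H(2) m unfolding strictly_k_balanced_def by force
  have H': "real (ec H) - 1 = m * (real (vc H) - real k)" "ec H \<ge> 2"
    using dens_k_gt_1[of k H] dH m \<open>1 \<le> k\<close> by auto
  then show c2: "card (edges H) \<ge> 2" by (simp add: ec_def)
  have U: "k + 1 \<le> card (\<Union>E)" if "E \<subseteq> edges H" "2 \<le> card E" for E
    using that fin by (intro card_Union_two_edges) (auto intro: finite_subset)
  have d: "dens_k k (Hypergraph (\<Union>E) E) = (real (card E) - 1) / (real (card (\<Union>E)) - real k)"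
    if "E \<subseteq> edges H" "2 \<le> card E" for E
    using U[OF that] that by (auto simp: dens_k_def nonempty_def vc_def ec_def)
  \<comment> \<open>\<open>vc H\<close> counts isolated vertices and \<open>excess\<close> does not.
    There are none, since deleting them would push the density above its maximum
    \<open>m\<close>.\<close>
  have "(real (ec H) - 1) / (real (card (\<Union>(edges H))) - real k) \<le> m"
    using max_dens_k(1)[OF H(1) subhypergraph_edges[OF H(1) order_refl]] d[OF order_refl c2] m
    by (simp add: ec_def)
  then have "real (ec H) - 1 \<le> m * (real (card (\<Union>(edges H))) - real k)"
    using U[OF order_refl c2] by (simp add: divide_simps split: if_splits)
  then have "real (vc H) \<le> real (card (\<Union>(edges H)))" using H' m by simp
  moreover have "card (\<Union>(edges H)) \<le> vc H"
    unfolding vc_def using H(1) by (intro card_mono) (auto simp: kgraph_def)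
  ultimately have "real (card (\<Union>(edges H))) = real (vc H)" by linarith
  then have lamH: "excess (1 / m) (edges H) = real k - 1 / m"
    using H'(1) m(2) by (simp add: excess_def ec_def field_simps)
  have "real k - 1 / m < excess (1 / m) J" if J: "J \<subset> edges H" "2 \<le> card J" for J
  proof -
    have J': "J \<subseteq> edges H" using J by auto
    have "dens_k k (Hypergraph (\<Union>J) J) < m"
      using H(2) subhypergraph_edges[OF H(1) J'] J m unfolding strictly_k_balanced_def by force
    then have "real (card J) - 1 < m * (real (card (\<Union>J)) - real k)"
      using d[OF J' J(2)] U[OF J' J(2)] by (simp add: divide_simps split: if_splits)
    then have "(real (card J) - 1) / m < real (card (\<Union>J)) - real k"
      using m(2) by (simp add: pos_divide_less_eq mult.commute)
    then show ?thesis by (simp add: excess_def diff_divide_distrib)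
  qed
  then show "balanced k (1 / m) (real k - 1 / m) 2 (edges H)"
    using fin lamH unfolding balanced_def by auto
qed

text \<open>Now \<open>e / (v - k + 1 / m) < \<theta>\<close> rearranges to
  \<open>k - 1 / m < v - e / \<theta>\<close>, and it is available for single edges too, whence
  \<open>s = 1\<close>.\<close>

lemma strictly_balanced_wrt_balanced:
  assumes H: "kgraph k H" "strictly_balanced_wrt k H H2" "nonempty H2"
    and m: "m = max_dens_k k H2" "m > 1" and "max_dens_k k H > 1" and "1 \<le> k"
    and \<theta>: "\<theta> = max_dens_k2 k H H2"
  shows "balanced k (1 / \<theta>) (real k - 1 / m) 1 (edges H)" "card (edges H) \<ge> 2" "\<theta> > 0"
proof -
  have fin: "finite (edges H)" "\<And>e. e \<in> edges H \<Longrightarrow> finite e \<and> card e = k"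
    using kgraph_finite_edges[OF H(1)] H(1) by (auto simp: kgraph_def intro: finite_subset)
  obtain J where J: "subhypergraph J H" "dens_k k J = max_dens_k k H" using max_dens_k(2)[OF H(1)] by blast
  note J' = dens_k_gt_1[OF \<open>1 \<le> k\<close>, of J]
  have J2: "vc J \<ge> k + 1" "ec J \<ge> 2" using J' J(2) assms(6) by auto
  show c2: "card (edges H) \<ge> 2" using subhypergraph_ec_le[OF H(1) J(1)] J2 by (simp add: ec_def)
  have pos: "0 < real u - real k + 1 / m" if "k \<le> u" for u
    using that m(2) by (intro add_nonneg_pos) auto
  have "0 < dens_k2 k J H2" using J2 H(3) pos[of "vc J"] m by (simp add: dens_k2_def)
  then show \<theta>0: "\<theta> > 0" using max_dens_k2(1)[OF H(1) J(1), of H2] \<theta> by linarith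
  have dH: "dens_k2 k H H2 = \<theta>"
    using max_dens_k2(2)[OF H(1)] H(2) \<theta> unfolding strictly_balanced_wrt_def by force
  have vH: "vc H \<ge> k" using subhypergraph_ec_le[OF H(1) J(1)] J2 by simp
  have eH: "real (ec H) = \<theta> * (real (vc H) - real k + 1 / m)"
  proof -
    have "real (ec H) / (real (vc H) - real k + 1 / m) = \<theta>"
      using dH vH H(3) m(1) by (simp add: dens_k2_def)
    then show ?thesis using pos[OF vH] by (metis less_irrefl nonzero_divide_eq_eq)
  qed
  have U: "k \<le> card (\<Union>E)" if "E \<subseteq> edges H" "1 \<le> card E" for E
  proof -
    have finE: "finite E" using fin(1) that(1) finite_subset by blast
    have "E \<noteq> {}" using that(2) by auto
    then obtain e where e: "e \<in> E" by auto
    have "finite (\<Union>E)" using finE fin(2) that(1) by blast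
    then have "card e \<le> card (\<Union>E)" using e by (intro card_mono) auto
    then show ?thesis using fin(2) e that(1) by auto
  qed
  have d: "dens_k2 k (Hypergraph (\<Union>E) E) H2 = real (card E) / (real (card (\<Union>E)) - real k + 1 / m)"
    if "E \<subseteq> edges H" "1 \<le> card E" for E
    using U[OF that] H(3) m(1) by (simp add: dens_k2_def vc_def ec_def)
  have c1: "1 \<le> card (edges H)" using c2 by simp
  have "real (ec H) / (real (card (\<Union>(edges H))) - real k + 1 / m) \<le> \<theta>"
    using max_dens_k2(1)[OF H(1) subhypergraph_edges[OF H(1) order_refl], of H2] d[OF order_refl c1] \<theta>
    by (simp add: ec_def)
  then have "real (ec H) \<le> \<theta> * (real (card (\<Union>(edges H))) - real k + 1 / m)"
    using pos[OF U[OF order_refl c1]] by (simp add: pos_divide_le_eq)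
  then have "real (vc H) \<le> real (card (\<Union>(edges H)))" using eH \<theta>0 by simp
  moreover have "card (\<Union>(edges H)) \<le> vc H"
    unfolding vc_def using H(1) by (intro card_mono) (auto simp: kgraph_def)
  ultimately have "real (card (\<Union>(edges H))) = real (vc H)" by linarith
  then have lamH: "excess (1 / \<theta>) (edges H) = real k - 1 / m"
    using eH \<theta>0 by (simp add: excess_def ec_def)
  have "real k - 1 / m < excess (1 / \<theta>) J" if J: "J \<subset> edges H" "1 \<le> card J" for J
  proof -
    have J': "J \<subseteq> edges H" using J by auto
    have "dens_k2 k (Hypergraph (\<Union>J) J) H2 < \<theta>"
      using H(2) subhypergraph_edges[OF H(1) J'] J \<theta> unfolding strictly_balanced_wrt_def by force
    then have "real (card J) < \<theta> * (real (card (\<Union>J)) - real k + 1 / m)"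
      using d[OF J' J(2)] pos[OF U[OF J' J(2)]] by (simp add: pos_divide_less_eq)
    then have "real (card J) / \<theta> < real (card (\<Union>J)) - real k + 1 / m"
      using \<theta>0 by (simp add: pos_divide_less_eq mult.commute)
    then show ?thesis by (simp add: excess_def)
  qed
  then show "balanced k (1 / \<theta>) (real k - 1 / m) 1 (edges H)"
    using fin lamH unfolding balanced_def by auto
qed

text \<open>For more than \<open>k\<close> vertices, \<open>(e - 1) / (v - k) \<le> m\<close> and
  \<open>e / (v - k + 1 / m) \<le> m\<close> are the same inequality, so both maxima agree in the
  symmetric case.\<close>

lemma max_dens_k2_eq:
  assumes H: "kgraph k H" "nonempty H2"
    and m: "m = max_dens_k k H2" "m = max_dens_k k H" "m > 1" and "1 \<le> k"
  shows "max_dens_k2 k H H2 = m"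
proof (rule antisym)
  have pos: "0 < real u - real k + 1 / m" if "k \<le> u" for u
    using that m(3) by (intro add_nonneg_pos) auto
  obtain J where J: "subhypergraph J H" "dens_k2 k J H2 = max_dens_k2 k H H2"
    using max_dens_k2(2)[OF H(1)] by blast
  show "max_dens_k2 k H H2 \<le> m"
  proof (cases "vc J \<ge> k \<and> nonempty J")
    case True
    have "real (ec J) \<le> m * (real (vc J) - real k) + 1"
    \<comment> \<open>On exactly \<open>k\<close> vertices \<open>dens_k\<close> takes a special
      value, but there is at most one edge.\<close>
    proof (cases "vc J = k")
      case True
      have "edges J \<subseteq> {verts J}"
      proof
        fix e assume e: "e \<in> edges J"
        then have "e \<subseteq> verts J" "card e = k" using J(1) H(1) by (auto simp: subhypergraph_def kgraph_def)
        moreover have "finite (verts J)" using J(1) H(1) by (auto simp: subhypergraph_def kgraph_def intro: finite_subset)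
        ultimately have "e = verts J" using True by (intro card_subset_eq) (auto simp: vc_def)
        then show "e \<in> {verts J}" by simp
      qed
      then have "ec J \<le> 1" unfolding ec_def using card_mono[of "{verts J}" "edges J"] by simp
      then show ?thesis using True by simp
    next
      case False
      then have "k + 1 \<le> vc J" using \<open>vc J \<ge> k \<and> nonempty J\<close> by simp
      moreover have "dens_k k J \<le> m" using max_dens_k(1)[OF H(1) J(1)] m by simp
      ultimately have "(real (ec J) - 1) / (real (vc J) - real k) \<le> m"
        using \<open>vc J \<ge> k \<and> nonempty J\<close> by (simp add: dens_k_def)
      then have "real (ec J) - 1 \<le> m * (real (vc J) - real k)"
        using \<open>k + 1 \<le> vc J\<close> by (simp add: pos_divide_le_eq)
      then show ?thesis by simp
    qed
    also have "\<dots> = m * (real (vc J) - real k + 1 / m)" using m(3) by (simp add: algebra_simps)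
    finally have "real (ec J) / (real (vc J) - real k + 1 / m) \<le> m"
      using True pos[of "vc J"] by (simp add: pos_divide_le_eq)
    then show ?thesis using J(2) True H(2) m(1) by (simp add: dens_k2_def)
  next
    case False
    then have "dens_k2 k J H2 = 0" by (auto simp: dens_k2_def ec_def nonempty_def)
    then show ?thesis using J(2) m(3) by simp
  qed
  obtain J where J: "subhypergraph J H" "dens_k k J = m"
    using max_dens_k(2)[OF H(1)] m by metis
  note J' = dens_k_gt_1[OF \<open>1 \<le> k\<close>, of J, unfolded J(2), OF m(3)]
  have "real (ec J) = m * (real (vc J) - real k + 1 / m)" using J'(3) m(3) by (simp add: algebra_simps)
  then have "dens_k2 k J H2 = m" using J'(2) H(2) m(1) pos[of "vc J"] by (simp add: dens_k2_def)
  then show "m \<le> max_dens_k2 k H H2" using max_dens_k2(1)[OF H(1) J(1), of H2] by simp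
qed

lemma heart_balanced:
  assumes h: "heart k H1 H2" and m: "m = max_dens_k k H2" "m > 1" and "1 \<le> k"
    and \<theta>: "\<theta> = max_dens_k2 k H1 H2"
  shows "\<exists>s. balanced k (1 / \<theta>) (real k - 1 / m) s (edges H1) \<and> (s = 1 \<or> 1 / \<theta> = 1 / m)"
    "balanced k (1 / m) (real k - 1 / m) 2 (edges H2)"
    "card (edges H1) \<ge> 2" "card (edges H2) \<ge> 2" "0 < 1 / \<theta>" "1 / \<theta> < 1" "1 / \<theta> \<in> \<rat>"
proof -
  have H: "kgraph k H1" "kgraph k H2" "strictly_k_balanced k H2" "max_dens_k k H1 \<ge> m"
    using h m by (auto simp: heart_def)
  show b2: "balanced k (1 / m) (real k - 1 / m) 2 (edges H2)" and c2: "card (edges H2) \<ge> 2"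
    using strictly_k_balanced_balanced[OF H(2,3) m \<open>1 \<le> k\<close>] by auto
  have ne: "nonempty H2" using c2 by (auto simp: nonempty_def)
  have "\<exists>s. balanced k (1 / \<theta>) (real k - 1 / m) s (edges H1) \<and> (s = 1 \<or> 1 / \<theta> = 1 / m) \<and>
     card (edges H1) \<ge> 2 \<and> \<theta> > 0 \<and> 1 / \<theta> < 1"
  proof (cases "max_dens_k k H1 = m")
    case True
    then have "strictly_k_balanced k H1" using h m by (simp add: heart_def)
    note b1 = strictly_k_balanced_balanced[OF H(1) this True[symmetric] m(2) \<open>1 \<le> k\<close>]
    have "\<theta> = m" unfolding \<theta> by (rule max_dens_k2_eq[OF H(1) ne m(1) True[symmetric] m(2) \<open>1 \<le> k\<close>])
    then show ?thesis using b1 m(2) by auto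
  next
    case False
    then have gt: "max_dens_k k H1 > m" using H(4) by simp
    then have "strictly_balanced_wrt k H1 H2" using h m by (simp add: heart_def)
    note b1 = strictly_balanced_wrt_balanced[OF H(1) this ne m _ \<open>1 \<le> k\<close> \<theta>]
    have b1': "balanced k (1 / \<theta>) (real k - 1 / m) 1 (edges H1)" "card (edges H1) \<ge> 2" "\<theta> > 0"
      using b1 gt m(2) by auto
    obtain e where e: "e \<in> edges H1" using b1'(2) by fastforce
    have "edges H1 \<noteq> {e}"
    proof
      assume "edges H1 = {e}"
      then have "card (edges H1) = 1" by simp
      then show False using b1'(2) by simp
    qed
    then have "{e} \<subset> edges H1" using e by auto
    \<comment> \<open>Strictness for a single edge, whose excess is \<open>k - 1 / \<theta>\<close>,
      yields \<open>\<theta> > m\<close>.\<close>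
    then have "real k - 1 / m < excess (1 / \<theta>) {e}" using b1'(1) by (simp add: balanced_def)
    moreover have "card e = k" using e b1'(1) by (simp add: balanced_def)
    ultimately have "1 / \<theta> < 1 / m" by (simp add: excess_def)
    also have "\<dots> < 1" using m(2) by simp
    finally show ?thesis using b1' by auto
  qed
  then obtain s where s: "balanced k (1 / \<theta>) (real k - 1 / m) s (edges H1)" "s = 1 \<or> 1 / \<theta> = 1 / m"
     "card (edges H1) \<ge> 2" "\<theta> > 0" "1 / \<theta> < 1" by blast
  show "\<exists>s. balanced k (1 / \<theta>) (real k - 1 / m) s (edges H1) \<and> (s = 1 \<or> 1 / \<theta> = 1 / m)" using s by blast
  show "card (edges H1) \<ge> 2" "0 < 1 / \<theta>" "1 / \<theta> < 1" using s by auto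
  \<comment> \<open>Both excess identities are linear in \<open>1 / m\<close> and
    \<open>1 / \<theta>\<close> with integer coefficients apart from \<open>1 / m\<close> itself;
    solving them in turn gives rationality.\<close>
  have "1 / m * (real (card (edges H2)) - 1) = real (card (\<Union>(edges H2))) - real k"
    using b2 by (simp add: balanced_def excess_def algebra_simps)
  then have "1 / m = (real (card (\<Union>(edges H2))) - real k) / (real (card (edges H2)) - 1)"
    using c2 by (simp add: eq_divide_eq)
  then have rm: "1 / m \<in> \<rat>" by simp
  have "1 / \<theta> * real (card (edges H1)) = real (card (\<Union>(edges H1))) - real k + 1 / m"
    using s(1) by (simp add: balanced_def excess_def algebra_simps)
  then have "1 / \<theta> = (real (card (\<Union>(edges H1))) - real k + 1 / m) / real (card (edges H1))"
    using s(3) by (simp only: eq_divide_eq) auto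
  moreover have "\<dots> \<in> \<rat>" by (rule Rats_divide[OF Rats_add[OF Rats_diff rm]]) auto
  ultimately show "1 / \<theta> \<in> \<rat>" by simp
qed

section \<open>Colouring sparse hypergraphs\<close>

text \<open>A copy of H2 made of crossing edges only would pull \<open>\<psi>\<close> back to a weak
  colouring of H2 with \<open>k\<close> colours.\<close>

lemma chromatic_colouring:
  fixes C :: "'v set set"
  assumes k: "k \<ge> 3" and \<alpha>: "0 < \<alpha>" "\<alpha> < 1" and \<kappa>: "\<kappa> < real k" "real k - 1 < \<kappa>"
    and F1: "balanced k \<alpha> \<kappa> s F1" "card F1 \<ge> 2"
    and H2: "kgraph k H2" "weak_chromatic H2 \<ge> k + 1"
    and C: "finite C" "\<And>e. e \<in> C \<Longrightarrow> finite e \<and> card e = k"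
    and sparse: "\<And>S. S \<subseteq> C \<Longrightarrow> \<alpha> * real (card S) \<le> real (card (\<Union>S))"
  shows "\<exists>c. two_colouring {A. A \<subseteq> C \<and> is_copy F1 A} {B. B \<subseteq> C \<and> is_copy (edges H2) B} c"
proof -
  let ?\<A> = "{A. A \<subseteq> C \<and> is_copy F1 A}"
  have "finite (\<Union>C)" using C by auto
  have "\<exists>\<psi> :: 'v \<Rightarrow> nat. range \<psi> \<subseteq> {..<k} \<and>
      (\<forall>A\<in>?\<A>. \<Union>A \<subseteq> \<Union>C \<longrightarrow> (\<exists>e\<in>A. \<not> mono_edge \<psi> e))"
    by (rule vertex_partition[where w = "card (\<Union>F1)" and s = s, OF k \<alpha> \<kappa> _ C sparse \<open>finite (\<Union>C)\<close>])
      (use balanced_copy[OF F1(1)] F1(2) in auto)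
  then obtain \<psi> :: "'v \<Rightarrow> nat" where \<psi>: "range \<psi> \<subseteq> {..<k}"
    "\<forall>A\<in>?\<A>. \<Union>A \<subseteq> \<Union>C \<longrightarrow> (\<exists>e\<in>A. \<not> mono_edge \<psi> e)" by blast
  have "\<exists>e\<in>B. mono_edge \<psi> e" if B: "is_copy (edges H2) B" for B
  proof (rule ccontr)
    assume neg: "\<not> ?thesis"
    obtain f where f: "B = (\<lambda>e. f ` e) ` edges H2" using B by (auto simp: is_copy_def)
    have "weak_colouring H2 k (\<psi> \<circ> f)"
      unfolding weak_colouring_def
    proof (intro conjI notI)
      show "(\<psi> \<circ> f) ` verts H2 \<subseteq> {..<k}" using \<psi>(1) by auto
      assume "\<exists>e\<in>edges H2. \<exists>s. \<forall>v\<in>e. (\<psi> \<circ> f) v = s"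
      then obtain e s where "e \<in> edges H2" "\<forall>v\<in>e. \<psi> (f v) = s" by auto
      then have "f ` e \<in> B" "mono_edge \<psi> (f ` e)" by (auto simp: f mono_edge_def)
      then show False using neg by blast
    qed
    then have "\<exists>c. weak_colouring H2 k c" by blast
    then have "weak_chromatic H2 \<le> k" unfolding weak_chromatic_def by (rule Least_le)
    then show False using H2(2) by simp
  qed
  moreover have "\<exists>e\<in>A. \<not> mono_edge \<psi> e" if "A \<in> ?\<A>" for A using \<psi>(2) that by blast
  ultimately show ?thesis unfolding two_colouring_def by (intro exI[of _ "mono_edge \<psi>"]) blast
qed

text \<open>Because \<open>\<theta> * u = e + k * \<theta> - \<theta> / m\<close>, it suffices that
  \<open>k * \<theta> \<le> u * ((u - 1) choose (k - 2))\<close>. This follows from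
  \<open>\<theta> * (u - k) \<le> e \<le> u choose k\<close> by absorbing twice in the binomial
  coefficient.\<close>

lemma density_drop:
  assumes "3 \<le> k" "k + 1 \<le> u" "m > 1" "real e = \<theta> * (real u - real k + 1 / m)" "e \<le> u choose k"
  shows "\<theta> * real u \<le> real e + real u * real ((u - 1) choose (k - 2))"
proof -
  let ?b = "real ((u - 1) choose (k - 2))"
  have pos: "0 < real u - real k" using assms(2) by simp
  have pos': "0 < real u - real k + 1 / m" using pos assms(3) by (intro add_pos_pos) auto
  have \<theta>0: "\<theta> \<ge> 0" using assms(4) pos' by (metis of_nat_0_le_iff zero_le_mult_iff not_less)
  have "(k - 1) * ((u - 1) choose (k - 1)) = (u - 1) * ((u - 1 - 1) choose (k - 1 - 1))"
    using assms(1) by (intro times_binomial_minus1_eq) simp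
  also have "\<dots> = (u - 1 - (k - 2)) * ((u - 1) choose (k - 2))"
    using assms(1) binomial_absorb_comp[of "u - 1" "k - 2"] by (simp add: numeral_2_eq_2)
  finally have "real (k - 1) * real ((u - 1) choose (k - 1)) = real (u - 1 - (k - 2)) * ?b"
    by (metis of_nat_mult)
  then have 1: "(real k - 1) * real ((u - 1) choose (k - 1)) = (real u - real k + 1) * ?b"
    using assms(1,2) by (simp add: of_nat_diff)
  have "k * (u choose k) = u * ((u - 1) choose (k - 1))"
    using assms(1) by (intro times_binomial_minus1_eq) simp
  then have 2: "real k * real (u choose k) = real u * real ((u - 1) choose (k - 1))"
    by (metis of_nat_mult)
  have "\<theta> * (real u - real k) \<le> real e" using assms(3,4) \<theta>0 by (simp add: algebra_simps)
  then have "real k * (\<theta> * (real u - real k)) \<le> real k * real (u choose k)"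
    using assms(5) by (intro mult_left_mono) auto
  then have 3: "real k * (\<theta> * (real u - real k)) \<le> real u * real ((u - 1) choose (k - 1))" using 2 by simp
  have "(real k - 1) * (real k * \<theta> * (real u - real k)) \<le> (real k - 1) * (real u * real ((u - 1) choose (k - 1)))"
    using 3 assms(1) by (intro mult_left_mono) (auto simp: ac_simps)
  also have "\<dots> = (real u - real k + 1) * (real u * ?b)" using 1 by (simp add: ac_simps)
  also have "\<dots> \<le> ((real k - 1) * (real u - real k)) * (real u * ?b)"
  proof (rule mult_right_mono)
    \<comment> \<open>The place where \<open>k \<ge> 3\<close> enters: \<open>u - k + 1\<close> is
      at most twice \<open>u - k\<close>, and \<open>2 \<le> k - 1\<close>.\<close>
    have "real u - real k + 1 \<le> 2 * (real u - real k)" using assms(2) by simp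
    also have "\<dots> \<le> (real k - 1) * (real u - real k)" using assms(1) pos by (intro mult_right_mono) auto
    finally show "real u - real k + 1 \<le> (real k - 1) * (real u - real k)" .
  qed simp
  finally have "((real k - 1) * (real u - real k)) * (real k * \<theta>) \<le> ((real k - 1) * (real u - real k)) * (real u * ?b)"
    by (simp add: ac_simps)
  then have "real k * \<theta> \<le> real u * ?b" using assms(1) pos by (subst (asm) mult_le_cancel_left_pos) auto
  moreover have "\<theta> * real u = real e + real k * \<theta> - \<theta> / m" using assms(4) by (simp add: algebra_simps)
  moreover have "0 \<le> \<theta> / m" using \<theta>0 assms(3) by simp
  ultimately show ?thesis by linarith
qed

text \<open>\<open>X\<close> receives the second colour. A copy of F1 avoiding \<open>X\<close>
  would have at most \<open>(T - t) * u\<close> edges, fewer than \<open>density_drop\<close> grants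
  it; a copy of H2 inside \<open>X\<close> would have maximum density at most \<open>t\<close>. The
  summand 1 in \<open>t\<close> absorbs the rounding in \<open>T < \<theta> + 1\<close>.\<close>

lemma density_colouring:
  fixes C :: "'v set set"
  assumes k: "k \<ge> 3" and \<theta>: "\<theta> > 0" and "m > 1"
    and F1: "balanced k (1 / \<theta>) (real k - 1 / m) s F1" "card F1 \<ge> 2" "card (\<Union>F1) \<le> w"
    and H2: "kgraph k H2" "max_dens H2 > real (w choose (k - 2)) + 1"
    and C: "finite C" "\<And>e. e \<in> C \<Longrightarrow> finite e \<and> card e = k"
    and sparse: "\<And>S. S \<subseteq> C \<Longrightarrow> real (card S) \<le> \<theta> * real (card (\<Union>S))"
  shows "\<exists>c. two_colouring {A. A \<subseteq> C \<and> is_copy F1 A} {B. B \<subseteq> C \<and> is_copy (edges H2) B} c"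
proof -
  define T where "T = nat \<lceil>\<theta>\<rceil>"
  define t where "t = (w choose (k - 2)) + 1"
  have T: "\<theta> \<le> real T" "real T < \<theta> + 1" unfolding T_def using \<theta> by linarith+
  have "card S \<le> T * card (\<Union>S)" if "S \<subseteq> C" for S
  proof -
    have "real (card S) \<le> real T * real (card (\<Union>S))"
      using sparse[OF that] mult_right_mono[OF T(1), of "real (card (\<Union>S))"] by simp
    then show ?thesis by (metis of_nat_le_iff of_nat_mult)
  qed
  then obtain X where X: "X \<subseteq> C" "\<And>S. S \<subseteq> X \<Longrightarrow> card S \<le> t * card (\<Union>S)"
    "\<And>S. S \<subseteq> C - X \<Longrightarrow> card S \<le> (T - t) * card (\<Union>S)"
    using sparse_split[of C T t] C by metis
  have "\<exists>e\<in>A. e \<in> X" if A: "A \<subseteq> C" "is_copy F1 A" for A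
  proof (rule ccontr)
    assume "\<not> ?thesis"
    then have "A \<subseteq> C - X" using A by blast
    then have le: "card A \<le> (T - t) * card (\<Union>A)" by (rule X(3))
    note bA = balanced_copy[OF F1(1) A(2)]
    have cA: "card A \<ge> 2" "card (\<Union>A) \<le> w" using bA F1 by auto
    have finA: "finite A" "\<And>e. e \<in> A \<Longrightarrow> finite e \<and> card e = k" using bA(1) by (auto simp: balanced_def)
    define u where "u = card (\<Union>A)"
    have u: "k + 1 \<le> u" unfolding u_def using card_Union_two_edges[OF finA cA(1)] .
    have finU: "finite (\<Union>A)" using finA by auto
    have "card A \<le> card {e. e \<subseteq> \<Union>A \<and> card e = k}"
      using finU finA by (intro card_mono) auto
    then have ch: "card A \<le> u choose k" using n_subsets[OF finU, of k] by (simp add: u_def)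
    have eq: "real (card A) = \<theta> * (real u - real k + 1 / m)"
      using bA(1) \<theta> by (simp add: balanced_def excess_def u_def field_simps)
    have drop: "\<theta> * real u \<le> real (card A) + real u * real ((u - 1) choose (k - 2))"
      by (rule density_drop[OF k u \<open>m > 1\<close> eq ch])
    have "(u - 1) choose (k - 2) \<le> w choose (k - 2)"
      using cA(2) by (intro binomial_right_mono) (simp add: u_def)
    \<comment> \<open>For \<open>t \<ge> T\<close> the truncated difference would give
      \<open>card A \<le> 0\<close>.\<close>
    have "t < T"
    proof (rule ccontr)
      assume "\<not> t < T"
      then show False using le cA(1) by simp
    qed
    then have "real (T - t) = real T - real t" by simp
    also have "\<dots> < \<theta> - real (w choose (k - 2))" using T by (simp add: t_def)
    also have "\<dots> \<le> \<theta> - real ((u - 1) choose (k - 2))"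
      using \<open>(u - 1) choose (k - 2) \<le> w choose (k - 2)\<close> by simp
    finally have "real u * real (T - t) < real u * (\<theta> - real ((u - 1) choose (k - 2)))"
      using u by (intro mult_strict_left_mono) auto
    also have "\<dots> \<le> real (card A)" using drop by (simp add: algebra_simps)
    finally have "real ((T - t) * u) < real (card A)" by (simp add: mult.commute)
    then have "(T - t) * u < card A" by (simp only: of_nat_less_iff)
    then show False using le by (simp add: u_def)
  qed
  moreover have "\<exists>e\<in>B. e \<notin> X" if B: "is_copy (edges H2) B" for B
  proof (rule ccontr)
    assume "\<not> ?thesis"
    then have BX: "B \<subseteq> X" by blast
    obtain f where f: "inj_on f (\<Union>(edges H2))" "B = (\<lambda>e. f ` e) ` edges H2" using B by (auto simp: is_copy_def)
    obtain J where J: "subhypergraph J H2" "dens J = max_dens H2" using max_dens_attained[OF H2(1)] by blast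
    then have "dens J > real t" using H2(2) by (simp add: t_def)
    then have vJ: "vc J \<ge> 1" and dJ: "real (ec J) > real t * real (vc J)"
      by (auto simp: dens_def t_def pos_less_divide_eq split: if_splits)
    have sub: "edges J \<subseteq> edges H2" "\<Union>(edges J) \<subseteq> verts J" using J(1) by (auto simp: subhypergraph_def)
    have "finite (verts J)" using vJ by (intro card_ge_0_finite) (simp add: vc_def)
    then have cJ: "card (\<Union>(edges J)) \<le> vc J" unfolding vc_def using sub(2) by (intro card_mono)
    note ci = card_image_edges[OF f(1) sub(1)]
    have "(\<lambda>e. f ` e) ` edges J \<subseteq> X" using BX sub(1) f(2) by blast
    from X(2)[OF this] have "ec J \<le> t * card (\<Union>(edges J))" unfolding ci by (simp add: ec_def)
    also have "\<dots> \<le> t * vc J" using cJ by (intro mult_le_mono2)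
    finally have "real (ec J) \<le> real t * real (vc J)" by (metis of_nat_le_iff of_nat_mult)
    then show False using dJ by simp
  qed
  ultimately show ?thesis unfolding two_colouring_def by (intro exI[of _ "\<lambda>e. e \<notin> X"]) blast
qed

lemma isomorphic_copy:
  assumes "isomorphic H J" "subhypergraph H' H" "kgraph k H"
  obtains A where "is_copy (edges H') A" "A \<subseteq> edges J"
proof -
  obtain f where f: "bij_betw f (verts H) (verts J)" "(\<lambda>e. f ` e) ` edges H = edges J"
    using assms(1) by (auto simp: isomorphic_def)
  have "\<Union>(edges H') \<subseteq> verts H" using assms(2) by (fastforce simp: subhypergraph_def)
  then have "inj_on f (\<Union>(edges H'))" using f(1) by (meson bij_betw_def inj_on_subset)
  then have "is_copy (edges H') ((\<lambda>e. f ` e) ` edges H')" by (auto simp: is_copy_def)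
  moreover have "(\<lambda>e. f ` e) ` edges H' \<subseteq> edges J" using f(2) assms(2) by (auto simp: subhypergraph_def)
  ultimately show thesis by (rule that)
qed

text \<open>A two-colouring is read as a colouring by 1 and 2 only. As each \<open>H i\<close> has
  an edge, a monochromatic copy must have \<open>i = 1\<close> or \<open>i = 2\<close>, and it
  contains a copy of the corresponding subhypergraph.\<close>

lemma arrows_no_two_colouring:
  fixes G :: "'b hypergraph"
  assumes "arrows G r H" "r \<ge> 2" "\<forall>i\<in>{1..r}. kgraph k (H i) \<and> nonempty (H i)"
    and "subhypergraph H1' (H 1)" "subhypergraph H2' (H 2)"
  shows "\<nexists>c. two_colouring {A. A \<subseteq> edges G \<and> is_copy (edges H1') A} {B. B \<subseteq> edges G \<and> is_copy (edges H2') B} c"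
proof
  assume "\<exists>c. two_colouring {A. A \<subseteq> edges G \<and> is_copy (edges H1') A} {B. B \<subseteq> edges G \<and> is_copy (edges H2') B} c"
  then obtain c where "two_colouring {A. A \<subseteq> edges G \<and> is_copy (edges H1') A} {B. B \<subseteq> edges G \<and> is_copy (edges H2') B} c" ..
  then have c: "\<And>A. A \<subseteq> edges G \<Longrightarrow> is_copy (edges H1') A \<Longrightarrow> \<exists>e\<in>A. \<not> c e"
    "\<And>B. B \<subseteq> edges G \<Longrightarrow> is_copy (edges H2') B \<Longrightarrow> \<exists>e\<in>B. c e" by (simp_all add: two_colouring_def)
  define col :: "'b set \<Rightarrow> nat" where "col e = (if c e then 1 else 2)" for e
  have "col ` edges G \<subseteq> {1..r}" using assms(2) by (auto simp: col_def)
  then obtain i J where iJ: "i \<in> {1..r}" "subhypergraph J G" "isomorphic (H i) J" "\<forall>e\<in>edges J. col e = i"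
    using assms(1) unfolding arrows_def by blast
  have JG: "edges J \<subseteq> edges G" using iJ(2) by (auto simp: subhypergraph_def)
  have kH: "kgraph k (H i)" "nonempty (H i)" using assms(3) iJ(1) by auto
  obtain e0 where e0: "e0 \<in> edges J" using kH(2) iJ(3) by (fastforce simp: nonempty_def isomorphic_def)
  then consider "i = 1" | "i = 2" using iJ(4) by (auto simp: col_def split: if_splits)
  then show False
  proof cases
    case 1
    then obtain A where A: "is_copy (edges H1') A" "A \<subseteq> edges J"
      using isomorphic_copy[OF iJ(3) _ kH(1)] assms(4) by metis
    have "\<forall>e\<in>A. c e" using A(2) iJ(4) 1 by (auto simp: col_def split: if_splits)
    then show False using c(1)[of A] A JG by blast
  next
    case 2
    then obtain A where A: "is_copy (edges H2') A" "A \<subseteq> edges J"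
      using isomorphic_copy[OF iJ(3) _ kH(1)] assms(5) by metis
    have "\<forall>e\<in>A. \<not> c e" using A(2) iJ(4) 2 by (auto simp: col_def split: if_splits)
    then show False using c(2)[of A] A JG by blast
  qed
qed

theorem theorem1p7:
  fixes r k :: nat
    and H :: "nat \<Rightarrow> 'a hypergraph"
    and H1' H2' :: "'a hypergraph"
  assumes "r \<ge> 2" and "k \<ge> 3"
    and "\<forall>i\<in>{1..r}. kgraph k (H i) \<and> nonempty (H i)"
    and "\<forall>i\<in>{1..<r}. max_dens_k k (H i) \<ge> max_dens_k k (H (i + 1))"
    and "max_dens_k k (H 2) > 1"
    and "heart_of k H1' H2' (H 1) (H 2)"
    and "weak_chromatic H2' \<ge> k + 1 \<or>
         max_dens H2' > real (vc (H 1) choose (k - 2)) + 1"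
  shows "\<exists>b::real. b > 0 \<and>
    (\<forall>p :: nat \<Rightarrow> real.
       (\<forall>n. 0 \<le> p n \<and> p n \<le> 1) \<and>
       (\<forall>n\<ge>1. p n \<le> b * real n powr (- 1 / max_dens_k2 k (H 1) (H 2))) \<longrightarrow>
       (\<lambda>n. measure_pmf.prob (random_kgraph k n (p n)) {G. arrows G r H}) \<longlonglongrightarrow> 0)"
proof -
  define m where "m = max_dens_k k H2'"
  define \<theta> where "\<theta> = max_dens_k2 k H1' H2'"
  define \<alpha> where "\<alpha> = 1 / \<theta>"
  define \<kappa> where "\<kappa> = real k - 1 / m"
  note ho = assms(6)[unfolded heart_of_def]
  have heart: "heart k H1' H2'" and sub: "subhypergraph H1' (H 1)" "subhypergraph H2' (H 2)"
    and m2: "m = max_dens_k k (H 2)" using ho by (auto simp: m_def)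
  have "m > 1" "1 \<le> k" using m2 assms(2,5) by auto
  have kH: "kgraph k (H 1)" "kgraph k (H 2)" "nonempty (H 2)" using assms(1,3) by auto
  have kH': "kgraph k H1'" "kgraph k H2'" using heart by (auto simp: heart_def)
  note hb = heart_balanced[OF heart m_def \<open>m > 1\<close> \<open>1 \<le> k\<close> \<theta>_def, folded \<alpha>_def \<kappa>_def]
  have ne: "nonempty H2'" using hb(4) by (auto simp: nonempty_def)
  \<comment> \<open>When the two k-densities agree, a heart is only required to preserve
    \<open>max_dens_k\<close>; the exponent is recovered by applying \<open>max_dens_k2_eq\<close>
    to the pair and to its heart.\<close>
  have \<theta>: "max_dens_k2 k (H 1) (H 2) = \<theta>"
  proof (cases "max_dens_k k (H 1) > max_dens_k k (H 2)")
    case True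
    then show ?thesis using ho by (simp add: \<theta>_def)
  next
    case False
    have "1 \<in> {1..<r}" using assms(1) by auto
    then have "max_dens_k k (H 1) \<ge> max_dens_k k (H (1 + 1))" using assms(4) by blast
    then have "max_dens_k k (H 1) \<ge> max_dens_k k (H 2)" by (simp only: one_add_one)
    then have eq: "max_dens_k k (H 1) = max_dens_k k (H 2)" using False by simp
    then have "m = max_dens_k k (H 1)" "m = max_dens_k k H1'" using ho m2 by auto
    then have "max_dens_k2 k (H 1) (H 2) = m" "max_dens_k2 k H1' H2' = m"
      using max_dens_k2_eq[OF kH(1,3) m2 _ \<open>m > 1\<close> \<open>1 \<le> k\<close>]
        max_dens_k2_eq[OF kH'(1) ne m_def _ \<open>m > 1\<close> \<open>1 \<le> k\<close>] by auto
    then show ?thesis by (simp add: \<theta>_def)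
  qed
  have "\<theta> > 0" using hb(5) by (simp add: \<alpha>_def)
  obtain s where s: "balanced k \<alpha> \<kappa> s (edges H1')" "s = 1 \<or> \<alpha> = 1 / m" using hb(1) by blast
  define e1 e2 where "e1 = card (edges H1')" and "e2 = card (edges H2')"
  define M where "M = e1 + e2 + e2 * e1"
  have \<kappa>: "\<kappa> < real k" "real k - 1 < \<kappa>" using \<open>m > 1\<close> by (auto simp: \<kappa>_def)
  \<comment> \<open>The deterministic half: it holds for every graph in the support, so the limit
    follows by monotonicity of the probability.\<close>
  have key: "\<exists>C\<subseteq>edges G. explorable \<alpha> M C \<and> excess \<alpha> C < 0"
    if G: "G \<in> set_pmf (random_kgraph k n q)" and arr: "arrows G r H" for n q G
  proof -
    have EG: "edges G \<subseteq> all_edges k n" using G by (auto simp: random_kgraph_def)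
    then have finG: "finite (edges G)" using finite_all_edges finite_subset by blast
    let ?\<A> = "\<lambda>C. {A. A \<subseteq> C \<and> is_copy (edges H1') A}" and ?\<B> = "\<lambda>C. {B. B \<subseteq> C \<and> is_copy (edges H2') B}"
    have fin: "finite (?\<A> (edges G))" "finite (?\<B> (edges G))"
      using finG by (auto intro: finite_subset[of _ "Pow (edges G)"])
    obtain \<A> \<B> where sub': "\<A> \<subseteq> ?\<A> (edges G)" "\<B> \<subseteq> ?\<B> (edges G)" and crit: "critical \<A> \<B>"
      by (rule critical_exists[OF fin arrows_no_two_colouring[OF arr assms(1,3) sub]])
    define C where "C = \<Union>\<A> \<union> \<Union>\<B>"
    have CG: "C \<subseteq> edges G" using sub' by (auto simp: C_def)
    have expl: "explorable \<alpha> M C"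
      unfolding C_def M_def
    proof (rule critical_explorable[OF crit, where k = k and \<kappa> = \<kappa> and s = s and m = m])
      show "finite \<A>" "finite \<B>" using sub' fin finite_subset by blast+
      show "balanced k \<alpha> \<kappa> s A \<and> card A \<le> e1" if "A \<in> \<A>" for A
        using balanced_copy[OF s(1), of A] sub'(1) that by (auto simp: e1_def)
      show "balanced k (1 / m) \<kappa> 2 B \<and> card B \<le> e2" if "B \<in> \<B>" for B
        using balanced_copy[OF hb(2), of B] sub'(2) that by (auto simp: e2_def)
      show "\<kappa> \<noteq> 0" using \<kappa> assms(2) by auto
    qed (use s \<open>m > 1\<close> in auto)
    have "excess \<alpha> C < 0"
    proof (rule ccontr)
      assume "\<not> excess \<alpha> C < 0"
      have finC: "finite C" using finite_subset[OF CG finG] .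
      have eC: "finite e \<and> card e = k" if "e \<in> C" for e
        using all_edgesD[of e k n] that CG EG by auto
      have sparse: "\<alpha> * real (card S) \<le> real (card (\<Union>S))" if "S \<subseteq> C" for S
      proof (cases "S = {}")
        case False
        then show ?thesis
          using explorable_excess_le[OF expl False that] \<open>\<not> excess \<alpha> C < 0\<close> by (simp add: excess_def)
      qed simp
      have "\<exists>c. two_colouring (?\<A> C) (?\<B> C) c"
        using assms(7)
      proof
        assume "weak_chromatic H2' \<ge> k + 1"
        then show ?thesis
          by (intro chromatic_colouring[OF assms(2) hb(5,6) \<kappa> s(1) hb(3) kH'(2)] finC eC sparse)
      next
        assume dens: "max_dens H2' > real (vc (H 1) choose (k - 2)) + 1"
        show ?thesis
        proof (rule density_colouring[OF assms(2) \<open>\<theta> > 0\<close> \<open>m > 1\<close> s(1)[unfolded \<alpha>_def \<kappa>_def] hb(3) _ kH'(2) dens finC eC])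
          show "card (\<Union>(edges H1')) \<le> vc (H 1)" unfolding vc_def
            using sub(1) kH(1) by (intro card_mono) (auto simp: subhypergraph_def kgraph_def)
          show "real (card S) \<le> \<theta> * real (card (\<Union>S))" if "S \<subseteq> C" for S
            using sparse[OF that] \<open>\<theta> > 0\<close> by (simp add: \<alpha>_def pos_divide_le_eq mult.commute)
        qed
      qed
      then obtain c where c: "two_colouring (?\<A> C) (?\<B> C) c" ..
      \<comment> \<open>The colouring handles all copies inside \<open>C\<close>, in particular the
        critical system from which \<open>C\<close> was formed.\<close>
      have "\<A> \<subseteq> ?\<A> C" "\<B> \<subseteq> ?\<B> C" using sub' by (auto simp: C_def)
      then have "two_colouring \<A> \<B> c" using c unfolding two_colouring_def by blast
      then show False using criticalD(1)[OF crit] by blast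
    qed
    then show ?thesis using CG expl by blast
  qed
  obtain b :: real where "b > 0 \<and> (\<forall>p :: nat \<Rightarrow> real. (\<forall>n. 0 \<le> p n \<and> p n \<le> 1) \<and>
      (\<forall>n\<ge>1. p n \<le> b * real n powr (- \<alpha>)) \<longrightarrow>
      (\<lambda>n. measure_pmf.prob (random_kgraph k n (p n))
        {G. \<exists>C\<subseteq>edges G. explorable \<alpha> M C \<and> excess \<alpha> C < 0}) \<longlonglongrightarrow> 0)"
    using explorable_rare[OF hb(7,5), of k M] ..
  note b = conjunct1[OF this] and rare = conjunct2[OF this, THEN spec, THEN mp]
  show ?thesis
  proof (rule exI[of _ b], intro conjI allI impI)
    fix p :: "nat \<Rightarrow> real"
    assume p: "(\<forall>n. 0 \<le> p n \<and> p n \<le> 1) \<and>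
       (\<forall>n\<ge>1. p n \<le> b * real n powr (- 1 / max_dens_k2 k (H 1) (H 2)))"
    then have lim: "(\<lambda>n. measure_pmf.prob (random_kgraph k n (p n))
        {G. \<exists>C\<subseteq>edges G. explorable \<alpha> M C \<and> excess \<alpha> C < 0}) \<longlonglongrightarrow> 0"
      by (intro rare) (simp add: \<alpha>_def flip: \<theta>)
    show "(\<lambda>n. measure_pmf.prob (random_kgraph k n (p n)) {G. arrows G r H}) \<longlonglongrightarrow> 0"
    proof (rule tendsto_sandwich[OF _ _ tendsto_const lim])
      show "\<forall>\<^sub>F n in sequentially. measure_pmf.prob (random_kgraph k n (p n)) {G. arrows G r H} \<le>
          measure_pmf.prob (random_kgraph k n (p n)) {G. \<exists>C\<subseteq>edges G. explorable \<alpha> M C \<and> excess \<alpha> C < 0}"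
        by (intro always_eventually allI measure_pmf.finite_measure_mono_AE AE_pmfI)
          (use key in auto)
    qed (rule always_eventually, simp)
  qed (rule b)
qed

end
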